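(* Let $\Bbbk$ be an algebraically closed field of characteristic $0$ and let $1 \le r_1 \le \cdots \le r_n$ be integers. Assume that either $n=3$ and $r_1 \ge 2$, or $n \ge 4$. Then the divisor class group $\operatorname{Cl}(\Bbbk[K_{r_1,\ldots,r_n}])$ of the edge ring of the complete multipartite graph $K_{r_1,\ldots,r_n}$ is isomorphic to $\mathbb{Z}^n$ as a group.
   Context: $K_{r_1,\ldots,r_n}$ is the complete multipartite graph: its vertex set is a disjoint union $\bigsqcup_{i=1}^n V_i$ with $|V_i|=r_i$, and its edges are all $\{a,b\}$ with $a\in V_i$, $b\in V_j$, $i\ne j$. For a finite simple graph $G$ on the vertex set $\{1,\ldots,d\}$, the edge ring $\Bbbk[G]$ is the $\Bbbk$-subalgebra of the polynomial ring $\Bbbk[t_1,\ldots,t_d]$ generated by the monomials $t_it_j$ for all edges $\{i,j\}$ of $G$. (The edge ring of a complete multipartite graph is known to be a normal Cohen--Macaulay domain, so its divisor class group is defined.) *)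

theory Defs
  imports
    "HOL-Algebra.Algebra"
    "HOL-Algebra.Algebraic_Closure_Type"
    "HOL-Library.Poly_Mapping"
    "HOL-Library.Extended_Nat"
begin

section \<open>The divisor class group of a normal Noetherian domain\<close>

text \<open>The supremum of the lengths \<open>k\<close> of chains of primes
  \<open>Q 0 \<subset> \<dots> \<subset> Q k = P\<close>.\<close>

definition height :: "('a, 'b) ring_scheme \<Rightarrow> 'a set \<Rightarrow> enat" where
  "height R P = Sup {enat k | k Q. (\<forall>i\<le>k. primeideal (Q i) R) \<and>
                                   (\<forall>i<k. Q i \<subset> Q (Suc i)) \<and> Q k = P}"

definition height_one_primes :: "('a, 'b) ring_scheme \<Rightarrow> 'a set set" where
  "height_one_primes R = {P. primeideal P R \<and> height R P = 1}"

text \<open>For a domain \<open>R\<close>, this is the contraction to \<open>R\<close> of the \<open>n\<close>-th power of the maximal ideal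
  of the localization of \<open>R\<close> at \<open>P\<close>, written without fractions: \<open>a\<close> lies in \<open>P ^ n R_P\<close>
  iff \<open>a = c / s\<close> with \<open>c \<in> P ^ n\<close> and \<open>s \<in> R - P\<close>.  The power \<open>P ^ n\<close> is the usual
  power of ideals, with \<open>P ^ 0 = R\<close>.\<close>

definition local_power :: "('a, 'b) ring_scheme \<Rightarrow> 'a set \<Rightarrow> nat \<Rightarrow> 'a set" where
  "local_power R P n =
     {a \<in> carrier R. \<exists>s \<in> carrier R - P. s \<otimes>\<^bsub>R\<^esub> a \<in> P [^]\<^bsub>ideals_set R\<^esub> n}"

text \<open>The valuation of the local ring at \<open>P\<close> on nonzero elements of \<open>R\<close>.  If \<open>R\<close> is normal and
  Noetherian and \<open>P\<close> has height one, this local ring is a discrete valuation ring, so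
  that the maximum exists for \<open>a \<noteq> 0\<close>.\<close>

definition ord_at :: "('a, 'b) ring_scheme \<Rightarrow> 'a set \<Rightarrow> 'a \<Rightarrow> nat" where
  "ord_at R P a = (GREATEST n. a \<in> local_power R P n)"

definition divisor_group :: "('a, 'b) ring_scheme \<Rightarrow> ('a set \<Rightarrow>\<^sub>0 int) monoid" where
  "divisor_group R = free_Abelian_group (height_one_primes R)"

text \<open>The divisors of the nonzero elements \<open>a / b\<close> of the fraction field of \<open>R\<close>.\<close>

definition principal_divisors :: "('a, 'b) ring_scheme \<Rightarrow> ('a set \<Rightarrow>\<^sub>0 int) set" where
  "principal_divisors R =
     {D \<in> carrier (divisor_group R).
        \<exists>a \<in> carrier R - {\<zero>\<^bsub>R\<^esub>}. \<exists>b \<in> carrier R - {\<zero>\<^bsub>R\<^esub>}.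
          \<forall>P \<in> height_one_primes R.
            Poly_Mapping.lookup D P = int (ord_at R P a) - int (ord_at R P b)}"

definition divisor_class_group :: "('a, 'b) ring_scheme \<Rightarrow> ('a set \<Rightarrow>\<^sub>0 int) set monoid" where
  "divisor_class_group R = divisor_group R Mod principal_divisors R"


section \<open>Edge rings\<close>

text \<open>A polynomial is a finitely supported map from monomials to coefficients, a monomial
  being a finitely supported map from variables to exponents.\<close>

definition polynomial_ring :: "'v set \<Rightarrow> (('v \<Rightarrow>\<^sub>0 nat) \<Rightarrow>\<^sub>0 'k::field) ring" where
  "polynomial_ring V =
     ring_of_type_algebra\<lparr>carrier :=
       {p. \<forall>m \<in> Poly_Mapping.keys p. Poly_Mapping.keys m \<subseteq> V}\<rparr>"

definition pconst :: "'k \<Rightarrow> (('v \<Rightarrow>\<^sub>0 nat) \<Rightarrow>\<^sub>0 'k::field)" where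
  "pconst c = Poly_Mapping.single 0 c"

definition pvar :: "'v \<Rightarrow> (('v \<Rightarrow>\<^sub>0 nat) \<Rightarrow>\<^sub>0 'k::field)" where
  "pvar v = Poly_Mapping.single (Poly_Mapping.single v 1) 1"

text \<open>The subalgebra generated by a set is the subring generated by that set together with the
  constants.  (The locale \<open>subalgebra\<close> of HOL-Algebra describes linear subspaces and does not
  require closure under multiplication.)\<close>

definition edge_ring :: "'v set \<Rightarrow> 'v set set \<Rightarrow> (('v \<Rightarrow>\<^sub>0 nat) \<Rightarrow>\<^sub>0 'k::field) ring" where
  "edge_ring V E =
     (polynomial_ring V)\<lparr>carrier :=
       generate_ring (polynomial_ring V)
         (range pconst \<union> {pvar a \<otimes>\<^bsub>polynomial_ring V\<^esub> pvar b | a b. {a, b} \<in> E})\<rparr>"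


section \<open>Complete multipartite graphs\<close>

text \<open>The \<open>i\<close>-th part is \<open>{i} \<times> {1..r i}\<close>, for \<open>1 \<le> i \<le> n\<close>.\<close>

definition multipartite_verts :: "nat \<Rightarrow> (nat \<Rightarrow> nat) \<Rightarrow> (nat \<times> nat) set" where
  "multipartite_verts n r = (SIGMA i:{1..n}. {1..r i})"

definition multipartite_edges :: "nat \<Rightarrow> (nat \<Rightarrow> nat) \<Rightarrow> (nat \<times> nat) set set" where
  "multipartite_edges n r =
     {{a, b} | a b. a \<in> multipartite_verts n r \<and> b \<in> multipartite_verts n r \<and> fst a \<noteq> fst b}"

end

theory Submission
  imports Defs "HOL-Computational_Algebra.Polynomial" "HOL-Library.Product_Lexorder"
begin

text \<open>The edge ring is the monoid algebra of the monoid \<open>S\<close> of vectors \<open>m\<close> of even degree with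
  \<open>2 m(V\<^sub>i) \<le> |m|\<close> for every part.  Its facets are \<open>m\<^sub>v = 0\<close> for the vertices \<open>v\<close> and
  \<open>|m| / 2 = m(V\<^sub>i)\<close> for the parts.  After inverting all monomials one gets a factorial ring, so a
  prime of height one either contains a monomial, and then it is the prime of a facet, or it is
  generated up to monomials by a prime of the Laurent polynomial ring.  Hence (Nagata) the class
  group is the free abelian group on the facets modulo the image of the lattice of even vectors,
  which is \<open>\<int>\<^sup>n\<close>.\<close>

section \<open>Gauss's lemma for subrings of a domain\<close>

text \<open>The hypotheses on \<open>n\<close> and \<open>r\<close> make every inequality of the
  list a facet of its own: outside any vertex and any part an edge must remain
  (\<open>avoid\<close>). With three parts, the first a single vertex \<open>v\<close>, the weight
  of \<open>v\<close> would be the sum of the weights of the two other parts, so that its vanishing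
  would force both of these to vanish. No ring of fractions is formed. The localization at the
  monomials appears as divisibility up to a monomial factor, and its factoriality is imported from a
  polynomial ring inside the same type: the algebra of a free monoid that generates the same lattice
  of even vectors as \<open>S\<close>. Gauss's lemma is therefore developed relative to a subring.
  The quotient has no torsion because the image of the lattice is cut out by equations: weights come
  from an even vector exactly when, for some integer \<open>t\<close>, the vertex weights sum to
  \<open>2 t\<close> and, for each part, its own weight and those of its vertices sum to
  \<open>t\<close>. Eliminating \<open>t\<close> leaves \<open>n\<close> integral forms, which
  together take all values.\<close>

definition dvd_in :: "'a::comm_ring_1 set \<Rightarrow> 'a \<Rightarrow> 'a \<Rightarrow> bool" where
  "dvd_in A a b \<longleftrightarrow> (\<exists>c\<in>A. b = a * c)"

definition prime_in :: "'a::comm_ring_1 set \<Rightarrow> 'a \<Rightarrow> bool" where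
  "prime_in A p \<longleftrightarrow> p \<in> A \<and> p \<noteq> 0 \<and> \<not> dvd_in A p 1 \<and>
     (\<forall>a\<in>A. \<forall>b\<in>A. dvd_in A p (a * b) \<longrightarrow> dvd_in A p a \<or> dvd_in A p b)"

text \<open>Since the factors are prime and not merely irreducible, existence implies uniqueness.\<close>

definition factorial_in :: "'a::comm_ring_1 set \<Rightarrow> bool" where
  "factorial_in A \<longleftrightarrow> (\<forall>a\<in>A. a \<noteq> 0 \<longrightarrow>
     (\<exists>u ps. u \<in> A \<and> dvd_in A u 1 \<and> (\<forall>p\<in>set ps. prime_in A p) \<and> a = u * prod_list ps))"

text \<open>Subrings are sets in a fixed type because variables are adjoined one after another in
  \<open>factorial_star_monoid\<close>, and all the rings of that induction have to live in one
  type. Units and primes are relative to the set.\<close>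

locale idom_subring =
  fixes A :: "'a::idom set"
  assumes one_mem [simp, intro]: "1 \<in> A"
    and diff_mem [simp, intro]: "a \<in> A \<Longrightarrow> b \<in> A \<Longrightarrow> a - b \<in> A"
    and mult_mem [simp, intro]: "a \<in> A \<Longrightarrow> b \<in> A \<Longrightarrow> a * b \<in> A"
begin

lemma zero_mem [simp, intro]: "0 \<in> A"
  using diff_mem[of 1 1] by simp

lemma uminus_mem [simp, intro]: "a \<in> A \<Longrightarrow> - a \<in> A"
  using diff_mem[of 0 a] by simp

lemma add_mem [simp, intro]: "a \<in> A \<Longrightarrow> b \<in> A \<Longrightarrow> a + b \<in> A"
  using diff_mem[of a "- b"] by simp

lemma sum_mem: "(\<And>i. i \<in> I \<Longrightarrow> f i \<in> A) \<Longrightarrow> sum f I \<in> A"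
  by (induction I rule: infinite_finite_induct) auto

lemma prod_list_mem: "set xs \<subseteq> A \<Longrightarrow> prod_list xs \<in> A"
  by (induction xs) auto

lemma dvd_in_zero [simp]: "dvd_in A a 0"
  unfolding dvd_in_def by (rule bexI[of _ 0]) auto

lemma dvd_in_refl: "dvd_in A a a"
  unfolding dvd_in_def by (rule bexI[of _ 1]) auto

lemma dvd_in_mult: "dvd_in A a b \<Longrightarrow> c \<in> A \<Longrightarrow> dvd_in A a (b * c)"
  unfolding dvd_in_def by (metis mult.assoc mult_mem)

lemma dvd_in_mult2: "dvd_in A a b \<Longrightarrow> c \<in> A \<Longrightarrow> dvd_in A a (c * b)"
  by (metis dvd_in_mult mult.commute)

lemma dvd_in_add: "dvd_in A a b \<Longrightarrow> dvd_in A a c \<Longrightarrow> dvd_in A a (b + c)"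
  unfolding dvd_in_def by (metis add_mem distrib_left)

lemma dvd_in_diff: "dvd_in A a b \<Longrightarrow> dvd_in A a c \<Longrightarrow> dvd_in A a (b - c)"
  unfolding dvd_in_def by (metis diff_mem right_diff_distrib)

lemma dvd_in_sum: "(\<And>i. i \<in> I \<Longrightarrow> dvd_in A a (f i)) \<Longrightarrow> dvd_in A a (sum f I)"
  by (induction I rule: infinite_finite_induct) (auto intro: dvd_in_add)

lemma unit_mult: "dvd_in A u 1 \<Longrightarrow> dvd_in A v 1 \<Longrightarrow> dvd_in A (u * v) 1"
  unfolding dvd_in_def by (metis mult.assoc mult.left_commute mult.right_neutral mult_mem)

lemma prime_in_dvd_prod_list:
  assumes p: "prime_in A p" and ps: "set ps \<subseteq> A" and d: "dvd_in A p (prod_list ps)"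
  shows "\<exists>q\<in>set ps. dvd_in A p q"
  using ps d
proof (induction ps)
  case Nil
  then show ?case using p by (simp add: prime_in_def)
next
  case (Cons q ps)
  have "dvd_in A p q \<or> dvd_in A p (prod_list ps)"
    using Cons.prems p prod_list_mem[of ps] by (simp add: prime_in_def)
  then show ?case using Cons by auto
qed

text \<open>The prime \<open>p\<close> divides some factor \<open>q\<close>, and a prime dividing a
  prime differs from it by a unit, so \<open>q\<close> can be struck out. The strict drop in length
  is the termination measure of \<open>content_primitive_part\<close>.\<close>

lemma prime_in_cancel_factorization:
  assumes p: "prime_in A p" and ps: "\<forall>q\<in>set ps. prime_in A q" and u: "u \<in> A" "dvd_in A u 1"
    and b: "b \<in> A" and eq: "p * b = u * prod_list ps"
  obtains v qs where "v \<in> A" "dvd_in A v 1" "\<forall>q\<in>set qs. prime_in A q"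
    "length qs < length ps" "b = v * prod_list qs"
proof -
  have psA: "set ps \<subseteq> A" using ps by (auto simp: prime_in_def)
  obtain u' where u': "u' \<in> A" "1 = u * u'" using u(2) by (auto simp: dvd_in_def)
  have "prod_list ps = p * (b * u')" using eq u'(2)
    by (metis mult.assoc mult.commute mult.right_neutral)
  then have "dvd_in A p (prod_list ps)" using b u' by (auto simp: dvd_in_def)
  then obtain q where q: "q \<in> set ps" "dvd_in A p q"
    using prime_in_dvd_prod_list[OF p psA] by blast
  then obtain c where c: "c \<in> A" "q = p * c" by (auto simp: dvd_in_def)
  have qp: "prime_in A q" using ps q by auto
  have pA: "p \<in> A" "p \<noteq> 0" using p by (auto simp: prime_in_def)
  \<comment> \<open>As \<open>q = p * c\<close> is prime it divides \<open>p\<close> or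
    \<open>c\<close>. The first makes \<open>c\<close> a unit; the second would make
    \<open>p\<close> a unit.\<close>
  have "dvd_in A q p \<or> dvd_in A q c"
    using qp c pA dvd_in_refl unfolding prime_in_def by metis
  then have cu: "dvd_in A c 1"
  proof
    assume "dvd_in A q p"
    then obtain d where "d \<in> A" "p = p * c * d" using c by (auto simp: dvd_in_def)
    then have "1 = c * d" using pA by (simp add: mult.assoc)
    then show ?thesis using \<open>d \<in> A\<close> by (auto simp: dvd_in_def)
  next
    assume "dvd_in A q c"
    then obtain d where d: "d \<in> A" "c = p * c * d" using c by (auto simp: dvd_in_def)
    have "c \<noteq> 0" using c qp by (auto simp: prime_in_def)
    then have "1 = p * d" using d by (metis mult.assoc mult.left_commute mult_cancel_left2)
    then show ?thesis using d p by (auto simp: dvd_in_def prime_in_def)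
  qed
  have "prod_list ps = q * prod_list (remove1 q ps)"
    using q(1) by (induction ps) (auto simp: ac_simps)
  then have "p * b = p * (u * c * prod_list (remove1 q ps))" using eq c by (simp add: ac_simps)
  then have "b = (u * c) * prod_list (remove1 q ps)" using pA by simp
  moreover have "length (remove1 q ps) < length ps"
    using length_pos_if_in_set[OF q(1)] q(1) by (simp add: length_remove1)
  moreover have "\<forall>q\<in>set (remove1 q ps). prime_in A q" using ps set_remove1_subset by fast
  ultimately show thesis using that[of "u * c"] u c cu unit_mult by blast
qed

end

section \<open>Gauss's lemma: polynomials over a factorial subring\<close>

definition poly_over :: "'a::zero set \<Rightarrow> 'a poly set" where
  "poly_over A = {f. \<forall>i. coeff f i \<in> A}"

lemma (in idom_subring) idom_subring_poly_over: "idom_subring (poly_over A)"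
proof
  show "f * g \<in> poly_over A" if "f \<in> poly_over A" "g \<in> poly_over A" for f g
    using that by (auto simp: poly_over_def coeff_mult intro!: sum_mem)
qed (auto simp: poly_over_def coeff_1)

locale factorial_idom_subring = idom_subring +
  assumes factorial: "factorial_in A"
begin

sublocale PA: idom_subring "poly_over A"
  by (rule idom_subring_poly_over)

lemma const_mem_iff [simp]: "[:a:] \<in> poly_over A \<longleftrightarrow> a \<in> A"
  by (auto simp: poly_over_def coeff_pCons split: nat.splits)

lemma smult_mem [simp, intro]: "a \<in> A \<Longrightarrow> f \<in> poly_over A \<Longrightarrow> smult a f \<in> poly_over A"
  by (auto simp: poly_over_def)

lemma dvd_in_const_iff:
  assumes "a \<in> A" "f \<in> poly_over A"
  shows "dvd_in (poly_over A) [:a:] f \<longleftrightarrow> (\<forall>i. dvd_in A a (coeff f i))"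
proof
  assume "dvd_in (poly_over A) [:a:] f"
  then show "\<forall>i. dvd_in A a (coeff f i)" by (auto simp: dvd_in_def poly_over_def)
next
  assume *: "\<forall>i. dvd_in A a (coeff f i)"
  show "dvd_in (poly_over A) [:a:] f"
  \<comment> \<open>For \<open>a \<noteq> 0\<close> the quotients \<open>c i\<close> vanish wherever
    the coefficients of \<open>f\<close> do and so form a polynomial; for \<open>a = 0\<close> the
    chosen quotients may have infinite support.\<close>
  proof (cases "a = 0")
    case True
    then have "f = 0" using * by (auto simp: dvd_in_def poly_eq_iff)
    then show ?thesis by simp
  next
    case False
    from * obtain c where c: "\<And>i. c i \<in> A" "\<And>i. coeff f i = a * c i"
      unfolding dvd_in_def by metis
    have "\<forall>\<^sub>\<infinity>i. c i = 0"
      using MOST_coeff_eq_0[of f] False by (auto simp: c elim: MOST_mono)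
    then have "coeff (Abs_poly c) = c" by (rule Abs_poly_inverse[simplified])
    then have "Abs_poly c \<in> poly_over A" "f = [:a:] * Abs_poly c"
      using c by (auto simp: poly_over_def poly_eq_iff)
    then show ?thesis by (auto simp: dvd_in_def)
  qed
qed

text \<open>Gauss's argument: let \<open>i\<close> and \<open>j\<close> be the least indices at
  which \<open>p\<close> fails to divide the coefficients of \<open>f\<close> and \<open>g\<close>.
  In the coefficient of \<open>f * g\<close> at \<open>i + j\<close> every other term is divisible
  by \<open>p\<close>, so the term at \<open>(i, j)\<close> would have to be divisible as
  well.\<close>

lemma prime_in_const:
  assumes p: "prime_in A p"
  shows "prime_in (poly_over A) [:p:]"
proof -
  have pA: "p \<in> A" "p \<noteq> 0" using p by (auto simp: prime_in_def)
  have nu: "\<not> dvd_in (poly_over A) [:p:] 1"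
  proof
    assume "dvd_in (poly_over A) [:p:] 1"
    then have "\<forall>i. dvd_in A p (coeff 1 i)" using dvd_in_const_iff[of p 1] pA by simp
    then have "dvd_in A p 1" by (metis lead_coeff_1)
    then show False using p by (simp add: prime_in_def)
  qed
  have "dvd_in (poly_over A) [:p:] f \<or> dvd_in (poly_over A) [:p:] g"
    if f: "f \<in> poly_over A" and g: "g \<in> poly_over A" and d: "dvd_in (poly_over A) [:p:] (f * g)" for f g
  proof (rule ccontr)
    assume "\<not> ?thesis"
    then obtain i0 j0 where "\<not> dvd_in A p (coeff f i0)" "\<not> dvd_in A p (coeff g j0)"
      using dvd_in_const_iff[of p f] dvd_in_const_iff[of p g] f g pA by auto
    define i where "i = (LEAST i. \<not> dvd_in A p (coeff f i))"
    define j where "j = (LEAST j. \<not> dvd_in A p (coeff g j))"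
    have i: "\<not> dvd_in A p (coeff f i)" 
      unfolding i_def by (rule LeastI[of "\<lambda>i. \<not> dvd_in A p (coeff f i)" i0]) fact
    have j: "\<not> dvd_in A p (coeff g j)" 
      unfolding j_def by (rule LeastI[of "\<lambda>i. \<not> dvd_in A p (coeff g i)" j0]) fact
    have il: "dvd_in A p (coeff f k)" if "k < i" for k
      using not_less_Least[of k "\<lambda>i. \<not> dvd_in A p (coeff f i)"] that unfolding i_def by simp
    have jl: "dvd_in A p (coeff g k)" if "k < j" for k
      using not_less_Least[of k "\<lambda>i. \<not> dvd_in A p (coeff g i)"] that unfolding j_def by simp
    have fg: "coeff f k \<in> A" "coeff g k \<in> A" for k using f g by (auto simp: poly_over_def)
    have split: "coeff (f * g) (i + j) = coeff f i * coeff g j + (\<Sum>k\<in>{..i+j}-{i}. coeff f k * coeff g (i + j - k))"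
      unfolding coeff_mult using sum.remove[of "{..i+j}" i "\<lambda>k. coeff f k * coeff g (i + j - k)"] by simp
    have dfg: "dvd_in A p (coeff (f * g) (i + j))"
      using d dvd_in_const_iff[of p "f * g"] PA.mult_mem[OF f g] pA by simp
    have "dvd_in A p (\<Sum>k\<in>{..i+j}-{i}. coeff f k * coeff g (i + j - k))"
    proof (rule dvd_in_sum)
      fix k assume k: "k \<in> {..i+j}-{i}"
      show "dvd_in A p (coeff f k * coeff g (i + j - k))"
      proof (cases "k < i")
        case True
        then show ?thesis using dvd_in_mult[OF il] fg by simp
      next
        case False
        then have "i + j - k < j" using k by auto
        then show ?thesis using dvd_in_mult2[OF jl] fg by simp
      qed
    qed
    from dvd_in_diff[OF dfg this] have "dvd_in A p (coeff f i * coeff g j)"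
      unfolding split by simp
    then show False using i j fg p unfolding prime_in_def by blast
  qed
  then show ?thesis using nu pA unfolding prime_in_def by simp
qed

text \<open>Stated through prime constants, so that no greatest common divisor of the coefficients
  has to be chosen.\<close>

definition primitive :: "'a poly \<Rightarrow> bool" where
  "primitive f \<longleftrightarrow> f \<in> poly_over A \<and> f \<noteq> 0 \<and> (\<forall>p. prime_in A p \<longrightarrow> \<not> dvd_in (poly_over A) [:p:] f)"

text \<open>The primes of \<open>c\<close> are removed one at a time: such a prime divides
  \<open>h * k\<close> but not the primitive \<open>h\<close>, hence it divides \<open>k\<close> and
  cancels. This is how divisibility over the fraction field descends to \<open>A\<close>.\<close>

lemma primitive_dvd_const_mult:
  assumes h: "primitive h" and F: "F \<in> poly_over A" and c: "c \<in> A" "c \<noteq> 0"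
    and d: "dvd_in (poly_over A) h ([:c:] * F)"
  shows "dvd_in (poly_over A) h F"
proof -
  obtain u ps where u: "u \<in> A" "dvd_in A u 1" and ps: "\<forall>p\<in>set ps. prime_in A p" "c = u * prod_list ps"
    using factorial c unfolding factorial_in_def by blast
  have "dvd_in (poly_over A) h F"
    if "dvd_in (poly_over A) h ([:u * prod_list ps:] * F)" "\<forall>p\<in>set ps. prime_in A p" for ps
    using that
  proof (induction ps)
    case Nil
    obtain u' where u': "u' \<in> A" "1 = u * u'" using u(2) by (auto simp: dvd_in_def)
    have "dvd_in (poly_over A) h ([:u:] * F)" using Nil(1) by simp
    then have "dvd_in (poly_over A) h ([:u:] * F * [:u':])"
      by (rule PA.dvd_in_mult) (use u' in simp)
    moreover have "[:u:] * F * [:u':] = F" using u'(2) by (simp add: mult.commute)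
    ultimately show ?case by simp
  next
    case (Cons p ps)
    let ?G = "[:u * prod_list ps:] * F"
    have "[:u * prod_list (p # ps):] * F = [:p:] * ?G" by (simp add: ac_simps)
    then obtain k where k: "k \<in> poly_over A" "[:p:] * ?G = h * k"
      using Cons.prems(1) by (auto simp: dvd_in_def)
    have psA: "set ps \<subseteq> A" and p: "prime_in A p" using Cons.prems(2) by (auto simp: prime_in_def)
    have "u * prod_list ps \<in> A" using u prod_list_mem[OF psA] by blast
    then have G: "?G \<in> poly_over A" using F by (intro PA.mult_mem) simp_all
    have "dvd_in (poly_over A) [:p:] (h * k)" using k G by (metis dvd_in_def)
    then have "dvd_in (poly_over A) [:p:] k"
      using prime_in_const[OF p] h k(1) p unfolding prime_in_def[of "poly_over A"] primitive_def by blast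
    then obtain l where l: "l \<in> poly_over A" "k = [:p:] * l" by (auto simp: dvd_in_def)
    have "[:p:] * ?G = [:p:] * (h * l)" using k l by (simp only: ac_simps)
    moreover have "[:p:] \<noteq> 0" using p by (simp add: prime_in_def)
    ultimately have "?G = h * l" using mult_left_cancel by blast
    then have "dvd_in (poly_over A) h ?G" using l by (auto simp: dvd_in_def)
    then show ?case using Cons.IH Cons.prems(2) by simp
  qed
  then show ?thesis using d ps by blast
qed

text \<open>A prime constant dividing \<open>f\<close> divides its leading coefficient too, so at
  most as many can be split off as that coefficient has prime factors.\<close>

lemma content_primitive_part:
  assumes "f \<in> poly_over A" "f \<noteq> 0"
  obtains c g where "c \<in> A" "c \<noteq> 0" "primitive g" "f = [:c:] * g"
proof -
  have "\<exists>c g. c \<in> A \<and> c \<noteq> 0 \<and> primitive g \<and> f = [:c:] * g"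
    if "f \<in> poly_over A" "f \<noteq> 0" "u \<in> A" "dvd_in A u 1" "\<forall>p\<in>set ps. prime_in A p"
      "lead_coeff f = u * prod_list ps" for f u ps
    using that
  proof (induction "length ps" arbitrary: f u ps rule: less_induct)
    case less
    show ?case
    proof (cases "primitive f")
      case True
      then show ?thesis by (intro exI[of _ 1] exI[of _ f]) simp
    next
      case False
      then obtain p where p: "prime_in A p" "dvd_in (poly_over A) [:p:] f"
        using less.prems by (auto simp: primitive_def)
      then obtain g where g: "g \<in> poly_over A" "f = [:p:] * g" by (auto simp: dvd_in_def)
      have pA: "p \<in> A" "p \<noteq> 0" using p by (auto simp: prime_in_def)
      have "p * lead_coeff g = u * prod_list ps" using less.prems(6) g pA by simp
      then obtain v qs where vq: "v \<in> A" "dvd_in A v 1" "\<forall>q\<in>set qs. prime_in A q"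
        "length qs < length ps" "lead_coeff g = v * prod_list qs"
        using prime_in_cancel_factorization[OF p(1) less.prems(5,3,4), of "lead_coeff g"] g(1)
        by (auto simp: poly_over_def)
      have "g \<noteq> 0" using g less.prems by auto
      from less.hyps[OF vq(4) g(1) this vq(1-3,5)] obtain c h
        where "c \<in> A" "c \<noteq> 0" "primitive h" "g = [:c:] * h" by blast
      then show ?thesis using g pA by (intro exI[of _ "p * c"] exI[of _ h]) (auto simp: ac_simps)
    qed
  qed
  moreover have "lead_coeff f \<in> A" "lead_coeff f \<noteq> 0" using assms by (auto simp: poly_over_def)
  ultimately show thesis using assms that factorial unfolding factorial_in_def by meson
qed

text \<open>The leading coefficient of \<open>h\<close> need not be invertible, so \<open>f\<close>
  is multiplied by it before each reduction of the degree; \<open>c\<close> collects these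
  multipliers.\<close>

lemma pseudo_division:
  assumes "f \<in> poly_over A" "h \<in> poly_over A" "h \<noteq> 0"
  shows "\<exists>c\<in>A-{0}. \<exists>q\<in>poly_over A. [:c:] * f - q * h = 0 \<or> degree ([:c:] * f - q * h) < degree h"
  using assms(1)
proof (induction "degree f" arbitrary: f rule: less_induct)
  case less
  show ?case
  proof (cases "f = 0 \<or> degree f < degree h")
    case True
    then show ?thesis by (intro bexI[of _ 1] bexI[of _ 0]) auto
  next
    case False
    define a where "a = lead_coeff h"
    define m where "m = monom (lead_coeff f) (degree f - degree h)"
    define g where "g = [:a:] * f - m * h"
    have aA: "a \<in> A" "a \<noteq> 0" using assms unfolding a_def by (auto simp: poly_over_def)
    have m: "m \<in> poly_over A" using less.prems unfolding m_def poly_over_def by auto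
    have g: "g \<in> poly_over A" unfolding g_def using aA m less.prems assms by auto
    have df: "degree ([:a:] * f) = degree f" using aA by simp
    have dm: "degree (m * h) = degree f"
      using False assms unfolding m_def by (simp add: degree_mult_eq degree_monom_eq)
    have le: "degree g \<le> degree f" unfolding g_def by (rule degree_diff_le) (auto simp: df dm)
    have "degree m = degree f - degree h"
      using False unfolding m_def by (simp add: degree_monom_eq)
    then have "lead_coeff m = lead_coeff f" unfolding m_def by simp
    then have "lead_coeff (m * h) = lead_coeff f * a" unfolding lead_coeff_mult a_def by simp
    then have z: "coeff g (degree f) = 0" using dm by (simp add: g_def)
    show ?thesis
    proof (cases "g = 0")
      case True
      then show ?thesis using aA m unfolding g_def by blast
    next
      case False
      then have "degree g < degree f" using le z by (metis le_neq_implies_less leading_coeff_0_iff)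
      from less.hyps[OF this g] obtain c q where c: "c \<in> A" "c \<noteq> 0" "q \<in> poly_over A"
        "[:c:] * g - q * h = 0 \<or> degree ([:c:] * g - q * h) < degree h" by auto
      have "[:c:] * g - q * h = [:c * a:] * f - ([:c:] * m + q) * h"
        unfolding g_def by (simp add: algebra_simps smult_diff_right)
      moreover have "[:c:] * m + q \<in> poly_over A" using c m by (intro PA.add_mem PA.mult_mem) auto
      ultimately show ?thesis using c aA by (intro bexI[of _ "c * a"] bexI[of _ "[:c:] * m + q"]) auto
    qed
  qed
qed

lemma primitive_const_unit:
  assumes "primitive [:a:]"
  shows "dvd_in A a 1"
proof -
  have a: "a \<in> A" "a \<noteq> 0" using assms by (auto simp: primitive_def)
  then obtain u ps where u: "u \<in> A" "dvd_in A u 1" and ps: "\<forall>p\<in>set ps. prime_in A p" "a = u * prod_list ps"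
    using factorial unfolding factorial_in_def by blast
  have "ps = []"
  proof (cases ps)
    case (Cons p qs)
    have "set qs \<subseteq> A" using ps Cons by (auto simp: prime_in_def)
    then have "u * prod_list qs \<in> A" using u prod_list_mem by blast
    moreover have "[:a:] = [:p:] * [:u * prod_list qs:]" using ps Cons by (simp add: ac_simps)
    ultimately have "dvd_in (poly_over A) [:p:] [:a:]"
      unfolding dvd_in_def by (intro bexI[of _ "[:u * prod_list qs:]"]) auto
    then show ?thesis using assms ps Cons by (auto simp: primitive_def)
  qed simp
  then show ?thesis using u ps by simp
qed

lemma dvd_in_trans_poly:
  "dvd_in (poly_over A) a b \<Longrightarrow> dvd_in (poly_over A) b c \<Longrightarrow> dvd_in (poly_over A) a c"
  unfolding dvd_in_def by (metis mult.assoc PA.mult_mem)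

lemma primitive_factor:
  assumes "primitive (g * h)" "g \<in> poly_over A" "h \<in> poly_over A"
  shows "primitive g" "primitive h"
  using assms PA.dvd_in_mult[of _ g h] PA.dvd_in_mult2[of _ h g] unfolding primitive_def by auto

text \<open>A Bezout argument over the fraction field, with denominators cleared. An element
  \<open>h\<close> of least degree in the ideal of \<open>f\<close> and \<open>g1\<close> divides
  all of the ideal up to constants, so its primitive part \<open>h0\<close> divides \<open>f\<close>
  and \<open>g1\<close>. Irreducibility forces \<open>h\<close> to be a constant, and the Bezout
  identity for \<open>h\<close> then carries divisibility from \<open>g1 * g2\<close> to
  \<open>g2\<close>.\<close>

lemma irreducible_primitive_prime:
  assumes f: "primitive f" "degree f > 0"
    and irr: "\<And>g h. g \<in> poly_over A \<Longrightarrow> h \<in> poly_over A \<Longrightarrow> f = g * h \<Longrightarrow> degree g = 0 \<or> degree h = 0"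
  shows "prime_in (poly_over A) f"
proof -
  have fA: "f \<in> poly_over A" "f \<noteq> 0" using f by (auto simp: primitive_def)
  have nu: "\<not> dvd_in (poly_over A) f 1"
  proof
    assume "dvd_in (poly_over A) f 1"
    then obtain k where k: "1 = f * k" by (auto simp: dvd_in_def)
    then have "f * k \<noteq> 0" by (metis zero_neq_one)
    then have "degree (f * k) = degree f + degree k" by (intro degree_mult_eq) auto
    then show False using k f(2) by (metis degree_1 add_is_0 less_irrefl)
  qed
  have "dvd_in (poly_over A) f g2"
    if g1: "g1 \<in> poly_over A" and g2: "g2 \<in> poly_over A" and d: "dvd_in (poly_over A) f (g1 * g2)"
      and nd: "\<not> dvd_in (poly_over A) f g1" for g1 g2
  proof -
    define I where "I = {f * u + g1 * v | u v. u \<in> poly_over A \<and> v \<in> poly_over A}"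
    have fI: "f \<in> I" unfolding I_def by (rule CollectI, rule exI[of _ 1], rule exI[of _ 0]) auto
    have gI: "g1 \<in> I" unfolding I_def by (rule CollectI, rule exI[of _ 0], rule exI[of _ 1]) auto
    have IP: "z \<in> poly_over A" if "z \<in> I" for z using that fA g1 unfolding I_def by auto
    define h where "h = arg_min degree (\<lambda>z. z \<in> I \<and> z \<noteq> 0)"
    have h: "h \<in> I" "h \<noteq> 0" and hmin: "\<And>z. z \<in> I \<Longrightarrow> z \<noteq> 0 \<Longrightarrow> degree h \<le> degree z"
      using arg_min_nat_lemma[of "\<lambda>z. z \<in> I \<and> z \<noteq> 0" f degree] fI fA unfolding h_def by auto
    obtain hu hv where huv: "h = f * hu + g1 * hv" "hu \<in> poly_over A" "hv \<in> poly_over A"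
      using h unfolding I_def by blast
    have multiple: "\<exists>c\<in>A-{0}. dvd_in (poly_over A) h ([:c:] * z)" if zI: "z \<in> I" for z
    proof -
      obtain c q where c: "c \<in> A-{0}" "q \<in> poly_over A"
        "[:c:] * z - q * h = 0 \<or> degree ([:c:] * z - q * h) < degree h"
        using pseudo_division[OF IP[OF zI] IP[OF h(1)] h(2)] by blast
      obtain zu zv where z: "z = f * zu + g1 * zv" "zu \<in> poly_over A" "zv \<in> poly_over A"
        using zI unfolding I_def by blast
      have "[:c:] * z - q * h = f * ([:c:] * zu - q * hu) + g1 * ([:c:] * zv - q * hv)"
        unfolding z(1) huv(1) by (simp add: algebra_simps smult_add_right)
      moreover have "[:c:] * zu - q * hu \<in> poly_over A" "[:c:] * zv - q * hv \<in> poly_over A"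
        using c z huv by (auto intro!: PA.diff_mem PA.mult_mem simp del: mult_pCons_left)
      ultimately have "[:c:] * z - q * h \<in> I" unfolding I_def by blast
      then have "[:c:] * z - q * h = 0" using c(3) hmin by force
      then have "[:c:] * z = h * q" by (simp add: mult.commute)
      then show ?thesis using c(1,2) unfolding dvd_in_def by blast
    qed
    obtain d0 h0 where h0: "d0 \<in> A" "d0 \<noteq> 0" "primitive h0" "h = [:d0:] * h0"
      using content_primitive_part[OF IP[OF h(1)] h(2)] by blast
    have h0P: "h0 \<in> poly_over A" using h0 by (simp add: primitive_def)
    have h0h: "dvd_in (poly_over A) h0 h"
      unfolding dvd_in_def using h0 by (intro bexI[of _ "[:d0:]"]) (auto simp: mult.commute)
    have h0I: "dvd_in (poly_over A) h0 z" if "z \<in> I" for z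
      using multiple[OF that] primitive_dvd_const_mult[OF h0(3) IP[OF that]] dvd_in_trans_poly[OF h0h]
      by blast
    obtain k where k: "k \<in> poly_over A" "f = h0 * k" using h0I[OF fI] by (auto simp: dvd_in_def)
    \<comment> \<open>Otherwise the cofactor \<open>k\<close> is a primitive constant, hence a unit,
      and \<open>f\<close> divides \<open>h0\<close> and with it \<open>g1\<close>.\<close>
    have "degree h0 = 0"
    proof (rule ccontr)
      assume "degree h0 \<noteq> 0"
      then have "degree k = 0" using irr[OF h0P k] by auto
      then obtain k0 where k0: "k = [:k0:]" by (metis degree_eq_zeroE)
      have "primitive k" using primitive_factor(2)[of h0 k] f(1) k h0P by simp
      then have "dvd_in A k0 1" using primitive_const_unit k0 by simp
      then obtain k1 where k1: "k1 \<in> A" "1 = k0 * k1" by (auto simp: dvd_in_def)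
      have "h0 = f * [:k1:]" using k k0 k1 by (simp add: mult.commute)
      then have "dvd_in (poly_over A) f h0"
        unfolding dvd_in_def using k1 by (intro bexI[of _ "[:k1:]"]) auto
      then show False using nd h0I[OF gI] dvd_in_trans_poly by blast
    qed
    then have "degree h = 0" using h0 by simp
    then obtain a where a: "h = [:a:]" by (metis degree_eq_zeroE)
    have aA: "a \<in> A" "a \<noteq> 0" using a h IP[OF h(1)] by auto
    \<comment> \<open>The Bezout identity for the constant \<open>h\<close>, multiplied by
      \<open>g2\<close>.\<close>
    have "[:a:] * g2 = f * (hu * g2) + g1 * g2 * hv"
      unfolding a[symmetric] huv(1) by (simp add: algebra_simps)
    moreover have "dvd_in (poly_over A) f (f * (hu * g2))"
      using huv g2 unfolding dvd_in_def by blast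
    moreover have "dvd_in (poly_over A) f (g1 * g2 * hv)" using PA.dvd_in_mult[OF d] huv by blast
    ultimately have "dvd_in (poly_over A) f ([:a:] * g2)" using PA.dvd_in_add by metis
    then show ?thesis using primitive_dvd_const_mult[OF f(1) g2 aA] by blast
  qed
  then show ?thesis unfolding prime_in_def using fA nu by blast
qed

lemma primitive_factorization:
  assumes "primitive f"
  shows "\<exists>u ps. u \<in> poly_over A \<and> dvd_in (poly_over A) u 1 \<and>
     (\<forall>p\<in>set ps. prime_in (poly_over A) p) \<and> f = u * prod_list ps"
  using assms
proof (induction "degree f" arbitrary: f rule: less_induct)
  case less
  have fA: "f \<in> poly_over A" "f \<noteq> 0" using less.prems by (auto simp: primitive_def)
  consider "degree f = 0" | "degree f > 0" "prime_in (poly_over A) f"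
    | g h where "g \<in> poly_over A" "h \<in> poly_over A" "f = g * h" "degree g \<noteq> 0" "degree h \<noteq> 0"
    using irreducible_primitive_prime[OF less.prems] by blast
  then show ?case
  proof cases
    case 1
    then obtain a where a: "f = [:a:]" by (metis degree_eq_zeroE)
    then obtain b where b: "b \<in> A" "1 = a * b"
      using primitive_const_unit less.prems by (auto simp: dvd_in_def)
    then have "dvd_in (poly_over A) f 1"
      unfolding dvd_in_def using a by (intro bexI[of _ "[:b:]"]) (auto simp: mult.commute)
    then show ?thesis using fA by (intro exI[of _ f] exI[of _ "[]"]) auto
  next
    case 2
    then show ?thesis by (intro exI[of _ 1] exI[of _ "[f]"]) (auto intro: PA.dvd_in_refl)
  next
    case 3
    have "degree f = degree g + degree h" using 3(3) fA by (metis degree_mult_eq mult_eq_0_iff)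
    then have lt: "degree g < degree f" "degree h < degree f" using 3 by auto
    have pr: "primitive g" "primitive h" using primitive_factor[of g h] 3 less.prems by auto
    obtain u ps where u: "u \<in> poly_over A" "dvd_in (poly_over A) u 1"
      "\<forall>p\<in>set ps. prime_in (poly_over A) p" "g = u * prod_list ps"
      using less.hyps[OF lt(1) pr(1)] by blast
    obtain v qs where v: "v \<in> poly_over A" "dvd_in (poly_over A) v 1"
      "\<forall>p\<in>set qs. prime_in (poly_over A) p" "h = v * prod_list qs"
      using less.hyps[OF lt(2) pr(2)] by blast
    have "f = (u * v) * prod_list (ps @ qs)" using 3(3) u v by (simp add: ac_simps)
    moreover have "u * v \<in> poly_over A" "dvd_in (poly_over A) (u * v) 1"
      using u v PA.unit_mult by auto
    moreover have "\<forall>p\<in>set (ps @ qs). prime_in (poly_over A) p" using u v by auto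
    ultimately show ?thesis by blast
  qed
qed

lemma prod_list_const: "prod_list (map (\<lambda>p. [:p:]) ps) = [:prod_list ps:]"
  by (induction ps) (auto simp: one_pCons ac_simps)

text \<open>Content and primitive part are factored separately; a prime of the content stays prime
  as a constant by \<open>prime_in_const\<close>.\<close>

theorem factorial_poly_over: "factorial_in (poly_over A)"
  unfolding factorial_in_def
proof (intro ballI impI)
  fix f assume "f \<in> poly_over A" "f \<noteq> 0"
  then obtain c g where c: "c \<in> A" "c \<noteq> 0" and g: "primitive g" "f = [:c:] * g"
    using content_primitive_part by blast
  obtain u ps where u: "u \<in> A" "dvd_in A u 1" and ps: "\<forall>p\<in>set ps. prime_in A p" "c = u * prod_list ps"
    using factorial c unfolding factorial_in_def by blast
  obtain v qs where v: "v \<in> poly_over A" "dvd_in (poly_over A) v 1"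
      "\<forall>p\<in>set qs. prime_in (poly_over A) p" "g = v * prod_list qs"
    using primitive_factorization[OF g(1)] by blast
  obtain u' where u': "u' \<in> A" "1 = u * u'" using u(2) by (auto simp: dvd_in_def)
  have uu: "dvd_in (poly_over A) [:u:] 1"
    unfolding dvd_in_def using u' by (intro bexI[of _ "[:u':]"]) (auto simp: mult.commute)
  have "f = ([:u:] * v) * prod_list (map (\<lambda>p. [:p:]) ps @ qs)"
    using g(2) v(4) ps(2) by (simp add: prod_list_const ac_simps)
  moreover have "\<forall>p\<in>set (map (\<lambda>p. [:p:]) ps @ qs). prime_in (poly_over A) p"
    using ps v prime_in_const by auto
  moreover have "[:u:] * v \<in> poly_over A" using u v by (intro PA.mult_mem) auto
  ultimately show "\<exists>u ps. u \<in> poly_over A \<and> dvd_in (poly_over A) u 1 \<and>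
      (\<forall>p\<in>set ps. prime_in (poly_over A) p) \<and> f = u * prod_list ps"
    using PA.unit_mult[OF uu v(2)] by blast
qed

end

section \<open>Factoriality after adjoining a transcendental element\<close>

lemma factorial_in_image:
  fixes \<phi> :: "'a::comm_ring_1 \<Rightarrow> 'b::comm_ring_1"
  assumes inj: "inj_on \<phi> A" and one: "\<phi> 1 = 1" and zero: "\<phi> 0 = 0"
    and mult: "\<And>a b. \<phi> (a * b) = \<phi> a * \<phi> b"
    and A: "0 \<in> A" "1 \<in> A" "\<And>a b. a \<in> A \<Longrightarrow> b \<in> A \<Longrightarrow> a * b \<in> A" and fac: "factorial_in A"
  shows "factorial_in (\<phi> ` A)"
proof -
  have dvd: "dvd_in (\<phi> ` A) (\<phi> a) (\<phi> b) \<longleftrightarrow> dvd_in A a b" if "a \<in> A" "b \<in> A" for a b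
  proof
    assume "dvd_in (\<phi> ` A) (\<phi> a) (\<phi> b)"
    then obtain c where "c \<in> A" "\<phi> b = \<phi> (a * c)" by (auto simp: dvd_in_def mult)
    then show "dvd_in A a b" using inj_onD[OF inj, of b "a * c"] that A(3) by (auto simp: dvd_in_def)
  qed (auto simp: dvd_in_def mult)
  have prime: "prime_in (\<phi> ` A) (\<phi> p)" if p: "prime_in A p" for p
  proof -
    have pA: "p \<in> A" "p \<noteq> 0" "\<not> dvd_in A p 1" using p by (auto simp: prime_in_def)
    have "\<phi> p \<noteq> 0" using inj_onD[OF inj, of p 0] pA A zero by auto
    moreover have "\<not> dvd_in (\<phi> ` A) (\<phi> p) 1" using dvd[of p 1] pA A one by simp
    moreover have "dvd_in (\<phi> ` A) (\<phi> p) (\<phi> a) \<or> dvd_in (\<phi> ` A) (\<phi> p) (\<phi> b)"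
      if "dvd_in (\<phi> ` A) (\<phi> p) (\<phi> a * \<phi> b)" "a \<in> A" "b \<in> A" for a b
      using that p pA dvd A(3) unfolding prime_in_def mult[symmetric] by simp
    ultimately show ?thesis
      unfolding prime_in_def using pA(1) by blast
  qed
  have pl: "\<phi> (prod_list ps) = prod_list (map \<phi> ps)" for ps
    by (induction ps) (auto simp: one mult)
  show ?thesis
    unfolding factorial_in_def
  proof (intro ballI impI)
    fix b assume "b \<in> \<phi> ` A" "b \<noteq> 0"
    then obtain a where a: "a \<in> A" "a \<noteq> 0" "b = \<phi> a" using zero by auto
    then obtain u ps where u: "u \<in> A" "dvd_in A u 1" "\<forall>p\<in>set ps. prime_in A p" "a = u * prod_list ps"
      using fac unfolding factorial_in_def by blast
    then show "\<exists>u ps. u \<in> \<phi> ` A \<and> dvd_in (\<phi> ` A) u 1 \<and>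
        (\<forall>p\<in>set ps. prime_in (\<phi> ` A) p) \<and> b = u * prod_list ps"
      using a prime dvd[of u 1] A one
      by (intro exI[of _ "\<phi> u"] exI[of _ "map \<phi> ps"]) (auto simp: mult pl)
  qed
qed

text \<open>The assumption says that \<open>y\<close> is transcendental over \<open>A\<close>, so
  evaluation at \<open>y\<close> identifies the polynomials over \<open>A\<close> with the subring
  that \<open>A\<close> and \<open>y\<close> generate.\<close>

lemma (in factorial_idom_subring) factorial_in_adjoin:
  assumes "\<And>f. f \<in> poly_over A \<Longrightarrow> poly f y = 0 \<Longrightarrow> f = 0"
  shows "factorial_in ((\<lambda>f. poly f y) ` poly_over A)"
proof (rule factorial_in_image)
  show "inj_on (\<lambda>f. poly f y) (poly_over A)"
  proof (rule inj_onI)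
    fix f g assume "f \<in> poly_over A" "g \<in> poly_over A" "poly f y = poly g y"
    then show "f = g" using assms[of "f - g"] by auto
  qed
qed (auto intro: factorial_poly_over)

section \<open>Primes of height one and powers of ideals\<close>

text \<open>In a domain the zero ideal is prime and lies in every prime: a nonzero \<open>P\<close>
  has a chain of length one, and a nonzero prime strictly inside \<open>P\<close> prolongs it to
  length two.\<close>

lemma (in domain) height_eq_1_iff:
  assumes P: "primeideal P R"
  shows "height R P = 1 \<longleftrightarrow> P \<noteq> {\<zero>} \<and> (\<forall>Q. primeideal Q R \<longrightarrow> Q \<subseteq> P \<longrightarrow> Q \<noteq> {\<zero>} \<longrightarrow> Q = P)"
    (is "_ \<longleftrightarrow> ?R")
proof -
  define K where "K = {enat k | k Q. (\<forall>i\<le>k. primeideal (Q i) R) \<and> (\<forall>i<k. Q i \<subset> Q (Suc i)) \<and> Q k = P}"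
  have height: "height R P = Sup K" unfolding height_def K_def ..
  have zero: "\<zero> \<in> Q" if "primeideal Q R" for Q
    using that additive_subgroup.zero_closed ideal.axioms(1) primeideal.axioms(1) by blast
  have one: "enat 1 \<in> K" if "P \<noteq> {\<zero>}"
    unfolding K_def using P zeroprimeideal that zero[OF P]
    by (intro CollectI exI[of _ 1] exI[of _ "\<lambda>i. if i = 0 then {\<zero>} else P"]) auto
  have two: "enat 2 \<in> K" if "primeideal Q R" "Q \<noteq> {\<zero>}" "Q \<subset> P" for Q
    unfolding K_def using P zeroprimeideal that zero[OF that(1)]
    by (intro CollectI exI[of _ 2] exI[of _ "\<lambda>i. if i = 0 then {\<zero>} else if i = 1 then Q else P"])
      (auto simp: less_Suc_eq numeral_2_eq_2)
  show ?thesis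
  proof
    assume h: "height R P = 1"
    have le: "e \<le> 1" if "e \<in> K" for e using Sup_upper[OF that] h height by simp
    have "P \<noteq> {\<zero>}"
    proof
      assume P0: "P = {\<zero>}"
      have "e = 0" if e: "e \<in> K" for e
      proof -
        obtain k Q where kQ: "e = enat k" "\<forall>i\<le>k. primeideal (Q i) R" "\<forall>i<k. Q i \<subset> Q (Suc i)" "Q k = P"
          using e unfolding K_def by blast
        have "k = 0"
        proof (rule ccontr)
          assume "k \<noteq> 0"
          then obtain l where l: "k = Suc l" by (cases k) auto
          then have "Q l \<subset> {\<zero>}" "\<zero> \<in> Q l" using kQ zero P0 by auto
          then show False by blast
        qed
        then show ?thesis using kQ by (simp add: zero_enat_def)
      qed
      then have "Sup K \<le> 0" by (intro Sup_least) simp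
      then show False using h height by simp
    qed
    moreover have "Q = P" if Q: "primeideal Q R" "Q \<subseteq> P" "Q \<noteq> {\<zero>}" for Q
    proof (rule ccontr)
      assume "Q \<noteq> P"
      then have "enat 2 \<le> 1" using two[of Q] le Q by blast
      then show False by (simp add: one_enat_def)
    qed
    ultimately show ?R by blast
  next
    assume r: ?R
    have "e \<le> 1" if e: "e \<in> K" for e
    proof -
      obtain k Q where kQ: "e = enat k" "\<forall>i\<le>k. primeideal (Q i) R" "\<forall>i<k. Q i \<subset> Q (Suc i)" "Q k = P"
        using e unfolding K_def by blast
      have "k \<le> 1"
      proof (rule ccontr)
        assume "\<not> k \<le> 1"
        \<comment> \<open>The last but one member of the chain strictly contains another ideal and
          is therefore a nonzero prime strictly below \<open>P\<close>.\<close>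
        define l where "l = k - 2"
        have l: "k = Suc (Suc l)" using \<open>\<not> k \<le> 1\<close> by (simp add: l_def)
        have "primeideal (Q (Suc l)) R" "Q (Suc l) \<subset> P" "Q l \<subset> Q (Suc l)" "\<zero> \<in> Q l"
          using kQ l zero by auto
        moreover have "Q (Suc l) \<noteq> {\<zero>}" using calculation by auto
        ultimately show False using r by blast
      qed
      then show ?thesis using kQ by (simp add: one_enat_def)
    qed
    moreover have "1 \<in> K" using one r by (simp add: one_enat_def)
    ultimately show "height R P = 1"
      unfolding height by (intro antisym Sup_least Sup_upper) auto
  qed
qed

section \<open>Ideals, height one and ideal powers in a subring\<close>

context idom_subring
begin

text \<open>The record is the one behind \<open>polynomial_ring\<close> and
  \<open>edge_ring\<close>, so that \<open>edge_ring_eq\<close> can be an equality of rings and not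
  only an isomorphism.\<close>

definition ring_on :: "'a ring" where
  "ring_on = ring_of_type_algebra\<lparr>carrier := A\<rparr>"

lemma ring_on_simps [simp]:
  "carrier ring_on = A" "x \<otimes>\<^bsub>ring_on\<^esub> y = x * y" "x \<oplus>\<^bsub>ring_on\<^esub> y = x + y"
  "\<one>\<^bsub>ring_on\<^esub> = 1" "\<zero>\<^bsub>ring_on\<^esub> = 0"
  by (simp_all add: ring_on_def ring_of_type_algebra_def)

lemma domain_ring_on: "domain ring_on"
proof -
  have "cring ring_on"
  proof (rule cringI)
    show "abelian_group ring_on"
      by (rule abelian_groupI) (auto simp: ac_simps intro!: bexI[of _ "- x" for x])
    show "comm_monoid ring_on"
      by (rule comm_monoidI) (auto simp: ac_simps)
  qed (auto simp: algebra_simps)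
  then show ?thesis by (rule domain.intro) (auto simp: domain_axioms_def)
qed

sublocale RA: domain ring_on
  by (rule domain_ring_on)

lemma a_inv_ring_on [simp]: "x \<in> A \<Longrightarrow> \<ominus>\<^bsub>ring_on\<^esub> x = - x"
  by (rule RA.minus_equality) auto

lemma ideal_ring_onI:
  assumes "P \<subseteq> A" "0 \<in> P" "\<And>x y. x \<in> P \<Longrightarrow> y \<in> P \<Longrightarrow> x + y \<in> P"
    "\<And>x a. x \<in> P \<Longrightarrow> a \<in> A \<Longrightarrow> a * x \<in> P"
  shows "ideal P ring_on"
proof (rule idealI)
  have "- x \<in> P" if "x \<in> P" for x using assms(4)[OF that, of "- 1"] by simp
  then have "inv\<^bsub>add_monoid ring_on\<^esub> x \<in> P" if "x \<in> P" for x
    using a_inv_ring_on[of x] that assms(1) unfolding a_inv_def by auto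
  then show "subgroup P (add_monoid ring_on)"
    by (rule subgroup.intro[rotated -1]) (use assms in auto)
  show "x \<otimes>\<^bsub>ring_on\<^esub> a \<in> P" "a \<otimes>\<^bsub>ring_on\<^esub> x \<in> P" if "a \<in> P" "x \<in> carrier ring_on" for a x
    using assms(4)[of a x] that by (auto simp: mult.commute)
qed (rule RA.ring_axioms)

lemma primeideal_ring_onI:
  assumes "P \<subseteq> A" "0 \<in> P" "\<And>x y. x \<in> P \<Longrightarrow> y \<in> P \<Longrightarrow> x + y \<in> P"
    "\<And>x a. x \<in> P \<Longrightarrow> a \<in> A \<Longrightarrow> a * x \<in> P" "1 \<notin> P"
    "\<And>a b. a \<in> A \<Longrightarrow> b \<in> A \<Longrightarrow> a * b \<in> P \<Longrightarrow> a \<in> P \<or> b \<in> P"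
  shows "primeideal P ring_on"
  using ideal_ring_onI[of P] assms RA.is_cring by (intro primeidealI) auto

lemma primeideal_ring_onD:
  assumes "primeideal P ring_on"
  shows "P \<subseteq> A" "0 \<in> P" "x \<in> P \<Longrightarrow> y \<in> P \<Longrightarrow> x + y \<in> P"
    "x \<in> P \<Longrightarrow> a \<in> A \<Longrightarrow> a * x \<in> P" "x \<in> P \<Longrightarrow> a \<in> A \<Longrightarrow> x * a \<in> P" "1 \<notin> P"
    "a \<in> A \<Longrightarrow> b \<in> A \<Longrightarrow> a * b \<in> P \<Longrightarrow> a \<in> P \<or> b \<in> P"
proof -
  interpret primeideal P ring_on by fact
  show sub: "P \<subseteq> A" using a_subset by simp
  show "0 \<in> P" using zero_closed by simp
  show "x \<in> P \<Longrightarrow> y \<in> P \<Longrightarrow> x + y \<in> P" using a_closed by simp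
  show "x \<in> P \<Longrightarrow> a \<in> A \<Longrightarrow> a * x \<in> P" using I_l_closed by simp
  show "x \<in> P \<Longrightarrow> a \<in> A \<Longrightarrow> x * a \<in> P" using I_r_closed by simp
  show "a \<in> A \<Longrightarrow> b \<in> A \<Longrightarrow> a * b \<in> P \<Longrightarrow> a \<in> P \<or> b \<in> P" using I_prime by simp
  show "1 \<notin> P"
  proof
    assume "1 \<in> P"
    then have "A \<subseteq> P" using I_l_closed[of 1] by auto
    then show False using sub I_notcarr ring_on_simps(1) by (metis subset_antisym)
  qed
qed

lemma height_one_primes_ring_on:
  "P \<in> height_one_primes ring_on \<longleftrightarrow> primeideal P ring_on \<and> P \<noteq> {0} \<and>
     (\<forall>Q. primeideal Q ring_on \<longrightarrow> Q \<subseteq> P \<longrightarrow> Q \<noteq> {0} \<longrightarrow> Q = P)"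
  unfolding height_one_primes_def using RA.height_eq_1_iff[of P] by auto

lemma primeideal_prod_list:
  assumes "primeideal P ring_on" "set xs \<subseteq> A" "prod_list xs \<in> P"
  shows "\<exists>x\<in>set xs. x \<in> P"
  using assms(2,3)
proof (induction xs)
  case Nil
  then show ?case using primeideal_ring_onD(6)[OF assms(1)] by simp
next
  case (Cons x xs)
  then show ?case using primeideal_ring_onD(7)[OF assms(1), of x "prod_list xs"] prod_list_mem[of xs] by auto
qed

lemma power_mem: "a \<in> A \<Longrightarrow> a ^ n \<in> A"
  by (induction n) auto

lemma primeideal_power:
  assumes "primeideal P ring_on" "x \<in> A" "x ^ n \<in> P"
  shows "x \<in> P"
  using assms(3)
proof (induction n)
  case 0
  then show ?case using primeideal_ring_onD(6)[OF assms(1)] by simp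
next
  case (Suc n)
  then show ?case using primeideal_ring_onD(7)[OF assms(1), of x "x ^ n"] power_mem[of x n] assms(2) by auto
qed

lemma ideals_set_simps [simp]:
  "\<one>\<^bsub>ideals_set ring_on\<^esub> = A" "I \<otimes>\<^bsub>ideals_set ring_on\<^esub> I' = ideal_prod ring_on I I'"
  by (simp_all add: ideals_set_def)

lemma ideal_ideal_power: "ideal P ring_on \<Longrightarrow> ideal (P [^]\<^bsub>ideals_set ring_on\<^esub> (n::nat)) ring_on"
proof (induction n)
  case 0
  then show ?case using RA.oneideal by simp
next
  case (Suc n)
  then show ?case using RA.ideal_prod_is_ideal by simp
qed

lemma power_mem_ideal_power:
  assumes "ideal P ring_on" "x \<in> P" "c \<in> A"
  shows "x ^ n * c \<in> P [^]\<^bsub>ideals_set ring_on\<^esub> (n::nat)"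
proof -
  have "x ^ n \<in> P [^]\<^bsub>ideals_set ring_on\<^esub> (n::nat)"
  proof (induction n)
    case (Suc n)
    then show ?case using ideal_prod.prod[OF Suc assms(2), of ring_on] by (simp add: mult.commute)
  qed simp
  then show ?thesis using ideal.I_r_closed[OF ideal_ideal_power[OF assms(1)]] assms(3) by force
qed

text \<open>A filtration in which the elements of \<open>P\<close> have weight one contains the
  powers of \<open>P\<close>. This bounds \<open>local_power\<close> from above without describing
  the ideal powers themselves.\<close>

lemma ideal_power_subset:
  assumes "A \<subseteq> F 0" and add: "\<And>n x y. x \<in> F n \<Longrightarrow> y \<in> F n \<Longrightarrow> x + y \<in> F n"
    and mult: "\<And>n x y. x \<in> F n \<Longrightarrow> y \<in> P \<Longrightarrow> x * y \<in> F (Suc n)"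
  shows "P [^]\<^bsub>ideals_set ring_on\<^esub> (n::nat) \<subseteq> F n"
proof (induction n)
  case (Suc n)
  have "x \<in> F (Suc n)" if "x \<in> ideal_prod ring_on (P [^]\<^bsub>ideals_set ring_on\<^esub> n) P" for x
    using that by induction (use Suc mult add in auto)
  then show ?case by auto
qed (use assms in simp)

lemma ord_at_eqI:
  assumes "\<And>n. a \<in> local_power R P n \<longleftrightarrow> n \<le> k"
  shows "ord_at R P a = k"
  unfolding ord_at_def assms by (rule Greatest_equality) auto

end

section \<open>Monoid algebras and their facet primes\<close>

lemma poly_mapping_eq_sum_single:
  assumes "finite K" "Poly_Mapping.keys p \<subseteq> K"
  shows "p = (\<Sum>m\<in>K. Poly_Mapping.single m (Poly_Mapping.lookup p m))"
proof (rule poly_mapping_eqI)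
  fix k
  have "k \<notin> K \<Longrightarrow> Poly_Mapping.lookup p k = 0" using assms(2) by (meson in_keys_iff subsetD)
  then show "Poly_Mapping.lookup p k =
      Poly_Mapping.lookup (\<Sum>m\<in>K. Poly_Mapping.single m (Poly_Mapping.lookup p m)) k"
    using assms(1) by (simp add: lookup_sum lookup_single when_def)
qed

lemma lookup_mult_sum:
  "Poly_Mapping.lookup (p * q) k = (\<Sum>a\<in>Poly_Mapping.keys p. \<Sum>b\<in>Poly_Mapping.keys q.
     Poly_Mapping.lookup p a * Poly_Mapping.lookup q b when a + b = k)"
proof -
  have "p * q = (\<Sum>a\<in>Poly_Mapping.keys p. \<Sum>b\<in>Poly_Mapping.keys q.
     Poly_Mapping.single (a + b) (Poly_Mapping.lookup p a * Poly_Mapping.lookup q b))"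
    by (subst (1) poly_mapping_eq_sum_single[of "Poly_Mapping.keys p" p], simp, simp,
        subst (1) poly_mapping_eq_sum_single[of "Poly_Mapping.keys q" q], simp, simp)
      (simp add: sum_product mult_single)
  then show ?thesis by (simp add: lookup_sum lookup_single)
qed

text \<open>No cancellation can occur at an exponent that splits in one way only. It is applied to
  the largest and to the smallest exponents of two factors.\<close>

lemma lookup_mult_unique:
  assumes "a \<in> Poly_Mapping.keys p" "b \<in> Poly_Mapping.keys q"
    and "\<And>a' b'. a' \<in> Poly_Mapping.keys p \<Longrightarrow> b' \<in> Poly_Mapping.keys q \<Longrightarrow> a' + b' = a + b \<Longrightarrow> a' = a \<and> b' = b"
  shows "Poly_Mapping.lookup (p * q) (a + b) = Poly_Mapping.lookup p a * Poly_Mapping.lookup q b"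
proof -
  have "Poly_Mapping.lookup (p * q) (a + b) = (\<Sum>a'\<in>Poly_Mapping.keys p. \<Sum>b'\<in>Poly_Mapping.keys q.
     if b' = b then (if a' = a then Poly_Mapping.lookup p a * Poly_Mapping.lookup q b else 0) else 0)"
    unfolding lookup_mult_sum by (intro sum.cong refl) (use assms(3) in \<open>auto simp: when_def\<close>)
  also have "\<dots> = Poly_Mapping.lookup p a * Poly_Mapping.lookup q b"
    using assms(1,2) by simp
  finally show ?thesis .
qed

lemma lookup_single_mult:
  fixes p :: "'m::{comm_monoid_add, cancel_ab_semigroup_add} \<Rightarrow>\<^sub>0 'k::comm_semiring_1"
  shows "Poly_Mapping.lookup (Poly_Mapping.single u c * p) (u + m) = c * Poly_Mapping.lookup p m"
  by (auto simp: lookup_mult_sum when_def in_keys_iff)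

lemma keys_single_mult:
  fixes p :: "'m::{comm_monoid_add, cancel_ab_semigroup_add} \<Rightarrow>\<^sub>0 'k::field"
  assumes "c \<noteq> 0"
  shows "Poly_Mapping.keys (Poly_Mapping.single u c * p) = (+) u ` Poly_Mapping.keys p"
proof
  show "Poly_Mapping.keys (Poly_Mapping.single u c * p) \<subseteq> (+) u ` Poly_Mapping.keys p"
    using keys_mult[of "Poly_Mapping.single u c" p] assms by auto
  show "(+) u ` Poly_Mapping.keys p \<subseteq> Poly_Mapping.keys (Poly_Mapping.single u c * p)"
    using assms by (auto simp: in_keys_iff lookup_single_mult)
qed

lemma single_neq_0 [simp]: "Poly_Mapping.single m c = 0 \<longleftrightarrow> c = 0"
  by (metis lookup_single_eq lookup_zero single_zero)

lemma add_eq_add_of_le: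
  fixes a b c d :: "'m::{ordered_cancel_comm_monoid_add, linorder}"
  assumes "a \<le> c" "b \<le> d" "a + b = c + d"
  shows "a = c \<and> b = d"
proof -
  have "\<not> a < c" using add_less_le_mono[OF _ assms(2), of a c] assms(3) by force
  moreover have "\<not> b < d" using add_le_less_mono[OF assms(1), of b d] assms(3) by force
  ultimately show ?thesis using assms by (simp add: order.order_iff_strict)
qed

text \<open>In an ordered monoid the extreme exponents of a product are the sums of those of the
  factors. If the product has a single exponent, smallest and largest exponent coincide in each
  factor. Hence the divisors of a monomial, and so the units of the localization, are single
  terms.\<close>

lemma factor_of_single:
  fixes p q :: "'m::{ordered_cancel_comm_monoid_add, linorder} \<Rightarrow>\<^sub>0 'k::field"
  assumes pq: "p * q = Poly_Mapping.single m c" and c: "c \<noteq> 0"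
  obtains a d where "p = Poly_Mapping.single a d" "d \<noteq> 0"
proof -
  let ?p = "Poly_Mapping.keys p" and ?q = "Poly_Mapping.keys q"
  have "p \<noteq> 0" "q \<noteq> 0" using assms by auto
  then have ne: "?p \<noteq> {}" "?q \<noteq> {}" by simp_all
  have key: "a + b = m" if "a \<in> ?p" "b \<in> ?q"
    and "\<And>a' b'. a' \<in> ?p \<Longrightarrow> b' \<in> ?q \<Longrightarrow> a' + b' = a + b \<Longrightarrow> a' = a \<and> b' = b" for a b
  proof -
    have "(c when m = a + b) = Poly_Mapping.lookup p a * Poly_Mapping.lookup q b"
      using lookup_mult_unique[OF that] unfolding pq lookup_single .
    moreover have "Poly_Mapping.lookup p a \<noteq> 0" "Poly_Mapping.lookup q b \<noteq> 0"
      using that(1,2) by (simp_all add: in_keys_iff)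
    ultimately have "(c when m = a + b) \<noteq> 0" by simp
    then show ?thesis by simp
  qed
  have "Max ?p + Max ?q = m"
  proof (rule key)
    fix a' b' assume ab: "a' \<in> ?p" "b' \<in> ?q" "a' + b' = Max ?p + Max ?q"
    then show "a' = Max ?p \<and> b' = Max ?q" by (intro add_eq_add_of_le) simp_all
  qed (use ne in simp_all)
  moreover have "Min ?p + Min ?q = m"
  proof (rule key)
    fix a' b' assume ab: "a' \<in> ?p" "b' \<in> ?q" "a' + b' = Min ?p + Min ?q"
    then have "Min ?p = a' \<and> Min ?q = b'" by (intro add_eq_add_of_le) simp_all
    then show "a' = Min ?p \<and> b' = Min ?q" by simp
  qed (use ne in simp_all)
  moreover have "Min ?p \<le> Max ?p" "Min ?q \<le> Max ?q" using ne by simp_all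
  ultimately have mm: "Min ?p = Max ?p"
    using add_eq_add_of_le[of "Min ?p" "Max ?p" "Min ?q" "Max ?q"] by simp
  have "?p \<subseteq> {Max ?p}"
  proof
    fix a assume a: "a \<in> ?p"
    then have "Min ?p \<le> a" "a \<le> Max ?p" by simp_all
    then show "a \<in> {Max ?p}" using mm by auto
  qed
  then have "p = Poly_Mapping.single (Max ?p) (Poly_Mapping.lookup p (Max ?p))"
    using poly_mapping_eq_sum_single[of "{Max ?p}" p] by simp
  moreover have "Poly_Mapping.lookup p (Max ?p) \<noteq> 0"
    using Max_in[OF finite_keys ne(1)] by (simp add: in_keys_iff)
  ultimately show thesis using that by blast
qed

lemma poly_mapping_split:
  fixes p :: "'m \<Rightarrow>\<^sub>0 'k::comm_monoid_add"
  obtains p0 p1 where "p = p0 + p1" "Poly_Mapping.keys p0 = Poly_Mapping.keys p \<inter> B"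
    "Poly_Mapping.keys p1 = Poly_Mapping.keys p - B"
proof -
  have fin: "finite {x. (if x \<in> C then Poly_Mapping.lookup p x else 0) \<noteq> 0}" for C
    by (rule finite_subset[OF _ finite_keys[of p]]) (auto simp: in_keys_iff)
  define part where "part C = Abs_poly_mapping (\<lambda>x. if x \<in> C then Poly_Mapping.lookup p x else 0)" for C
  have part: "Poly_Mapping.lookup (part C) x = (if x \<in> C then Poly_Mapping.lookup p x else 0)" for C x
    unfolding part_def by (simp add: lookup_Abs_poly_mapping[OF fin])
  show thesis
  proof (rule that)
    show "p = part B + part (- B)" by (rule poly_mapping_eqI) (simp add: lookup_add part)
  qed (auto simp: in_keys_iff part split: if_splits)
qed

locale add_submonoid =
  fixes S :: "'m::comm_monoid_add set"
  assumes zero_S [simp, intro]: "0 \<in> S" and add_S [simp, intro]: "m \<in> S \<Longrightarrow> n \<in> S \<Longrightarrow> m + n \<in> S"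
begin

lemma sum_S: "(\<And>i. i \<in> I \<Longrightarrow> f i \<in> S) \<Longrightarrow> sum f I \<in> S"
  by (induction I rule: infinite_finite_induct) auto

end

definition monoid_algebra :: "'m set \<Rightarrow> ('m \<Rightarrow>\<^sub>0 'k::zero) set" where
  "monoid_algebra S = {p. Poly_Mapping.keys p \<subseteq> S}"

lemma single_mem_monoid_algebra [simp]: "m \<in> S \<Longrightarrow> Poly_Mapping.single m c \<in> monoid_algebra S"
  by (simp add: monoid_algebra_def)

lemma (in add_submonoid) monoid_algebra_mult_closed:
  "p \<in> monoid_algebra S \<Longrightarrow> q \<in> monoid_algebra S \<Longrightarrow> p * q \<in> monoid_algebra S"
  using keys_mult[of p q] unfolding monoid_algebra_def by fastforce

lemma monoid_algebra_diff_closed: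
  fixes p q :: "'m \<Rightarrow>\<^sub>0 'k::ab_group_add"
  assumes "p \<in> monoid_algebra S" "q \<in> monoid_algebra S"
  shows "p - q \<in> monoid_algebra S"
proof -
  have "Poly_Mapping.keys (p - q) \<subseteq> Poly_Mapping.keys p \<union> Poly_Mapping.keys q"
    by (auto simp: in_keys_iff lookup_minus)
  then show ?thesis using assms unfolding monoid_algebra_def by blast
qed

lemma monoid_algebra_add_closed:
  "p \<in> monoid_algebra S \<Longrightarrow> q \<in> monoid_algebra S \<Longrightarrow> p + q \<in> monoid_algebra S"
  using keys_add[of p q] unfolding monoid_algebra_def by blast

lemma idom_subring_monoid_algebra:
  fixes S :: "'m::{ordered_cancel_comm_monoid_add, linorder} set"
  assumes "add_submonoid S"
  shows "idom_subring (monoid_algebra S :: ('m \<Rightarrow>\<^sub>0 'k::field) set)"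
proof
  show "1 \<in> (monoid_algebra S :: ('m \<Rightarrow>\<^sub>0 'k::field) set)"
    using add_submonoid.zero_S[OF assms] by (simp add: monoid_algebra_def)
qed (auto intro: monoid_algebra_diff_closed add_submonoid.monoid_algebra_mult_closed[OF assms])

abbreviation mon :: "'m \<Rightarrow> ('m \<Rightarrow>\<^sub>0 'k::comm_semiring_1)" where
  "mon m \<equiv> Poly_Mapping.single m 1"

lemma mon_add: "mon (m + n) = mon m * mon n" for m n :: "'m::comm_monoid_add"
  by (simp add: mult_single)

text \<open>The exponents form only a commutative monoid, so a multiple of \<open>m\<close> is
  written as a constant sum, here and below.\<close>

lemma mon_sum_const: "mon (\<Sum>i<k::nat. m) = mon m ^ k" for m :: "'m::comm_monoid_add"
  by (induction k) (simp_all add: mon_add mult.commute del: sum_constant)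

text \<open>A normal affine monoid seen through its facets, with \<open>\<sigma> j\<close> the
  distance from the facet \<open>j\<close>. By \<open>\<sigma>_divides\<close> a difference of two
  elements lies in \<open>S\<close> once all its weights are nonnegative (normality); by
  \<open>\<sigma>_separates\<close> no facet contains another; by \<open>\<sigma>_primitive\<close>
  the weights are normalized, so that some monomial is a uniformizer at each facet. The parameter
  \<open>A\<close> brings the coefficient field into the locale.\<close>

locale facet_monoid = add_submonoid S
  for S :: "'m::{ordered_cancel_comm_monoid_add, linorder} set" +
  fixes A :: "('m \<Rightarrow>\<^sub>0 'k::field) set" and J :: "'j set" and \<sigma> :: "'j \<Rightarrow> 'm \<Rightarrow> nat"
  assumes A_eq: "A = monoid_algebra S"
    and finite_J: "finite J"
    and \<sigma>_add: "m \<in> S \<Longrightarrow> n \<in> S \<Longrightarrow> \<sigma> j (m + n) = \<sigma> j m + \<sigma> j n"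
    and \<sigma>_divides: "m \<in> S \<Longrightarrow> u \<in> S \<Longrightarrow> (\<And>j. j \<in> J \<Longrightarrow> \<sigma> j m \<le> \<sigma> j u) \<Longrightarrow> \<exists>w\<in>S. u = m + w"
    and \<sigma>_separates: "i \<in> J \<Longrightarrow> j \<in> J \<Longrightarrow> i \<noteq> j \<Longrightarrow> \<exists>s\<in>S. \<sigma> j s = 0 \<and> \<sigma> i s > 0"
    and \<sigma>_primitive: "j \<in> J \<Longrightarrow> \<exists>m\<in>S. \<sigma> j m = 1"
begin

sublocale idom_subring A
  unfolding A_eq by (rule idom_subring_monoid_algebra) (rule add_submonoid_axioms)

lemma mem_A_iff: "a \<in> A \<longleftrightarrow> (\<forall>m\<in>Poly_Mapping.keys a. m \<in> S)"
  by (auto simp: A_eq monoid_algebra_def)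

lemma single_mem [simp]: "m \<in> S \<Longrightarrow> Poly_Mapping.single m c \<in> A"
  by (simp add: A_eq)

lemma \<sigma>_zero [simp]: "\<sigma> j 0 = 0"
  using \<sigma>_add[of 0 0 j] by simp

lemma \<sigma>_sum: "(\<And>i. i \<in> I \<Longrightarrow> f i \<in> S) \<Longrightarrow> \<sigma> j (sum f I) = (\<Sum>i\<in>I. \<sigma> j (f i))"
  by (induction I rule: infinite_finite_induct) (auto simp: \<sigma>_add sum_S)

definition filt :: "'j \<Rightarrow> nat \<Rightarrow> ('m \<Rightarrow>\<^sub>0 'k) set" where
  "filt j n = {a \<in> A. \<forall>m\<in>Poly_Mapping.keys a. n \<le> \<sigma> j m}"

text \<open>The monomial valuation of the facet. At \<open>0\<close> it is the minimum of an empty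
  set, so the results on it assume nonzero arguments.\<close>

definition val :: "'j \<Rightarrow> ('m \<Rightarrow>\<^sub>0 'k) \<Rightarrow> nat" where
  "val j a = Min (\<sigma> j ` Poly_Mapping.keys a)"

lemma filt_iff_val: "a \<noteq> 0 \<Longrightarrow> a \<in> filt j n \<longleftrightarrow> a \<in> A \<and> n \<le> val j a"
  by (auto simp: filt_def val_def)

lemma val_single [simp]: "c \<noteq> 0 \<Longrightarrow> val j (Poly_Mapping.single m c) = \<sigma> j m"
  by (simp add: val_def)

lemma filt_0 [simp]: "filt j 0 = A"
  by (auto simp: filt_def)

lemma zero_filt [simp]: "0 \<in> filt j n"
  by (simp add: filt_def)

lemma filt_add: "a \<in> filt j n \<Longrightarrow> b \<in> filt j n \<Longrightarrow> a + b \<in> filt j n"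
  using keys_add[of a b] unfolding filt_def by auto

lemma filt_diff: "a \<in> filt j n \<Longrightarrow> b \<in> filt j n \<Longrightarrow> a - b \<in> filt j n"
  unfolding filt_def by (auto simp: in_keys_iff lookup_minus)

lemma filt_mult: "a \<in> filt j k \<Longrightarrow> b \<in> filt j l \<Longrightarrow> a * b \<in> filt j (k + l)"
  using keys_mult[of a b] unfolding filt_def by (fastforce simp: mem_A_iff \<sigma>_add intro: add_mono)

text \<open>The product of the parts of lowest weight does not vanish, since the ambient ring is a
  domain.\<close>

lemma val_mult:
  assumes a: "a \<in> A" "a \<noteq> 0" and b: "b \<in> A" "b \<noteq> 0"
  shows "val j (a * b) = val j a + val j b"
proof -
  have "a * b \<in> filt j (val j a + val j b)"
    using a b by (intro filt_mult) (simp_all add: filt_iff_val)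
  then have ge: "val j a + val j b \<le> val j (a * b)" using a b filt_iff_val[of "a * b"] by simp
  have split: "\<exists>p0 p1. p = p0 + p1 \<and> p0 \<noteq> 0 \<and> p0 \<in> filt j (val j p) \<and> p1 \<in> filt j (Suc (val j p)) \<and>
      (\<forall>m\<in>Poly_Mapping.keys p0. \<sigma> j m = val j p)" if p: "p \<in> A" "p \<noteq> 0" for p
  proof -
    obtain p0 p1 where pp: "p = p0 + p1" "Poly_Mapping.keys p0 = Poly_Mapping.keys p \<inter> {m. \<sigma> j m = val j p}"
      "Poly_Mapping.keys p1 = Poly_Mapping.keys p - {m. \<sigma> j m = val j p}"
      by (rule poly_mapping_split)
    have ge: "val j p \<le> \<sigma> j m" if "m \<in> Poly_Mapping.keys p" for m using that by (simp add: val_def)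
    have "val j p \<in> \<sigma> j ` Poly_Mapping.keys p" unfolding val_def using p by (intro Min_in) auto
    then have "Poly_Mapping.keys p0 \<noteq> {}" unfolding pp(2) by auto
    then have "p0 \<noteq> 0" by auto
    moreover have "p0 \<in> filt j (val j p)" using pp(2) p by (auto simp: filt_def mem_A_iff)
    moreover have "p1 \<in> filt j (Suc (val j p))"
      using pp(3) p ge by (auto simp: filt_def mem_A_iff Suc_le_eq order.strict_iff_order)
    moreover have "\<forall>m\<in>Poly_Mapping.keys p0. \<sigma> j m = val j p" using pp(2) by auto
    ultimately show ?thesis using pp(1) by blast
  qed
  obtain a0 a1 where a01: "a = a0 + a1" "a0 \<noteq> 0" "a0 \<in> filt j (val j a)" "a1 \<in> filt j (Suc (val j a))"
    "\<forall>m\<in>Poly_Mapping.keys a0. \<sigma> j m = val j a" using split[OF a] by blast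
  obtain b0 b1 where b01: "b = b0 + b1" "b0 \<noteq> 0" "b0 \<in> filt j (val j b)" "b1 \<in> filt j (Suc (val j b))"
    "\<forall>m\<in>Poly_Mapping.keys b0. \<sigma> j m = val j b" using split[OF b] by blast
  have "\<not> Suc (val j a + val j b) \<le> val j (a * b)"
  proof
    assume "Suc (val j a + val j b) \<le> val j (a * b)"
    then have ab: "a * b \<in> filt j (Suc (val j a + val j b))" using a b filt_iff_val[of "a * b"] by auto
    have bf: "b \<in> filt j (val j b)" using b by (simp add: filt_iff_val)
    have "a0 * b0 = a * b - a1 * b - a0 * b1" unfolding a01(1) b01(1) by (simp add: algebra_simps)
    moreover have "a1 * b \<in> filt j (Suc (val j a + val j b))" using filt_mult[OF a01(4) bf] by simp
    moreover have "a0 * b1 \<in> filt j (Suc (val j a + val j b))" using filt_mult[OF a01(3) b01(4)] by simp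
    ultimately have low: "a0 * b0 \<in> filt j (Suc (val j a + val j b))" using ab by (simp add: filt_diff)
    have "a0 * b0 \<noteq> 0" using a01 b01 by simp
    then obtain m where m: "m \<in> Poly_Mapping.keys (a0 * b0)" by (metis keys_eq_empty ex_in_conv)
    then obtain u v where uv: "m = u + v" "u \<in> Poly_Mapping.keys a0" "v \<in> Poly_Mapping.keys b0"
      using keys_mult[of a0 b0] by blast
    then have "u \<in> S" "v \<in> S" using a01(3) b01(3) by (auto simp: filt_def mem_A_iff)
    then have "\<sigma> j m = val j a + val j b" using uv a01(5) b01(5) by (simp add: \<sigma>_add)
    moreover have "Suc (val j a + val j b) \<le> \<sigma> j m" using low m by (simp add: filt_def)
    ultimately show False by simp
  qed
  then show ?thesis using ge by simp
qed

lemma val_prod_list: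
  assumes "set xs \<subseteq> A - {0}"
  shows "val j (prod_list xs) = sum_list (map (val j) xs)"
  using assms
proof (induction xs)
  case Nil
  then show ?case using val_single[of 1 j 0] by simp
next
  case (Cons x xs)
  moreover have "prod_list xs \<noteq> 0" using Cons.prems by (auto simp: prod_list_zero_iff)
  ultimately show ?case using val_mult[of x "prod_list xs" j] prod_list_mem[of xs] by auto
qed

lemma mon_divides:
  assumes a: "a \<in> A" and u: "u \<in> S" and le: "\<And>m j. m \<in> Poly_Mapping.keys a \<Longrightarrow> j \<in> J \<Longrightarrow> \<sigma> j u \<le> \<sigma> j m"
  shows "\<exists>y\<in>A. a = mon u * y"
proof -
  have "\<forall>m\<in>Poly_Mapping.keys a. \<exists>w\<in>S. m = u + w"
    using \<sigma>_divides[OF u] a le by (auto simp: mem_A_iff)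
  then obtain w where w: "\<And>m. m \<in> Poly_Mapping.keys a \<Longrightarrow> w m \<in> S \<and> m = u + w m" by metis
  define y where "y = (\<Sum>m\<in>Poly_Mapping.keys a. Poly_Mapping.single (w m) (Poly_Mapping.lookup a m))"
  have "y \<in> A" unfolding y_def using w by (intro sum_mem) auto
  moreover have "mon u * y = (\<Sum>m\<in>Poly_Mapping.keys a. Poly_Mapping.single m (Poly_Mapping.lookup a m))"
    unfolding y_def sum_distrib_left using w by (intro sum.cong refl) (auto simp: mult_single)
  ultimately show ?thesis using poly_mapping_eq_sum_single[of "Poly_Mapping.keys a" a] by auto
qed

text \<open>The sum of the elements given by \<open>\<sigma>_separates\<close> is a point in the
  relative interior of the facet. Its monomial lies outside the facet prime, while its multiples
  gain arbitrary weight on all other facets.\<close>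

lemma facet_interior:
  assumes "j \<in> J"
  obtains s where "s \<in> S" "\<sigma> j s = 0" "\<And>i. i \<in> J \<Longrightarrow> i \<noteq> j \<Longrightarrow> 0 < \<sigma> i s"
proof -
  have "\<forall>i\<in>J - {j}. \<exists>s\<in>S. \<sigma> j s = 0 \<and> \<sigma> i s > 0" using \<sigma>_separates assms by auto
  then obtain f where f: "\<And>i. i \<in> J - {j} \<Longrightarrow> f i \<in> S \<and> \<sigma> j (f i) = 0 \<and> \<sigma> i (f i) > 0" by metis
  show thesis
  proof (rule that)
    show "sum f (J - {j}) \<in> S" using f by (intro sum_S) auto
    show "\<sigma> j (sum f (J - {j})) = 0" using f by (subst \<sigma>_sum) auto
    fix i assume i: "i \<in> J" "i \<noteq> j"
    have "0 < \<sigma> i (f i)" using f i by auto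
    also have "\<dots> \<le> (\<Sum>l\<in>J - {j}. \<sigma> i (f l))" using i finite_J by (intro member_le_sum) auto
    also have "\<dots> = \<sigma> i (sum f (J - {j}))" using f by (subst \<sigma>_sum) auto
    finally show "0 < \<sigma> i (sum f (J - {j}))" .
  qed
qed

text \<open>In the local ring at the facet \<open>j\<close> the monomial of \<open>u\<close> is a
  uniformizer. The multiplier is a large multiple of an interior point of the facet: it keeps the
  weight at \<open>j\<close> and provides the weight that divisibility by the power of
  \<open>mon u\<close> requires at the other facets.\<close>

lemma filt_extract:
  assumes j: "j \<in> J" and a: "a \<in> filt j k" and u: "u \<in> S" "\<sigma> j u = 1"
  obtains s y where "s \<in> S" "\<sigma> j s = 0" "y \<in> A" "mon s * a = mon u ^ k * y"
proof -
  obtain s0 where s0: "s0 \<in> S" "\<sigma> j s0 = 0" "\<And>i. i \<in> J \<Longrightarrow> i \<noteq> j \<Longrightarrow> 0 < \<sigma> i s0"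
    using facet_interior[OF j] by blast
  \<comment> \<open>\<open>N\<close> bounds the weight of \<open>k\<close> copies of
    \<open>u\<close> at every facet, and each copy of \<open>s0\<close> contributes at least one off
    \<open>j\<close>.\<close>
  define N where "N = (\<Sum>i\<in>J. k * \<sigma> i u)"
  define s where "s = (\<Sum>i<N. s0)"
  define v where "v = (\<Sum>i<k. u)"
  have sv: "s \<in> S" "v \<in> S" unfolding s_def v_def using s0 u by (auto intro!: sum_S)
  have \<sigma>s: "\<sigma> i s = N * \<sigma> i s0" "\<sigma> i v = k * \<sigma> i u" for i
    unfolding s_def v_def using s0 u by (simp_all add: \<sigma>_sum del: sum_constant) simp_all
  have aA: "a \<in> A" using a by (simp add: filt_def)
  have "\<sigma> i v \<le> \<sigma> i m" if m: "m \<in> Poly_Mapping.keys (mon s * a)" and i: "i \<in> J" for m i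
  proof -
    obtain m' where m': "m = s + m'" "m' \<in> Poly_Mapping.keys a" 
      using m keys_single_mult[of 1 s a] by auto
    then have "m' \<in> S" using aA by (simp add: mem_A_iff)
    then have m: "\<sigma> i m = N * \<sigma> i s0 + \<sigma> i m'" using m' sv by (simp add: \<sigma>_add \<sigma>s)
    show ?thesis
    proof (cases "i = j")
      case True
      then show ?thesis using m a m' u by (auto simp: \<sigma>s filt_def)
    next
      case False
      have "k * \<sigma> i u \<le> N" unfolding N_def using i finite_J by (intro member_le_sum) auto
      also have "N * 1 \<le> N * \<sigma> i s0" using s0(3)[OF i False] by (intro mult_le_mono2) simp
      finally show ?thesis using m by (simp add: \<sigma>s)
    qed
  qed
  then obtain y where "y \<in> A" "mon s * a = mon v * y" using mon_divides[of "mon s * a" v] sv aA by auto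
  moreover have "\<sigma> j s = 0" using s0 by (simp add: \<sigma>s)
  ultimately show thesis using that sv(1) unfolding v_def mon_sum_const by blast
qed

section \<open>Facet primes: height one, position below monomials, valuations\<close>

abbreviation facet_prime :: "'j \<Rightarrow> ('m \<Rightarrow>\<^sub>0 'k) set" where
  "facet_prime j \<equiv> filt j (Suc 0)"

lemma mon_mem_facet_prime_iff: "m \<in> S \<Longrightarrow> mon m \<in> facet_prime j \<longleftrightarrow> 0 < \<sigma> j m"
  by (auto simp: filt_def)

lemma primeideal_facet_prime: "primeideal (facet_prime j) ring_on"
proof (rule primeideal_ring_onI)
  show "facet_prime j \<subseteq> A" by (auto simp: filt_def)
  show "a * x \<in> facet_prime j" if "x \<in> facet_prime j" "a \<in> A" for a x
    using filt_mult[of a j 0 x "Suc 0"] that by simp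
  show "1 \<notin> facet_prime j" using mon_mem_facet_prime_iff[of 0 j] by simp
  show "a \<in> facet_prime j \<or> b \<in> facet_prime j" if "a \<in> A" "b \<in> A" "a * b \<in> facet_prime j" for a b
  proof (cases "a = 0 \<or> b = 0")
    case False
    then show ?thesis using that by (auto simp: filt_iff_val val_mult)
  qed auto
qed (auto intro: filt_add)

lemma facet_prime_inj:
  assumes "i \<in> J" "j \<in> J" "facet_prime i = facet_prime j"
  shows "i = j"
proof (rule ccontr)
  assume "i \<noteq> j"
  then obtain s where "s \<in> S" "\<sigma> j s = 0" "\<sigma> i s > 0" using \<sigma>_separates assms by blast
  then show False using mon_mem_facet_prime_iff[of s i] mon_mem_facet_prime_iff[of s j] assms(3) by auto
qed

text \<open>By \<open>filt_extract\<close> a nonzero \<open>x\<close> in \<open>Q\<close> is, up to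
  a monomial outside the facet prime, a power of the uniformizer times some \<open>y\<close> of
  weight zero. Neither that monomial nor \<open>y\<close> lies in \<open>Q\<close>, so the
  uniformizer does; a second extraction, now with exponent one, puts every element of the facet
  prime into \<open>Q\<close>.\<close>

lemma facet_prime_minimal:
  assumes j: "j \<in> J" and Q: "primeideal Q ring_on" "Q \<subseteq> facet_prime j" "Q \<noteq> {0}"
  shows "Q = facet_prime j"
proof -
  note QD = primeideal_ring_onD[OF Q(1)]
  obtain u where u: "u \<in> S" "\<sigma> j u = 1" using \<sigma>_primitive[OF j] by blast
  obtain x where x: "x \<in> Q" "x \<noteq> 0" using QD(2) Q(3) by blast
  have xA: "x \<in> A" using x QD(1) by blast
  have s_notin: "mon s \<notin> Q" if "s \<in> S" "\<sigma> j s = 0" for s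
    using Q(2) mon_mem_facet_prime_iff[OF that(1), of j] that(2) by auto
  define k where "k = val j x"
  obtain s y where sy: "s \<in> S" "\<sigma> j s = 0" "y \<in> A" "mon s * x = mon u ^ k * y"
    using filt_extract[OF j _ u, of x k] x xA by (auto simp: filt_iff_val k_def)
  have "y \<noteq> 0" using sy(4) x by auto
  have uk: "mon u ^ k \<in> A" "val j (mon u ^ k :: 'm \<Rightarrow>\<^sub>0 'k) = k"
    using u by (auto simp: mon_sum_const[symmetric] \<sigma>_sum sum_S simp del: sum_constant) simp
  have "val j (mon s * x) = k" using val_mult[of "mon s" x j] sy x xA by (simp add: k_def)
  moreover have "val j (mon u ^ k * y) = k + val j y"
    using val_mult[of "mon u ^ k" y j] uk sy \<open>y \<noteq> 0\<close> by simp
  \<comment> \<open>The exponent \<open>k\<close> was chosen as the weight of \<open>x\<close>, so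
    it already accounts for the whole weight of the right-hand side.\<close>
  ultimately have "val j y = 0" using sy(4) by simp
  then have "y \<notin> Q" using Q(2) \<open>y \<noteq> 0\<close> by (auto simp: filt_iff_val)
  moreover have "mon u ^ k * y \<in> Q" using QD(4)[OF x(1), of "mon s"] sy by simp
  ultimately have "mon u ^ k \<in> Q" using QD(7)[OF uk(1) sy(3)] by blast
  then have uQ: "mon u \<in> Q" using primeideal_power[OF Q(1)] u(1) by auto
  have "p \<in> Q" if p: "p \<in> facet_prime j" for p
  proof -
    obtain s y where sy: "s \<in> S" "\<sigma> j s = 0" "y \<in> A" "mon s * p = mon u ^ Suc 0 * y"
      using filt_extract[OF j p u] by blast
    have "mon s * p \<in> Q" unfolding sy(4) using QD(5)[OF uQ sy(3)] by simp
    moreover have "p \<in> A" using p by (simp add: filt_def)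
    ultimately show ?thesis using QD(7)[of "mon s" p] s_notin[OF sy(1,2)] single_mem[OF sy(1)] by blast
  qed
  then show ?thesis using Q(2) by blast
qed

lemma facet_prime_mem_height_one_primes:
  assumes "j \<in> J"
  shows "facet_prime j \<in> height_one_primes ring_on"
proof -
  obtain u where "u \<in> S" "\<sigma> j u = 1" using \<sigma>_primitive[OF assms] by blast
  then have "mon u \<in> facet_prime j" using mon_mem_facet_prime_iff by simp
  then have "facet_prime j \<noteq> {0}" by (metis single_neq_0 singletonD zero_neq_one)
  then show ?thesis
    unfolding height_one_primes_ring_on using primeideal_facet_prime facet_prime_minimal[OF assms] by blast
qed

text \<open>If \<open>Q\<close> contained no facet prime, elements \<open>x j\<close> of the facet
  primes could be chosen outside \<open>Q\<close>. The product of the powers of \<open>x j\<close>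
  with exponent \<open>\<sigma> j m\<close> has weight at least \<open>\<sigma> j m\<close> at each
  facet \<open>j\<close>, so it is a multiple of \<open>mon m\<close> and lies in \<open>Q\<close>,
  although none of its factors does.\<close>

lemma facet_prime_below_monomial:
  assumes Q: "primeideal Q ring_on" and m: "m \<in> S" "mon m \<in> Q"
  shows "\<exists>j\<in>J. facet_prime j \<subseteq> Q"
proof (rule ccontr)
  assume "\<not> ?thesis"
  then have "\<forall>j\<in>J. \<exists>x. x \<in> facet_prime j \<and> x \<notin> Q" by blast
  then obtain x where x: "\<And>j. j \<in> J \<Longrightarrow> x j \<in> facet_prime j \<and> x j \<notin> Q" by metis
  note QD = primeideal_ring_onD[OF Q]
  have xA: "x j \<in> A" "x j \<noteq> 0" if "j \<in> J" for j using x[OF that] QD(2) by (auto simp: filt_def)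
  define y where "y = (\<Prod>j\<in>J. x j ^ \<sigma> j m)"
  have y: "(\<Prod>j\<in>K. x j ^ \<sigma> j m) \<in> A - Q" if "K \<subseteq> J" for K
    using finite_subset[OF that finite_J] that
  proof induction
    case empty
    then show ?case using QD(6) by simp
  next
    case (insert j K)
    have "x j ^ \<sigma> j m \<in> A - Q" using primeideal_power[OF Q, of "x j"] x[of j] xA[of j] insert.prems power_mem by auto
    then show ?case using insert QD(7) by auto
  qed
  have yA: "y \<in> A - Q" using y[of J] by (simp add: y_def)
  have "y \<in> filt j (\<sigma> j m)" if j: "j \<in> J" for j
  proof -
    have "x j ^ n \<in> filt j n" for n
    proof (induction n)
      case 0
      show ?case by simp
    next
      case (Suc n)
      then show ?case using filt_mult[of "x j" j "Suc 0" "x j ^ n" n] x[OF j] by simp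
    qed
    moreover have "y = x j ^ \<sigma> j m * (\<Prod>j\<in>J - {j}. x j ^ \<sigma> j m)"
      unfolding y_def using j finite_J by (rule prod.remove[rotated])
    moreover have "(\<Prod>j\<in>J - {j}. x j ^ \<sigma> j m) \<in> filt j 0" using y[of "J - {j}"] by simp
    ultimately show ?thesis using filt_mult[of _ j "\<sigma> j m" _ 0] by simp
  qed
  then have "\<exists>z\<in>A. y = mon m * z" using yA m by (intro mon_divides) (auto simp: filt_def)
  then show False using yA QD(5)[OF m(2)] by blast
qed

text \<open>The symbolic powers are the weight filtration: a multiplier outside the prime has weight
  zero, so it cannot increase the weight, and \<open>filt_extract\<close> supplies the multiplier
  for the converse.\<close>

lemma local_power_facet_prime:
  assumes j: "j \<in> J" and a: "a \<in> A"
  shows "a \<in> local_power ring_on (facet_prime j) n \<longleftrightarrow> a \<in> filt j n"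
proof
  assume "a \<in> local_power ring_on (facet_prime j) n"
  then obtain s where s: "s \<in> A" "s \<notin> facet_prime j" "s * a \<in> facet_prime j [^]\<^bsub>ideals_set ring_on\<^esub> n"
    by (auto simp: local_power_def)
  have "facet_prime j [^]\<^bsub>ideals_set ring_on\<^esub> n \<subseteq> filt j n"
    by (rule ideal_power_subset) (use filt_add filt_mult[of _ j _ _ "Suc 0"] in auto)
  then have sa: "s * a \<in> filt j n" using s by blast
  show "a \<in> filt j n"
  proof (cases "a = 0")
    case False
    moreover have "s \<noteq> 0" using s by auto
    moreover have "val j s = 0" using s \<open>s \<noteq> 0\<close> by (simp add: filt_iff_val)
    ultimately show ?thesis using sa s(1) a by (simp add: filt_iff_val val_mult)
  qed simp
next
  assume an: "a \<in> filt j n"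
  obtain u where u: "u \<in> S" "\<sigma> j u = 1" using \<sigma>_primitive[OF j] by blast
  obtain s y where s: "s \<in> S" "\<sigma> j s = 0" "y \<in> A" "mon s * a = mon u ^ n * y"
    using filt_extract[OF j an u] by blast
  have "mon u ^ n * y \<in> facet_prime j [^]\<^bsub>ideals_set ring_on\<^esub> n"
    using u s primeideal_facet_prime mon_mem_facet_prime_iff[of u j]
    by (intro power_mem_ideal_power primeideal.axioms(1)) auto
  moreover have "mon s \<notin> facet_prime j" "mon s \<in> A" using mon_mem_facet_prime_iff[of s j] s by auto
  ultimately show "a \<in> local_power ring_on (facet_prime j) n"
    using a s(4) unfolding local_power_def by (auto intro!: bexI[of _ "mon s"])
qed

lemma ord_at_facet_prime:
  "j \<in> J \<Longrightarrow> a \<in> A \<Longrightarrow> a \<noteq> 0 \<Longrightarrow> ord_at ring_on (facet_prime j) a = val j a"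
  by (rule ord_at_eqI) (subst local_power_facet_prime, auto simp: filt_iff_val)

end

section \<open>Primes not containing a monomial\<close>

text \<open>Divisibility in the localization of the monoid algebra at its monomials.\<close>

definition loc_dvd :: "'m set \<Rightarrow> ('m::comm_monoid_add \<Rightarrow>\<^sub>0 'k::field) \<Rightarrow> ('m \<Rightarrow>\<^sub>0 'k) \<Rightarrow> bool" where
  "loc_dvd S p a \<longleftrightarrow> (\<exists>m\<in>S. \<exists>c\<in>monoid_algebra S. mon m * a = p * c)"

definition loc_prime :: "'m set \<Rightarrow> ('m::comm_monoid_add \<Rightarrow>\<^sub>0 'k::field) \<Rightarrow> bool" where
  "loc_prime S p \<longleftrightarrow> p \<in> monoid_algebra S \<and> p \<noteq> 0 \<and> \<not> loc_dvd S p 1 \<and>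
     (\<forall>a\<in>monoid_algebra S. \<forall>b\<in>monoid_algebra S.
        loc_dvd S p (a * b) \<longrightarrow> loc_dvd S p a \<or> loc_dvd S p b)"

text \<open>The units of the localization are quotients of single terms
  (\<open>factor_of_single\<close>), so the unit of a factorization is spelled out: \<open>m\<close>
  is its denominator, \<open>n\<close> and \<open>c\<close> make up its numerator.\<close>

definition loc_factorial :: "'m set \<Rightarrow> ('m::comm_monoid_add \<Rightarrow>\<^sub>0 'k::field) set \<Rightarrow> bool" where
  "loc_factorial S A \<longleftrightarrow> (\<forall>a\<in>A. a \<noteq> 0 \<longrightarrow> (\<exists>m\<in>S. \<exists>n\<in>S. \<exists>c ps. c \<noteq> 0 \<and> (\<forall>p\<in>set ps. loc_prime S p) \<and>
     mon m * a = Poly_Mapping.single n c * prod_list ps))"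

locale factorial_facet_monoid = facet_monoid S A J \<sigma>
  for S :: "'m::{ordered_cancel_comm_monoid_add, linorder} set" and A :: "('m \<Rightarrow>\<^sub>0 'k::field) set"
    and J :: "'j set" and \<sigma> :: "'j \<Rightarrow> 'm \<Rightarrow> nat" +
  assumes loc_factorial: "loc_factorial S A"
begin

abbreviation ldvd :: "('m \<Rightarrow>\<^sub>0 'k) \<Rightarrow> ('m \<Rightarrow>\<^sub>0 'k) \<Rightarrow> bool" (infix "ldvd" 50) where
  "p ldvd a \<equiv> loc_dvd S p a"

abbreviation lprime :: "('m \<Rightarrow>\<^sub>0 'k) \<Rightarrow> bool" where
  "lprime \<equiv> loc_prime S"

lemma ldvdI: "m \<in> S \<Longrightarrow> c \<in> A \<Longrightarrow> mon m * a = p * c \<Longrightarrow> p ldvd a"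
  unfolding loc_dvd_def A_eq by blast

lemma ldvdE:
  assumes "p ldvd a"
  obtains m c where "m \<in> S" "c \<in> A" "mon m * a = p * c"
  using assms unfolding loc_dvd_def A_eq by blast

lemma lprimeD:
  assumes "lprime p"
  shows "p \<in> A" "p \<noteq> 0" "\<not> p ldvd 1" "a \<in> A \<Longrightarrow> b \<in> A \<Longrightarrow> p ldvd (a * b) \<Longrightarrow> p ldvd a \<or> p ldvd b"
  using assms unfolding loc_prime_def A_eq by blast+

lemma ldvd_refl: "p ldvd p"
  by (rule ldvdI[of 0 1]) auto

lemma ldvd_zero [simp]: "p ldvd 0"
  by (rule ldvdI[of 0 0]) auto

lemma one_ldvd: "a \<in> A \<Longrightarrow> 1 ldvd a"
  by (rule ldvdI[of 0 a]) auto

lemma ldvd_mult_right: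
  assumes "p ldvd a" "b \<in> A"
  shows "p ldvd (a * b)"
proof -
  obtain m c where mc: "m \<in> S" "c \<in> A" "mon m * a = p * c" using ldvdE[OF assms(1)] .
  have "mon m * (a * b) = p * (c * b)" using mc(3) by (metis mult.assoc)
  then show ?thesis using ldvdI mc(1) mult_mem[OF mc(2) assms(2)] by blast
qed

lemma ldvd_mult_left: "p ldvd a \<Longrightarrow> b \<in> A \<Longrightarrow> p ldvd (b * a)"
  using ldvd_mult_right by (metis mult.commute)

lemma ldvd_add:
  assumes "p ldvd a" "p ldvd b"
  shows "p ldvd (a + b)"
proof -
  obtain m c where mc: "m \<in> S" "c \<in> A" "mon m * a = p * c" using ldvdE[OF assms(1)] .
  obtain n d where nd: "n \<in> S" "d \<in> A" "mon n * b = p * d" using ldvdE[OF assms(2)] .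
  have "mon (m + n) * (a + b) = mon n * (mon m * a) + mon m * (mon n * b)"
    by (simp add: mon_add algebra_simps)
  also have "\<dots> = p * (mon n * c + mon m * d)" unfolding mc(3) nd(3) by (simp add: algebra_simps)
  finally show ?thesis using ldvdI[of "m + n" "mon n * c + mon m * d"] mc nd by simp
qed

lemma ldvd_mult_mono:
  assumes "p ldvd a" "q ldvd b"
  shows "(p * q) ldvd (a * b)"
proof -
  obtain m c where mc: "m \<in> S" "c \<in> A" "mon m * a = p * c" using ldvdE[OF assms(1)] .
  obtain n d where nd: "n \<in> S" "d \<in> A" "mon n * b = q * d" using ldvdE[OF assms(2)] .
  have "mon (m + n) * (a * b) = (mon m * a) * (mon n * b)"
    by (simp add: mon_add algebra_simps)
  also have "\<dots> = (p * q) * (c * d)" unfolding mc(3) nd(3) by (simp add: algebra_simps)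
  finally show ?thesis using ldvdI[of "m + n" "c * d"] mc nd by simp
qed

lemma ldvd_cancel_left:
  assumes "(p * q) ldvd (p * a)" "p \<noteq> 0"
  shows "q ldvd a"
proof -
  obtain m c where mc: "m \<in> S" "c \<in> A" "mon m * (p * a) = p * q * c" using ldvdE[OF assms(1)] .
  have "p * (mon m * a) = p * (q * c)" using mc(3) by (simp add: algebra_simps)
  then have "mon m * a = q * c" using assms(2) by simp
  then show ?thesis using ldvdI mc by blast
qed

lemma ldvd_mon_cancel:
  assumes "p ldvd (mon m * a)" "m \<in> S"
  shows "p ldvd a"
proof -
  obtain n c where nc: "n \<in> S" "c \<in> A" "mon n * (mon m * a) = p * c" using ldvdE[OF assms(1)] .
  have "mon (n + m) * a = p * c" using nc(3) by (simp add: mon_add mult.assoc)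
  then show ?thesis using ldvdI[of "n + m" c] nc assms(2) by simp
qed

lemma ldvd_trans:
  assumes "p ldvd q" "q ldvd a"
  shows "p ldvd a"
proof -
  obtain m c where mc: "m \<in> S" "c \<in> A" "mon m * q = p * c" using ldvdE[OF assms(1)] .
  obtain n d where nd: "n \<in> S" "d \<in> A" "mon n * a = q * d" using ldvdE[OF assms(2)] .
  have "mon (m + n) * a = mon m * (q * d)" unfolding nd(3)[symmetric] by (simp add: mon_add mult.assoc)
  also have "\<dots> = p * (c * d)" using mc(3) by (metis mult.assoc)
  finally show ?thesis using ldvdI[of "m + n" "c * d"] mc nd by simp
qed

lemma lprime_not_ldvd_single:
  assumes p: "lprime p" and m: "m \<in> S" and c: "c \<noteq> 0"
  shows "\<not> p ldvd Poly_Mapping.single m c"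
proof
  assume "p ldvd Poly_Mapping.single m c"
  then have "p ldvd (Poly_Mapping.single m c * Poly_Mapping.single 0 (inverse c))"
    by (rule ldvd_mult_right) simp
  then have "p ldvd (mon m * 1)" using c by (simp add: mult_single)
  then show False using ldvd_mon_cancel m lprimeD(3)[OF p] by blast
qed

text \<open>One factor at a time: \<open>p\<close> divides \<open>s * a\<close>, hence
  \<open>a\<close>, and cancelling it lowers the exponent. It makes every element outside the prime
  behave like a unit at \<open>p\<close>.\<close>

lemma lprime_power_cancel:
  assumes p: "lprime p" and s: "s \<in> A" "\<not> p ldvd s" and a: "a \<in> A" and d: "p ^ n ldvd (s * a)"
  shows "p ^ n ldvd a"
  using a d
proof (induction n arbitrary: a)
  case 0
  then show ?case using one_ldvd by simp
next
  case (Suc n)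
  note pD = lprimeD[OF p]
  have pn: "p ^ n \<in> A" using pD(1) by (rule power_mem)
  have "p ldvd p ^ Suc n" using ldvd_mult_right[OF ldvd_refl pn] by simp
  then have "p ldvd (s * a)" using Suc.prems(2) ldvd_trans by blast
  then have "p ldvd a" using pD(4)[OF s(1) Suc.prems(1)] s(2) by blast
  then obtain m b where mb: "m \<in> S" "b \<in> A" "mon m * a = p * b" using ldvdE by blast
  have "p ^ Suc n ldvd (mon m * (s * a))" using ldvd_mult_left[OF Suc.prems(2)] mb(1) by simp
  moreover have "mon m * (s * a) = p * (s * b)" using mb(3) by (metis mult.left_commute)
  ultimately have "p ^ n ldvd (s * b)" using ldvd_cancel_left[of p "p ^ n" "s * b"] pD(2) by simp
  then have "p ^ n ldvd b" using Suc.IH mb(2) by blast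
  then have "(p * p ^ n) ldvd (p * b)" by (rule ldvd_mult_mono[OF ldvd_refl])
  then have "p ^ Suc n ldvd (mon m * a)" using mb(3) by simp
  then show ?case using ldvd_mon_cancel mb(1) by blast
qed

text \<open>The cofactor \<open>d\<close> of \<open>q\<close> by \<open>p\<close> is not divisible
  by \<open>q\<close>, as otherwise \<open>p\<close> would divide a monomial. Hence \<open>q\<close>
  divides \<open>p\<close>, the two cofactors multiply to a monomial, and
  \<open>factor_of_single\<close> turns \<open>d\<close> into a single term.\<close>

lemma lprime_associated:
  assumes p: "lprime p" and q: "lprime q" and pq: "p ldvd q"
  obtains m n c where "m \<in> S" "n \<in> S" "c \<noteq> 0" "mon m * q = Poly_Mapping.single n c * p"
proof -
  note pD = lprimeD[OF p] and qD = lprimeD[OF q]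
  obtain m d where md: "m \<in> S" "d \<in> A" "mon m * q = p * d" using ldvdE[OF pq] .
  have "q ldvd (p * d)" unfolding md(3)[symmetric] using ldvd_mult_left[OF ldvd_refl] md(1) by simp
  then have "q ldvd p \<or> q ldvd d" using qD(4) pD(1) md(2) by blast
  moreover have "\<not> q ldvd d"
  proof
    assume "q ldvd d"
    then obtain k e where ke: "k \<in> S" "e \<in> A" "mon k * d = q * e" by (rule ldvdE)
    have "q * mon (m + k) = mon k * (mon m * q)" by (simp add: mon_add ac_simps)
    also have "\<dots> = p * (mon k * d)" unfolding md(3) by (simp add: ac_simps)
    also have "\<dots> = q * (p * e)" unfolding ke(3) by (simp add: ac_simps)
    finally have "mon (m + k) = p * e" using qD(2) by simp
    then have "mon (m + k) * 1 = p * e" by simp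
    then have "p ldvd 1" using ldvdI[of "m + k" e 1 p] md ke by simp
    then show False using pD(3) by simp
  qed
  ultimately have "q ldvd p" by blast
  then obtain k e where ke: "k \<in> S" "e \<in> A" "mon k * p = q * e" by (rule ldvdE)
  have "q * mon (m + k) = mon k * (mon m * q)" by (simp add: mon_add ac_simps)
  also have "\<dots> = d * (mon k * p)" unfolding md(3) by (simp add: ac_simps)
  also have "\<dots> = q * (d * e)" unfolding ke(3) by (simp add: ac_simps)
  finally have "d * e = Poly_Mapping.single (m + k) 1" using qD(2) by simp
  then obtain n c where nc: "d = Poly_Mapping.single n c" "c \<noteq> 0" by (rule factor_of_single) simp
  then have "n \<in> S" using md(2) by (simp add: mem_A_iff)
  then show thesis using that md nc by (metis mult.commute)
qed

section \<open>Generic primes: contractions of the principal primes of the localization\<close>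

definition prime_of :: "('m \<Rightarrow>\<^sub>0 'k) \<Rightarrow> ('m \<Rightarrow>\<^sub>0 'k) set" where
  "prime_of p = {a \<in> A. p ldvd a}"

definition generic_primes :: "('m \<Rightarrow>\<^sub>0 'k) set set" where
  "generic_primes = {prime_of p | p. lprime p}"

text \<open>A fixed representative of each class of associated primes. Factorizations thus become
  lists of prime ideals, and multiplicities become \<open>count_list\<close>.\<close>

definition generator :: "('m \<Rightarrow>\<^sub>0 'k) set \<Rightarrow> ('m \<Rightarrow>\<^sub>0 'k)" where
  "generator Q = (SOME p. lprime p \<and> Q = prime_of p)"

lemma generator:
  assumes "Q \<in> generic_primes"
  shows "lprime (generator Q)" "Q = prime_of (generator Q)"
proof -
  have "\<exists>p. lprime p \<and> Q = prime_of p" using assms by (auto simp: generic_primes_def)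
  then have "lprime (generator Q) \<and> Q = prime_of (generator Q)" unfolding generator_def by (rule someI_ex)
  then show "lprime (generator Q)" "Q = prime_of (generator Q)" by auto
qed

lemma mem_generic_prime_iff: "Q \<in> generic_primes \<Longrightarrow> a \<in> Q \<longleftrightarrow> a \<in> A \<and> generator Q ldvd a"
  using generator(2)[of Q] unfolding prime_of_def by blast

lemma prime_of_mem: "lprime p \<Longrightarrow> prime_of p \<in> generic_primes"
  by (auto simp: generic_primes_def)

lemma prime_of_eq:
  assumes p: "lprime p" and q: "lprime q" and pq: "p ldvd q"
  shows "prime_of p = prime_of q"
proof -
  obtain m n c where mnc: "m \<in> S" "n \<in> S" "c \<noteq> 0" "mon m * q = Poly_Mapping.single n c * p"
    using lprime_associated[OF assms] .
  have "mon n * p = q * Poly_Mapping.single m (inverse c)"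
  proof -
    have "mon n * p = Poly_Mapping.single 0 (inverse c) * (Poly_Mapping.single n c * p)"
      using mnc(3) by (simp add: mult.assoc[symmetric] mult_single)
    also have "\<dots> = (Poly_Mapping.single 0 (inverse c) * mon m) * q"
      unfolding mnc(4)[symmetric] by (simp only: mult.assoc)
    also have "\<dots> = q * Poly_Mapping.single m (inverse c)"
      by (simp add: mult_single mult.commute)
    finally show ?thesis .
  qed
  then have "q ldvd p" using ldvdI[of n "Poly_Mapping.single m (inverse c)" p q] mnc(1,2) by simp
  then show ?thesis unfolding prime_of_def using ldvd_trans[OF pq] ldvd_trans[of q p] by auto
qed

lemma generator_ldvd_iff:
  assumes "Q \<in> generic_primes" "Q' \<in> generic_primes"
  shows "generator Q ldvd generator Q' \<longleftrightarrow> Q = Q'"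
proof
  assume "generator Q ldvd generator Q'"
  then have "prime_of (generator Q) = prime_of (generator Q')"
    by (rule prime_of_eq[OF generator(1)[OF assms(1)] generator(1)[OF assms(2)]])
  then show "Q = Q'" using generator(2)[OF assms(1)] generator(2)[OF assms(2)] by simp
qed (simp add: ldvd_refl)

lemma primeideal_generic:
  assumes "Q \<in> generic_primes"
  shows "primeideal Q ring_on"
proof (rule primeideal_ring_onI)
  note g = lprimeD[OF generator(1)[OF assms]] and m = mem_generic_prime_iff[OF assms]
  show "a \<in> Q \<or> b \<in> Q" if "a \<in> A" "b \<in> A" "a * b \<in> Q" for a b
    using that g(4)[of a b] m by blast
  show "1 \<notin> Q" using g(3) m by blast
  show "Q \<subseteq> A" using m by blast
  show "0 \<in> Q" using m by simp
  show "a * x \<in> Q" if "x \<in> Q" "a \<in> A" for a x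
    using that ldvd_mult_left m by simp
  show "x + y \<in> Q" if "x \<in> Q" "y \<in> Q" for x y
    using that ldvd_add m by simp
qed

lemma mon_notin_generic: "Q \<in> generic_primes \<Longrightarrow> m \<in> S \<Longrightarrow> mon m \<notin> Q"
  using lprime_not_ldvd_single[OF generator(1)] mem_generic_prime_iff by simp

lemma generator_mem: "Q \<in> generic_primes \<Longrightarrow> generator Q \<in> A" "Q \<in> generic_primes \<Longrightarrow> generator Q \<noteq> 0"
    "Q \<in> generic_primes \<Longrightarrow> generator Q \<in> Q"
  using lprimeD(1,2)[OF generator(1)] mem_generic_prime_iff ldvd_refl by auto

text \<open>A factorization of \<open>a\<close> in the localization, normalized by
  \<open>generator\<close>. The exponents \<open>m\<close> and \<open>n\<close> of the unit are kept
  because they carry its facet weights (\<open>val_factors\<close>); the scalar has none.\<close>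

definition factors :: "('m \<Rightarrow>\<^sub>0 'k) \<Rightarrow> 'm \<Rightarrow> 'm \<Rightarrow> ('m \<Rightarrow>\<^sub>0 'k) set list \<Rightarrow> bool" where
  "factors a m n Qs \<longleftrightarrow> a \<in> A \<and> m \<in> S \<and> n \<in> S \<and> set Qs \<subseteq> generic_primes \<and>
     (\<exists>c. c \<noteq> 0 \<and> mon m * a = Poly_Mapping.single n c * prod_list (map generator Qs))"

lemma factors_exist:
  assumes "a \<in> A" "a \<noteq> 0"
  obtains m n Qs where "factors a m n Qs"
proof -
  obtain m n c ps where ps: "m \<in> S" "n \<in> S" "c \<noteq> 0" "\<forall>p\<in>set ps. lprime p"
    "mon m * a = Poly_Mapping.single n c * prod_list ps"
    using loc_factorial[unfolded loc_factorial_def, rule_format, OF assms] by auto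
  \<comment> \<open>Each prime is replaced by the generator of its class; the monomials and scalars
    of these exchanges are collected.\<close>
  have "\<exists>m n c Qs. m \<in> S \<and> n \<in> S \<and> c \<noteq> 0 \<and> set Qs \<subseteq> generic_primes \<and>
      mon m * prod_list ps = Poly_Mapping.single n c * prod_list (map generator Qs)"
    using ps(4)
  proof (induction ps)
    case Nil
    show ?case by (rule exI[of _ 0], rule exI[of _ 0], rule exI[of _ 1], rule exI[of _ "[]"]) simp
  next
    case (Cons p ps)
    obtain m n c Qs where IH: "m \<in> S" "n \<in> S" "c \<noteq> 0" "set Qs \<subseteq> generic_primes"
      "mon m * prod_list ps = Poly_Mapping.single n c * prod_list (map generator Qs)"
      using Cons.IH Cons.prems by auto
    define Q where "Q = prime_of p"
    have p: "lprime p" using Cons.prems by simp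
    have Q: "Q \<in> generic_primes" unfolding Q_def by (rule prime_of_mem[OF p])
    have "p \<in> Q" using lprimeD(1)[OF p] ldvd_refl by (simp add: Q_def prime_of_def)
    then have "generator Q ldvd p" using mem_generic_prime_iff[OF Q] by simp
    then obtain k l d where kl: "k \<in> S" "l \<in> S" "d \<noteq> 0" "mon k * p = Poly_Mapping.single l d * generator Q"
      using lprime_associated[OF generator(1)[OF Q] p] by blast
    have "mon (k + m) * prod_list (p # ps) = (mon k * p) * (mon m * prod_list ps)"
      by (simp add: mon_add ac_simps)
    also have "\<dots> = (Poly_Mapping.single l d * Poly_Mapping.single n c) * prod_list (map generator (Q # Qs))"
      unfolding kl(4) IH(5) by (simp add: ac_simps)
    finally show ?case using kl IH Q
      by (intro exI[of _ "k + m"] exI[of _ "l + n"] exI[of _ "d * c"] exI[of _ "Q # Qs"]) (auto simp: mult_single)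
  qed
  then obtain k l d Qs where Qs: "k \<in> S" "l \<in> S" "d \<noteq> 0" "set Qs \<subseteq> generic_primes"
      "mon k * prod_list ps = Poly_Mapping.single l d * prod_list (map generator Qs)" by blast
  have "mon (k + m) * a = mon k * (mon m * a)" by (simp add: mon_add ac_simps)
  also have "\<dots> = Poly_Mapping.single n c * (mon k * prod_list ps)" unfolding ps(5) by (simp add: ac_simps)
  also have "\<dots> = Poly_Mapping.single (n + l) (c * d) * prod_list (map generator Qs)"
    unfolding Qs(5) by (simp add: mult.assoc[symmetric] mult_single)
  finally have "factors a (k + m) (n + l) Qs"
    unfolding factors_def using Qs(1,2,3,4) ps(1,2,3) assms by (intro conjI exI[of _ "c * d"]) auto
  then show thesis by (rule that)
qed

lemma generator_list_mem: "set Qs \<subseteq> generic_primes \<Longrightarrow> set (map generator Qs) \<subseteq> A - {0}"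
  using generator_mem by auto

lemma generator_prod_mem: "set Qs \<subseteq> generic_primes \<Longrightarrow> prod_list (map generator Qs) \<in> A - {0}"
  using generator_list_mem[of Qs] prod_list_mem[of "map generator Qs"]
  by (auto simp: prod_list_zero_iff)

text \<open>A factor belonging to \<open>Q\<close> itself cancels against one power; a factor of
  another prime is not divisible by \<open>generator Q\<close> and drops out by
  \<open>lprime_power_cancel\<close>.\<close>

lemma power_ldvd_prod_iff:
  assumes Q: "Q \<in> generic_primes" and n: "n \<in> S" "c \<noteq> 0" and Qs: "set Qs \<subseteq> generic_primes"
  shows "generator Q ^ k ldvd (Poly_Mapping.single n c * prod_list (map generator Qs)) \<longleftrightarrow> k \<le> count_list Qs Q"
  using Qs
proof (induction Qs arbitrary: k)
  case Nil
  show ?case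
  proof (cases k)
    case 0
    then show ?thesis using one_ldvd n by simp
  next
    case (Suc l)
    have "generator Q ldvd generator Q ^ Suc l"
      using ldvd_mult_right[OF ldvd_refl power_mem[OF generator_mem(1)[OF Q]]] by simp
    then show ?thesis
      using Suc lprime_not_ldvd_single[OF generator(1)[OF Q] n] ldvd_trans by auto
  qed
next
  case (Cons Q' Qs)
  define r where "r = Poly_Mapping.single n c * prod_list (map generator Qs)"
  have r: "r \<in> A" unfolding r_def using generator_prod_mem[of Qs] Cons.prems n by auto
  have IH: "generator Q ^ k ldvd r \<longleftrightarrow> k \<le> count_list Qs Q" for k
    using Cons unfolding r_def by simp
  have Q': "Q' \<in> generic_primes" using Cons.prems by simp
  have eq: "Poly_Mapping.single n c * prod_list (map generator (Q' # Qs)) = generator Q' * r"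
    by (simp add: r_def ac_simps)
  show ?case
  proof (cases "Q' = Q")
    case True
    show ?thesis
    proof (cases k)
      case 0
      then show ?thesis unfolding eq using one_ldvd r generator_mem(1)[OF Q'] by simp
    next
      case (Suc l)
      have "generator Q ^ k ldvd (generator Q * r) \<longleftrightarrow> generator Q ^ l ldvd r"
        using ldvd_cancel_left[of "generator Q" "generator Q ^ l" r] generator_mem(2)[OF Q]
          ldvd_mult_mono[OF ldvd_refl, of "generator Q ^ l" r "generator Q"] unfolding Suc by auto
      then show ?thesis unfolding eq using IH True Suc by simp
    qed
  next
    case False
    then have "\<not> generator Q ldvd generator Q'" using generator_ldvd_iff[OF Q Q'] by auto
    then have "generator Q ^ k ldvd (generator Q' * r) \<longleftrightarrow> generator Q ^ k ldvd r"
      using lprime_power_cancel[OF generator(1)[OF Q] generator_mem(1)[OF Q'] _ r]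
        ldvd_mult_left[OF _ generator_mem(1)[OF Q']] by blast
    then show ?thesis unfolding eq using IH False by simp
  qed
qed

text \<open>Monomials lie outside \<open>Q\<close>, so the monomial hidden in \<open>ldvd\<close>
  can serve as the multiplier \<open>s\<close>. Conversely, any multiplier outside \<open>Q\<close>
  can be removed by \<open>lprime_power_cancel\<close>.\<close>

lemma local_power_generic:
  assumes Q: "Q \<in> generic_primes" and a: "a \<in> A"
  shows "a \<in> local_power ring_on Q n \<longleftrightarrow> generator Q ^ n ldvd a"
proof
  let ?p = "generator Q"
  assume "a \<in> local_power ring_on Q n"
  then obtain s where s: "s \<in> A" "s \<notin> Q" "s * a \<in> Q [^]\<^bsub>ideals_set ring_on\<^esub> n"
    by (auto simp: local_power_def)
  have "Q [^]\<^bsub>ideals_set ring_on\<^esub> n \<subseteq> {x. ?p ^ n ldvd x}"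
  proof (rule ideal_power_subset)
    show "x * y \<in> {x. ?p ^ Suc n ldvd x}" if "x \<in> {x. ?p ^ n ldvd x}" "y \<in> Q" for n x y
      using ldvd_mult_mono[of "?p ^ n" x ?p y] that mem_generic_prime_iff[OF Q] by (simp add: mult.commute)
  qed (use ldvd_add one_ldvd in auto)
  then have "?p ^ n ldvd (s * a)" using s by blast
  then show "?p ^ n ldvd a"
    using lprime_power_cancel[OF generator(1)[OF Q] s(1) _ a] s mem_generic_prime_iff[OF Q] by blast
next
  assume "generator Q ^ n ldvd a"
  then obtain m c where mc: "m \<in> S" "c \<in> A" "mon m * a = generator Q ^ n * c" by (rule ldvdE)
  have "mon m * a \<in> Q [^]\<^bsub>ideals_set ring_on\<^esub> n"
    unfolding mc(3) using primeideal.axioms(1)[OF primeideal_generic[OF Q]] generator_mem(3)[OF Q] mc(2)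
    by (rule power_mem_ideal_power)
  then show "a \<in> local_power ring_on Q n"
    unfolding local_power_def using a mon_notin_generic[OF Q mc(1)] single_mem[OF mc(1)]
    by (auto intro!: bexI[of _ "mon m"])
qed

lemma ord_at_generic:
  assumes Q: "Q \<in> generic_primes" and f: "factors a m n Qs"
  shows "ord_at ring_on Q a = count_list Qs Q"
proof (rule ord_at_eqI)
  fix k
  obtain c where c: "c \<noteq> 0" "mon m * a = Poly_Mapping.single n c * prod_list (map generator Qs)"
    and mn: "m \<in> S" "n \<in> S" "set Qs \<subseteq> generic_primes" "a \<in> A" using f unfolding factors_def by blast
  have "generator Q ^ k ldvd a \<longleftrightarrow> generator Q ^ k ldvd (mon m * a)"
    using ldvd_mult_left[of _ a "mon m"] ldvd_mon_cancel mn(1) by auto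
  then show "a \<in> local_power ring_on Q k \<longleftrightarrow> k \<le> count_list Qs Q"
    unfolding local_power_generic[OF Q mn(4)] c(2) power_ldvd_prod_iff[OF Q mn(2) c(1) mn(3)] .
qed

lemma factors_nonzero: "factors a m n Qs \<Longrightarrow> a \<noteq> 0"
  unfolding factors_def using generator_prod_mem[of Qs] by auto

text \<open>The valuation of both sides of the factorization. This link between generic
  multiplicities and facet weights is what allows the generic part of a divisor to be moved to the
  facets.\<close>

lemma val_factors:
  assumes "factors a m n Qs"
  shows "\<sigma> j m + val j a = \<sigma> j n + (\<Sum>Q\<leftarrow>Qs. val j (generator Q))"
proof -
  obtain c where c: "c \<noteq> 0" "mon m * a = Poly_Mapping.single n c * prod_list (map generator Qs)"
    and mn: "m \<in> S" "n \<in> S" "set Qs \<subseteq> generic_primes" "a \<in> A" using assms unfolding factors_def by blast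
  have "\<sigma> j m + val j a = val j (mon m * a)"
    using val_mult[of "mon m" a j] mn factors_nonzero[OF assms] by simp
  also have "\<dots> = \<sigma> j n + val j (prod_list (map generator Qs))"
    unfolding c(2) using val_mult[of "Poly_Mapping.single n c" _ j] generator_prod_mem[OF mn(3)] mn c(1) by simp
  also have "val j (prod_list (map generator Qs)) = (\<Sum>Q\<leftarrow>Qs. val j (generator Q))"
    using val_prod_list[OF generator_list_mem[OF mn(3)]] by (simp add: o_def)
  finally show ?thesis .
qed

text \<open>Factor a nonzero element of \<open>P\<close>. The single term is not in
  \<open>P\<close>, so some generator is; whatever this generator divides up to a monomial then lies
  in \<open>P\<close>, as the monomials do not.\<close>

lemma generic_prime_below:
  assumes P: "primeideal P ring_on" "P \<noteq> {0}" and no_mon: "\<And>m. m \<in> S \<Longrightarrow> mon m \<notin> P"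
  shows "\<exists>Q\<in>generic_primes. Q \<subseteq> P"
proof -
  note PD = primeideal_ring_onD[OF P(1)]
  obtain a where a: "a \<in> P" "a \<noteq> 0" using PD(2) P(2) by blast
  then obtain m n Qs where f: "factors a m n Qs" using factors_exist PD(1) by blast
  obtain c where c: "c \<noteq> 0" "mon m * a = Poly_Mapping.single n c * prod_list (map generator Qs)"
    and mn: "m \<in> S" "n \<in> S" "set Qs \<subseteq> generic_primes" using f unfolding factors_def by blast
  have "Poly_Mapping.single n c \<notin> P"
  proof
    assume "Poly_Mapping.single n c \<in> P"
    then have "Poly_Mapping.single n c * Poly_Mapping.single 0 (inverse c) \<in> P" by (rule PD(5)) simp
    then show False using no_mon[OF mn(2)] c(1) by (simp add: mult_single)
  qed
  moreover have "Poly_Mapping.single n c * prod_list (map generator Qs) \<in> P"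
    unfolding c(2)[symmetric] using PD(4)[OF a(1)] mn(1) by simp
  ultimately have "prod_list (map generator Qs) \<in> P"
    using PD(7) generator_prod_mem[OF mn(3)] mn(2) single_mem by blast
  then obtain x where "x \<in> set (map generator Qs)" "x \<in> P"
    using primeideal_prod_list[OF P(1), of "map generator Qs"] generator_list_mem[OF mn(3)] by blast
  then obtain Q where Q: "Q \<in> generic_primes" "generator Q \<in> P" using mn(3) by auto
  have "b \<in> P" if b: "b \<in> Q" for b
  proof -
    have bA: "b \<in> A" "generator Q ldvd b" using b mem_generic_prime_iff[OF Q(1)] by auto
    obtain k d where kd: "k \<in> S" "d \<in> A" "mon k * b = generator Q * d" using ldvdE[OF bA(2)] .
    have "mon k * b \<in> P" unfolding kd(3) using PD(5)[OF Q(2) kd(2)] .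
    then show ?thesis using PD(7)[OF single_mem[OF kd(1)] bA(1)] no_mon[OF kd(1)] by blast
  qed
  then show ?thesis using Q(1) by blast
qed

lemma generic_mem_height_one_primes:
  assumes Q: "Q \<in> generic_primes"
  shows "Q \<in> height_one_primes ring_on"
  unfolding height_one_primes_ring_on
proof (intro conjI allI impI)
  show "primeideal Q ring_on" by (rule primeideal_generic[OF Q])
  show "Q \<noteq> {0}" using generator_mem[OF Q] by blast
  fix P assume P: "primeideal P ring_on" "P \<subseteq> Q" "P \<noteq> {0}"
  then obtain Q' where Q': "Q' \<in> generic_primes" "Q' \<subseteq> P"
    using generic_prime_below[OF P(1,3)] mon_notin_generic[OF Q] by blast
  then have "generator Q' \<in> Q" using P(2) generator_mem(3)[OF Q'(1)] by blast
  then have "Q = Q'" using mem_generic_prime_iff[OF Q] generator_ldvd_iff[OF Q Q'(1)] by blast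
  then show "P = Q" using Q' P by blast
qed

lemma height_one_primes_eq: "height_one_primes ring_on = facet_prime ` J \<union> generic_primes"
proof
  show "facet_prime ` J \<union> generic_primes \<subseteq> height_one_primes ring_on"
    using facet_prime_mem_height_one_primes generic_mem_height_one_primes by blast
  show "height_one_primes ring_on \<subseteq> facet_prime ` J \<union> generic_primes"
  proof
    fix P assume P: "P \<in> height_one_primes ring_on"
    then have pr: "primeideal P ring_on" "P \<noteq> {0}"
      and min: "\<And>Q. primeideal Q ring_on \<Longrightarrow> Q \<subseteq> P \<Longrightarrow> Q \<noteq> {0} \<Longrightarrow> Q = P"
      unfolding height_one_primes_ring_on by blast+
    show "P \<in> facet_prime ` J \<union> generic_primes"
    proof (cases "\<exists>m\<in>S. mon m \<in> P")
      case True
      then obtain j where j: "j \<in> J" "facet_prime j \<subseteq> P" using facet_prime_below_monomial[OF pr(1)] by blast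
      then have "facet_prime j = P"
        using min[of "facet_prime j"] facet_prime_mem_height_one_primes[OF j(1)]
        unfolding height_one_primes_ring_on by blast
      then show ?thesis using j(1) by blast
    next
      case False
      then obtain Q where Q: "Q \<in> generic_primes" "Q \<subseteq> P" using generic_prime_below[OF pr] by blast
      then have "Q = P"
        using min[of Q] generic_mem_height_one_primes[OF Q(1)] unfolding height_one_primes_ring_on by blast
      then show ?thesis using Q(1) by blast
    qed
  qed
qed

lemma facet_prime_notin_generic: "j \<in> J \<Longrightarrow> facet_prime j \<notin> generic_primes"
proof
  assume "j \<in> J" "facet_prime j \<in> generic_primes"
  moreover obtain u where "u \<in> S" "\<sigma> j u = 1" using \<sigma>_primitive[OF \<open>j \<in> J\<close>] by blast
  ultimately show False using mon_notin_generic[of "facet_prime j" u] mon_mem_facet_prime_iff[of u j] by simp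
qed

end

section \<open>The divisor class group of a monoid algebra\<close>

lemma exists_list_with_counts:
  assumes "finite K"
  shows "\<exists>xs. set xs \<subseteq> K \<and> (\<forall>x\<in>K. count_list xs x = f x)"
  using assms
proof induction
  case empty
  then show ?case by (intro exI[of _ "[]"]) simp
next
  case (insert x K)
  then obtain xs where xs: "set xs \<subseteq> K" "\<forall>y\<in>K. count_list xs y = f y" by blast
  have rep: "count_list (replicate n x) y = (if y = x then n else 0)" for n y
    by (induction n) auto
  have "count_list xs x = 0" using xs(1) insert.hyps(2) by (auto simp: count_list_0_iff)
  then show ?case using xs insert.hyps(2)
    by (intro exI[of _ "replicate (f x) x @ xs"]) (auto simp: rep)
qed

context factorial_facet_monoid
begin

text \<open>The divisor of a generator is its own generic prime plus a combination of facet primes, so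
  that every divisor is linearly equivalent to one supported on the facet primes.\<close>

definition facet_part :: "(('m \<Rightarrow>\<^sub>0 'k) set \<Rightarrow>\<^sub>0 int) \<Rightarrow> 'j \<Rightarrow> int" where
  "facet_part D j = Poly_Mapping.lookup D (facet_prime j) -
     (\<Sum>Q\<in>Poly_Mapping.keys D \<inter> generic_primes. Poly_Mapping.lookup D Q * int (val j (generator Q)))"

text \<open>The sum in \<open>facet_part\<close> ranges over the support of \<open>D\<close>; a
  common finite range is needed to compare different divisors.\<close>

lemma facet_part_superset:
  assumes "finite K" "Poly_Mapping.keys D \<inter> generic_primes \<subseteq> K" "K \<subseteq> generic_primes"
  shows "facet_part D j = Poly_Mapping.lookup D (facet_prime j) -
     (\<Sum>Q\<in>K. Poly_Mapping.lookup D Q * int (val j (generator Q)))"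
  unfolding facet_part_def
  using assms by (intro arg_cong2[of _ _ _ _ "(-)"] sum.mono_neutral_left) (auto simp: in_keys_iff)

lemma facet_part_add: "facet_part (D + E) = (\<lambda>j. facet_part D j + facet_part E j)"
proof
  fix j
  let ?K = "(Poly_Mapping.keys D \<union> Poly_Mapping.keys E) \<inter> generic_primes"
  have "Poly_Mapping.keys (D + E) \<inter> generic_primes \<subseteq> ?K" using keys_add[of D E] by blast
  then have "facet_part (D + E) j = Poly_Mapping.lookup (D + E) (facet_prime j) -
      (\<Sum>Q\<in>?K. Poly_Mapping.lookup (D + E) Q * int (val j (generator Q)))"
    by (intro facet_part_superset) auto
  moreover have "facet_part F j = Poly_Mapping.lookup F (facet_prime j) -
      (\<Sum>Q\<in>?K. Poly_Mapping.lookup F Q * int (val j (generator Q)))" if "F \<in> {D, E}" for F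
    using that by (intro facet_part_superset) auto
  from this[of D] this[of E] calculation show "facet_part (D + E) j = facet_part D j + facet_part E j"
    by (simp add: lookup_add algebra_simps sum.distrib)
qed

text \<open>The contributions of the generators cancel by \<open>val_factors\<close>, so only the
  weights of the monomials survive. The defect \<open>z\<close> lets one computation serve twice:
  with \<open>z = 0\<close> for a divisor known to be principal, and with \<open>z\<close> solved
  for when principality is to be shown.\<close>

lemma facet_part_divisor:
  assumes a: "factors a m n Qs" and b: "factors b m' n' Qs'"
    and D: "\<And>Q. Q \<in> generic_primes \<Longrightarrow> Poly_Mapping.lookup D Q = int (count_list Qs Q) - int (count_list Qs' Q)"
    and Dj: "Poly_Mapping.lookup D (facet_prime j) = int (val j a) - int (val j b) + z"
  shows "facet_part D j = int (\<sigma> j (n + m')) - int (\<sigma> j (m + n')) + z"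
proof -
  have S: "m \<in> S" "n \<in> S" "m' \<in> S" "n' \<in> S" and Q: "set Qs \<subseteq> generic_primes" "set Qs' \<subseteq> generic_primes"
    using a b by (auto simp: factors_def)
  let ?K = "set Qs \<union> set Qs'"
  let ?v = "\<lambda>Q. int (val j (generator Q))"
  have sum: "(\<Sum>Q\<in>?K. int (count_list xs Q) * ?v Q) = int (\<Sum>Q\<leftarrow>xs. val j (generator Q))"
    if "set xs \<subseteq> ?K" for xs
  proof -
    have "(\<Sum>Q\<leftarrow>xs. val j (generator Q)) = (\<Sum>Q\<in>set xs. count_list xs Q * val j (generator Q))"
      by (rule sum_list_map_eq_sum_count)
    also have "\<dots> = (\<Sum>Q\<in>?K. count_list xs Q * val j (generator Q))"
      using that by (intro sum.mono_neutral_left) (auto simp: count_list_0_iff)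
    finally show ?thesis by simp
  qed
  have "Poly_Mapping.keys D \<inter> generic_primes \<subseteq> ?K"
  proof
    fix Q assume Q: "Q \<in> Poly_Mapping.keys D \<inter> generic_primes"
    then have "int (count_list Qs Q) - int (count_list Qs' Q) \<noteq> 0" using D[of Q] by (auto simp: in_keys_iff)
    then show "Q \<in> ?K" by (cases "Q \<in> set Qs"; cases "Q \<in> set Qs'") simp_all
  qed
  then have "facet_part D j = int (val j a) - int (val j b) + z -
      (\<Sum>Q\<in>?K. (int (count_list Qs Q) - int (count_list Qs' Q)) * ?v Q)"
    using facet_part_superset[of ?K D j] Q Dj D by (auto intro!: sum.cong)
  also have "(\<Sum>Q\<in>?K. (int (count_list Qs Q) - int (count_list Qs' Q)) * ?v Q) =
      int (\<Sum>Q\<leftarrow>Qs. val j (generator Q)) - int (\<Sum>Q\<leftarrow>Qs'. val j (generator Q))"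
    using sum[of Qs] sum[of Qs'] by (simp add: left_diff_distrib sum_subtractf)
  finally show ?thesis using val_factors[OF a, of j] val_factors[OF b, of j] S by (simp add: \<sigma>_add)
qed

text \<open>Removing the divisors of the generators reduces the divisor of \<open>a / b\<close> to
  that of a quotient of monomials. Conversely the positive and negative multiplicities of
  \<open>D\<close> at generic primes are realized by products of generators, and \<open>x\<close>
  and \<open>y\<close> then correct the facets.\<close>

lemma principal_divisors_iff:
  assumes D: "Poly_Mapping.keys D \<subseteq> height_one_primes ring_on"
  shows "D \<in> principal_divisors ring_on \<longleftrightarrow>
    (\<exists>x\<in>S. \<exists>y\<in>S. \<forall>j\<in>J. facet_part D j = int (\<sigma> j x) - int (\<sigma> j y))"
proof
  assume "D \<in> principal_divisors ring_on"
  then obtain a b where ab: "a \<in> A" "a \<noteq> 0" "b \<in> A" "b \<noteq> 0"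
    and DP: "\<And>P. P \<in> height_one_primes ring_on \<Longrightarrow>
      Poly_Mapping.lookup D P = int (ord_at ring_on P a) - int (ord_at ring_on P b)"
    unfolding principal_divisors_def by auto
  obtain m n Qs where fa: "factors a m n Qs" using factors_exist ab by blast
  obtain m' n' Qs' where fb: "factors b m' n' Qs'" using factors_exist ab by blast
  have "facet_part D j = int (\<sigma> j (n + m')) - int (\<sigma> j (m + n'))" if j: "j \<in> J" for j
  proof -
    have "facet_part D j = int (\<sigma> j (n + m')) - int (\<sigma> j (m + n')) + 0"
    proof (rule facet_part_divisor[OF fa fb])
      show "Poly_Mapping.lookup D Q = int (count_list Qs Q) - int (count_list Qs' Q)"
        if "Q \<in> generic_primes" for Q
        using DP[of Q] that ord_at_generic[OF that fa] ord_at_generic[OF that fb]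
        by (simp add: height_one_primes_eq)
      show "Poly_Mapping.lookup D (facet_prime j) = int (val j a) - int (val j b) + 0"
        using DP[of "facet_prime j"] j ord_at_facet_prime[OF j] ab by (simp add: height_one_primes_eq)
    qed
    then show ?thesis by simp
  qed
  moreover have "n + m' \<in> S" "m + n' \<in> S" using fa fb by (auto simp: factors_def)
  ultimately show "\<exists>x\<in>S. \<exists>y\<in>S. \<forall>j\<in>J. facet_part D j = int (\<sigma> j x) - int (\<sigma> j y)" by blast
next
  assume "\<exists>x\<in>S. \<exists>y\<in>S. \<forall>j\<in>J. facet_part D j = int (\<sigma> j x) - int (\<sigma> j y)"
  then obtain x y where xy: "x \<in> S" "y \<in> S"
    "\<And>j. j \<in> J \<Longrightarrow> facet_part D j = int (\<sigma> j x) - int (\<sigma> j y)" by blast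
  let ?K = "Poly_Mapping.keys D \<inter> generic_primes"
  have lists: "\<exists>Qs. set Qs \<subseteq> generic_primes \<and> (\<forall>Q\<in>generic_primes. count_list Qs Q = f Q)"
    if f: "\<And>Q. Poly_Mapping.lookup D Q = 0 \<Longrightarrow> f Q = 0" for f
  proof -
    obtain Qs where Qs: "set Qs \<subseteq> ?K" "\<forall>Q\<in>?K. count_list Qs Q = f Q"
      using exists_list_with_counts[of ?K f] by auto
    have "count_list Qs Q = f Q" if Q: "Q \<in> generic_primes" for Q
    proof (cases "Q \<in> Poly_Mapping.keys D")
      case True
      then show ?thesis using Qs(2) Q by blast
    next
      case False
      then have "Q \<notin> set Qs" "f Q = 0" using Qs(1) f by (auto simp: in_keys_iff)
      then show ?thesis by (simp add: count_list_0_iff)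
    qed
    then show ?thesis using Qs(1) by blast
  qed
  obtain Qs where Qs: "set Qs \<subseteq> generic_primes"
    "\<And>Q. Q \<in> generic_primes \<Longrightarrow> count_list Qs Q = nat (Poly_Mapping.lookup D Q)"
    using lists[of "\<lambda>Q. nat (Poly_Mapping.lookup D Q)"] by auto
  obtain Qs' where Qs': "set Qs' \<subseteq> generic_primes"
    "\<And>Q. Q \<in> generic_primes \<Longrightarrow> count_list Qs' Q = nat (- Poly_Mapping.lookup D Q)"
    using lists[of "\<lambda>Q. nat (- Poly_Mapping.lookup D Q)"] by auto
  define a where "a = mon x * prod_list (map generator Qs)"
  define b where "b = mon y * prod_list (map generator Qs')"
  have fa: "factors a 0 x Qs" and fb: "factors b 0 y Qs'"
    using xy Qs Qs' generator_prod_mem[OF Qs(1)] generator_prod_mem[OF Qs'(1)]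
    unfolding factors_def a_def b_def by (auto intro!: exI[of _ 1])
  have ab: "a \<in> A" "a \<noteq> 0" "b \<in> A" "b \<noteq> 0"
    using fa fb factors_nonzero[OF fa] factors_nonzero[OF fb] by (simp_all add: factors_def)
  have "Poly_Mapping.lookup D P = int (ord_at ring_on P a) - int (ord_at ring_on P b)"
    if P: "P \<in> height_one_primes ring_on" for P
  proof -
    consider j where "j \<in> J" "P = facet_prime j" | "P \<in> generic_primes"
      using P unfolding height_one_primes_eq by blast
    then show ?thesis
    proof cases
      case 1
      define z where "z = Poly_Mapping.lookup D (facet_prime j) - (int (val j a) - int (val j b))"
      have "facet_part D j = int (\<sigma> j (x + 0)) - int (\<sigma> j (0 + y)) + z"
        by (rule facet_part_divisor[OF fa fb]) (simp_all add: Qs(2) Qs'(2) z_def)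
      then have "z = 0" using xy(3)[OF 1(1)] by simp
      then show ?thesis using 1 ord_at_facet_prime[OF 1(1)] ab by (simp add: z_def)
    next
      case 2
      then show ?thesis
        using ord_at_generic[OF 2 fa] ord_at_generic[OF 2 fb] Qs(2)[OF 2] Qs'(2)[OF 2] by simp
    qed
  qed
  then show "D \<in> principal_divisors ring_on"
    unfolding principal_divisors_def divisor_group_def using D ab by auto
qed

text \<open>Here \<open>h\<close> presents \<open>H\<close> as the integral weights on the facets
  modulo those of quotients of monomials. It is defined on all functions on \<open>'j\<close>, and
  \<open>h_ker\<close> makes its value depend on the restriction to \<open>J\<close> alone.\<close>

theorem divisor_class_group_iso:
  fixes h :: "('j \<Rightarrow> int) \<Rightarrow> 'h" and H :: "('h, 'i) monoid_scheme"
  assumes H: "group H" and h_closed: "\<And>x. h x \<in> carrier H"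
    and h_add: "\<And>x y. h (\<lambda>j. x j + y j) = h x \<otimes>\<^bsub>H\<^esub> h y"
    and h_surj: "\<And>z. z \<in> carrier H \<Longrightarrow> \<exists>x. z = h x"
    and h_ker: "\<And>x. h x = \<one>\<^bsub>H\<^esub> \<longleftrightarrow> (\<exists>m\<in>S. \<exists>n\<in>S. \<forall>j\<in>J. x j = int (\<sigma> j m) - int (\<sigma> j n))"
  shows "divisor_class_group ring_on \<cong> H"
proof -
  let ?G = "divisor_group ring_on"
  let ?\<phi> = "\<lambda>D. h (facet_part D)"
  have hom: "group_hom ?G H ?\<phi>"
    unfolding divisor_group_def
    by (intro group_hom.intro group_hom_axioms.intro homI)
      (simp_all add: H h_closed h_add[symmetric] facet_part_add)
  have "kernel ?G H ?\<phi> = principal_divisors ring_on"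
  proof -
    have "D \<in> kernel ?G H ?\<phi> \<longleftrightarrow> D \<in> principal_divisors ring_on" for D
    proof (cases "Poly_Mapping.keys D \<subseteq> height_one_primes ring_on")
      case True
      then show ?thesis
        using principal_divisors_iff[OF True] by (simp add: kernel_def divisor_group_def h_ker)
    next
      case False
      then show ?thesis by (simp add: kernel_def divisor_group_def principal_divisors_def)
    qed
    then show ?thesis by blast
  qed
  moreover have "?\<phi> ` carrier ?G = carrier H"
  proof
    show "?\<phi> ` carrier ?G \<subseteq> carrier H" using h_closed by auto
    show "carrier H \<subseteq> ?\<phi> ` carrier ?G"
    proof
      fix z assume "z \<in> carrier H"
      then obtain x where x: "z = h x" using h_surj by blast
      define D where "D = (\<Sum>i\<in>J. Poly_Mapping.single (facet_prime i) (x i))"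
      have lk: "Poly_Mapping.lookup D P = (\<Sum>i\<in>J. x i when facet_prime i = P)" for P
        by (simp add: D_def lookup_sum lookup_single)
      have keys: "Poly_Mapping.keys D \<subseteq> facet_prime ` J"
      proof
        fix P assume "P \<in> Poly_Mapping.keys D"
        then have "(\<Sum>i\<in>J. x i when facet_prime i = P) \<noteq> 0" by (simp add: in_keys_iff lk)
        then obtain i where "i \<in> J" "(x i when facet_prime i = P) \<noteq> 0" by (rule sum.not_neutral_contains_not_neutral)
        then show "P \<in> facet_prime ` J" by auto
      qed
      have D: "D \<in> carrier ?G" using keys by (auto simp: divisor_group_def height_one_primes_eq)
      have fp: "facet_part D j = x j" if j: "j \<in> J" for j
      proof -
        have "Poly_Mapping.keys D \<inter> generic_primes = {}" using keys facet_prime_notin_generic by blast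
        then have "facet_part D j = (\<Sum>i\<in>J. x i when facet_prime i = facet_prime j)"
          by (simp add: facet_part_def lk)
        also have "\<dots> = (\<Sum>i\<in>J. if i = j then x i else 0)"
          using facet_prime_inj j by (intro sum.cong refl) (auto simp: when_def)
        also have "\<dots> = x j" using j finite_J by simp
        finally show ?thesis .
      qed
      \<comment> \<open>\<open>facet_part D\<close> and \<open>x\<close> agree on \<open>J\<close>
        only; their difference has the same values there as the weights of \<open>0 - 0\<close>, so
        it lies in the kernel.\<close>
      have "h (\<lambda>j. facet_part D j - x j) = \<one>\<^bsub>H\<^esub>"
        unfolding h_ker by (rule bexI[of _ 0], rule bexI[of _ 0]) (simp_all add: fp)
      then have "h (\<lambda>j. (facet_part D j - x j) + x j) = h x"
        using h_add[of "\<lambda>j. facet_part D j - x j" x] h_closed[of x] group.is_monoid[OF H]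
        by (simp add: monoid.l_one)
      then have "?\<phi> D = z" using x by simp
      then show "z \<in> ?\<phi> ` carrier ?G" using D by blast
    qed
  qed
  ultimately show ?thesis
    using group_hom.FactGroup_iso[OF hom] by (simp add: divisor_class_group_def)
qed

end

section \<open>Factoriality of monoid algebras\<close>

lemma monoid_algebra_sum_closed:
  fixes f :: "'i \<Rightarrow> 'm \<Rightarrow>\<^sub>0 'k::comm_monoid_add"
  assumes "\<And>i. i \<in> I \<Longrightarrow> f i \<in> monoid_algebra N"
  shows "sum f I \<in> monoid_algebra N"
  using assms
proof (induction I rule: infinite_finite_induct)
  case (insert i I)
  then show ?case using monoid_algebra_add_closed[of "f i" N "sum f I"] by simp
qed (simp_all add: monoid_algebra_def)

lemma mon_mult_mem_monoid_algebra:
  fixes p :: "'m::{comm_monoid_add, cancel_ab_semigroup_add} \<Rightarrow>\<^sub>0 'k::field"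
  shows "mon u * p \<in> monoid_algebra N \<longleftrightarrow> (\<forall>m\<in>Poly_Mapping.keys p. u + m \<in> N)"
  by (auto simp: monoid_algebra_def keys_single_mult)

text \<open>An element supported at the exponent \<open>0\<close> is a constant, so every nonzero
  one is a unit. This is the base of the induction over the variables.\<close>

lemma factorial_in_field:
  "factorial_in (monoid_algebra {0} :: ('m::comm_monoid_add \<Rightarrow>\<^sub>0 'k::field) set)"
  unfolding factorial_in_def
proof (intro ballI impI)
  fix a :: "'m \<Rightarrow>\<^sub>0 'k" assume a: "a \<in> monoid_algebra {0}" "a \<noteq> 0"
  define c where "c = Poly_Mapping.lookup a 0"
  have ac: "a = Poly_Mapping.single 0 c"
    using poly_mapping_eq_sum_single[of "{0}" a] a(1) by (simp add: monoid_algebra_def c_def)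
  then have "1 = a * Poly_Mapping.single 0 (inverse c)" using a(2) by (simp add: mult_single)
  then have "dvd_in (monoid_algebra {0}) a 1"
    unfolding dvd_in_def by (intro bexI[of _ "Poly_Mapping.single 0 (inverse c)"]) simp_all
  then show "\<exists>u ps. u \<in> monoid_algebra {0} \<and> dvd_in (monoid_algebra {0}) u 1 \<and>
      (\<forall>p\<in>set ps. prime_in (monoid_algebra {0}) p) \<and> a = u * prod_list ps"
    using a(1) by (intro exI[of _ a] exI[of _ "[]"]) simp
qed

text \<open>Adjoining a free generator \<open>e\<close> to the monoid adjoins the variable
  \<open>mon e\<close> to the algebra; the uniqueness of the decomposition is its
  transcendence.\<close>

lemma factorial_monoid_algebra_adjoin:
  fixes N :: "'m::{ordered_cancel_comm_monoid_add, linorder} set" and e :: 'm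
  assumes N: "add_submonoid N"
    and fac: "factorial_in (monoid_algebra N :: ('m \<Rightarrow>\<^sub>0 'k::field) set)"
    and unique: "\<And>m m' i i'. m \<in> N \<Longrightarrow> m' \<in> N \<Longrightarrow> m + (\<Sum>l<i::nat. e) = m' + (\<Sum>l<i'::nat. e) \<Longrightarrow> m = m' \<and> i = i'"
  shows "factorial_in (monoid_algebra {m + (\<Sum>l<i::nat. e) | m i. m \<in> N} :: ('m \<Rightarrow>\<^sub>0 'k) set)"
proof -
  let ?A = "monoid_algebra N :: ('m \<Rightarrow>\<^sub>0 'k) set"
  let ?N' = "{m + (\<Sum>l<i::nat. e) | m i. m \<in> N}"
  let ?y = "mon e :: 'm \<Rightarrow>\<^sub>0 'k"
  interpret N: add_submonoid N by fact
  interpret factorial_idom_subring ?A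
    by (intro factorial_idom_subring.intro factorial_idom_subring_axioms.intro
        idom_subring_monoid_algebra N fac)
  have eval: "poly f ?y = (\<Sum>i\<le>degree f. mon (\<Sum>l<i. e) * coeff f i)" for f
    by (simp add: poly_altdef mon_sum_const mult.commute del: sum_constant)
  have "(\<lambda>f. poly f ?y) ` poly_over ?A = monoid_algebra ?N'"
  proof
    show "(\<lambda>f. poly f ?y) ` poly_over ?A \<subseteq> monoid_algebra ?N'"
    proof (clarify, unfold eval, rule monoid_algebra_sum_closed)
      fix f :: "('m \<Rightarrow>\<^sub>0 'k) poly" and i
      assume "f \<in> poly_over ?A"
      then have "Poly_Mapping.keys (coeff f i) \<subseteq> N" by (simp add: poly_over_def monoid_algebra_def)
      then show "mon (\<Sum>l<i. e) * coeff f i \<in> monoid_algebra ?N'"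
        unfolding mon_mult_mem_monoid_algebra by (auto simp: add.commute simp del: sum_constant)
    qed
    show "monoid_algebra ?N' \<subseteq> (\<lambda>f. poly f ?y) ` poly_over ?A"
    proof
      fix p :: "'m \<Rightarrow>\<^sub>0 'k" assume p: "p \<in> monoid_algebra ?N'"
      have "\<exists>m i. k = m + (\<Sum>l<i::nat. e) \<and> m \<in> N" if "k \<in> Poly_Mapping.keys p" for k
        using p that by (auto simp: monoid_algebra_def simp del: sum_constant)
      then obtain g i where gi: "\<And>k. k \<in> Poly_Mapping.keys p \<Longrightarrow> k = g k + (\<Sum>l<i k::nat. e) \<and> g k \<in> N"
        by metis
      define f where "f = (\<Sum>k\<in>Poly_Mapping.keys p. monom (Poly_Mapping.single (g k) (Poly_Mapping.lookup p k)) (i k))"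
      have "f \<in> poly_over ?A"
        unfolding f_def using gi by (intro PA.sum_mem) (auto simp: poly_over_def)
      moreover have "poly f ?y = (\<Sum>k\<in>Poly_Mapping.keys p. Poly_Mapping.single k (Poly_Mapping.lookup p k))"
        unfolding f_def poly_sum poly_monom
      proof (intro sum.cong refl)
        fix k assume k: "k \<in> Poly_Mapping.keys p"
        have "Poly_Mapping.single (g k) (Poly_Mapping.lookup p k) * ?y ^ i k
            = Poly_Mapping.single (g k + (\<Sum>l<i k. e)) (Poly_Mapping.lookup p k)"
          unfolding mon_sum_const[symmetric] by (simp add: mult_single)
        then show "Poly_Mapping.single (g k) (Poly_Mapping.lookup p k) * ?y ^ i k
            = Poly_Mapping.single k (Poly_Mapping.lookup p k)" using gi[OF k] by metis
      qed
      ultimately show "p \<in> (\<lambda>f. poly f ?y) ` poly_over ?A"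
        using poly_mapping_eq_sum_single[of "Poly_Mapping.keys p" p] by auto
    qed
  qed
  moreover have "f = 0" if f: "f \<in> poly_over ?A" and z: "poly f ?y = 0" for f
  proof (rule poly_eqI, rule poly_mapping_eqI)
    fix i m
    have fN: "Poly_Mapping.keys (coeff f l) \<subseteq> N" for l using f by (simp add: poly_over_def monoid_algebra_def)
    show "Poly_Mapping.lookup (coeff f i) m = Poly_Mapping.lookup (coeff 0 i) m"
    proof (cases "m \<in> N \<and> i \<le> degree f")
      case True
      have "0 = Poly_Mapping.lookup (poly f ?y) ((\<Sum>l<i. e) + m)" unfolding z by simp
      also have "\<dots> = (\<Sum>k\<le>degree f. Poly_Mapping.lookup (mon (\<Sum>l<k. e) * coeff f k) ((\<Sum>l<i. e) + m))"
        unfolding eval lookup_sum ..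
      \<comment> \<open>By uniqueness of the decomposition only the term of degree \<open>i\<close>
        contributes to this exponent.\<close>
      also have "\<dots> = (\<Sum>k\<le>degree f. if k = i then Poly_Mapping.lookup (coeff f i) m else 0)"
      proof (intro sum.cong refl)
        fix k
        show "Poly_Mapping.lookup (mon (\<Sum>l<k. e) * coeff f k) ((\<Sum>l<i. e) + m) =
            (if k = i then Poly_Mapping.lookup (coeff f i) m else 0)"
        proof (cases "k = i")
          case True
          then show ?thesis by (simp add: lookup_single_mult del: sum_constant)
        next
          case False
          have "(\<Sum>l<i. e) + m \<notin> Poly_Mapping.keys (mon (\<Sum>l<k. e) * coeff f k)"
          proof
            assume "(\<Sum>l<i. e) + m \<in> Poly_Mapping.keys (mon (\<Sum>l<k. e) * coeff f k)"
            then obtain m' where "m' \<in> N" "(\<Sum>l<i. e) + m = (\<Sum>l<k. e) + m'"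
              using keys_single_mult[of 1 "\<Sum>l<k. e" "coeff f k"] fN[of k] by auto
            then show False using unique[of m m' i k] True False by (simp add: add.commute del: sum_constant)
          qed
          then show ?thesis using False by (simp add: in_keys_iff del: sum_constant)
        qed
      qed
      also have "\<dots> = Poly_Mapping.lookup (coeff f i) m" using True by simp
      finally show ?thesis by simp
    next
      case False
      then show ?thesis using fN[of i] by (auto simp: coeff_eq_0 in_keys_iff)
    qed
  qed
  ultimately show ?thesis using factorial_in_adjoin[of ?y] by simp
qed

text \<open>The sum of the individual multipliers works for all exponents at once: at the exponent
  \<open>m\<close> the summand \<open>f m\<close> does the work and the others stay in
  \<open>N\<close>.\<close>

lemma mon_mult_into:
  fixes p :: "'m::{comm_monoid_add, cancel_ab_semigroup_add} \<Rightarrow>\<^sub>0 'k::field"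
  assumes N: "add_submonoid N" and ex: "\<And>m. m \<in> Poly_Mapping.keys p \<Longrightarrow> \<exists>x\<in>N. x + m \<in> N"
  obtains x where "x \<in> N" "mon x * p \<in> monoid_algebra N"
proof -
  interpret add_submonoid N by fact
  obtain f where f: "\<And>m. m \<in> Poly_Mapping.keys p \<Longrightarrow> f m \<in> N \<and> f m + m \<in> N" using ex by metis
  have "sum f (Poly_Mapping.keys p) + m \<in> N" if m: "m \<in> Poly_Mapping.keys p" for m
  proof -
    have "sum f (Poly_Mapping.keys p) + m = sum f (Poly_Mapping.keys p - {m}) + (f m + m)"
      using m by (simp add: sum.remove[of _ m f] ac_simps)
    then show ?thesis using f m sum_S[of "Poly_Mapping.keys p - {m}" f] by auto
  qed
  moreover have "sum f (Poly_Mapping.keys p) \<in> N" using f by (intro sum_S) auto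
  ultimately show thesis using that by (auto simp: mon_mult_mem_monoid_algebra)
qed

text \<open>Both \<open>S\<close> and \<open>N\<close> generate the same group as \<open>E\<close>, so that their monoid algebras become
  equal after inverting the monomials.\<close>

locale commensurable_monoids = S: add_submonoid S + N: add_submonoid N + E: add_submonoid E
  for S N E :: "'m::{ordered_cancel_comm_monoid_add, linorder} set" +
  fixes U :: "('m \<Rightarrow>\<^sub>0 'k::field) set"
  assumes U_eq: "U = monoid_algebra N"
    and S_subset: "S \<subseteq> E" and N_subset: "N \<subseteq> E"
    and into_N: "z \<in> E \<Longrightarrow> \<exists>x\<in>N. x + z \<in> N"
    and into_S: "z \<in> E \<Longrightarrow> \<exists>x\<in>S. x + z \<in> S"
    and factorial_U: "factorial_in U"
begin

sublocale idom_subring U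
  unfolding U_eq by (rule idom_subring_monoid_algebra) (rule N.add_submonoid_axioms)

lemma mon_mem_U: "m \<in> N \<Longrightarrow> Poly_Mapping.single m c \<in> U"
  by (simp add: U_eq)

lemma poly_into_N:
  fixes p :: "'m \<Rightarrow>\<^sub>0 'k"
  assumes "p \<in> monoid_algebra E"
  obtains x where "x \<in> N" "mon x * p \<in> U"
  unfolding U_eq
  by (rule mon_mult_into[OF N.add_submonoid_axioms, of p]) (use assms into_N in \<open>auto simp: monoid_algebra_def\<close>)

lemma poly_into_S:
  fixes p :: "'m \<Rightarrow>\<^sub>0 'k"
  assumes "p \<in> monoid_algebra E"
  obtains x where "x \<in> S" "mon x * p \<in> monoid_algebra S"
  by (rule mon_mult_into[OF S.add_submonoid_axioms, of p]) (use assms into_S in \<open>auto simp: monoid_algebra_def\<close>)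

lemma S_into_E: "p \<in> monoid_algebra S \<Longrightarrow> p \<in> monoid_algebra E"
  and U_into_E: "q \<in> U \<Longrightarrow> q \<in> monoid_algebra E"
  using S_subset N_subset by (auto simp: monoid_algebra_def U_eq)

lemma dvd_mon_imp_single:
  fixes p d :: "'m \<Rightarrow>\<^sub>0 'k"
  assumes "p * d = mon m"
  shows "\<exists>a c. c \<noteq> 0 \<and> p = Poly_Mapping.single a c"
  by (rule factor_of_single[OF assms]) auto

text \<open>Divisibility is carried from \<open>S\<close> to \<open>N\<close> and back by monomial
  factors. They are harmless because \<open>p\<close>, not being a single term, divides no
  monomial.\<close>

lemma loc_prime_shift:
  assumes p: "prime_in U p" and nonmon: "\<And>a c. c \<noteq> 0 \<Longrightarrow> p \<noteq> Poly_Mapping.single a c"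
    and u: "u \<in> S" "mon u * p \<in> monoid_algebra S"
  shows "loc_prime S (mon u * p)"
proof -
  have pU: "p \<in> U" "p \<noteq> 0" using p by (auto simp: prime_in_def)
  have "\<not> loc_dvd S (mon u * p) 1"
  proof
    assume "loc_dvd S (mon u * p) 1"
    then obtain m c where "mon m * 1 = mon u * p * c" by (auto simp: loc_dvd_def)
    then have "p * (mon u * c) = mon m" by (simp add: ac_simps)
    then show False using dvd_mon_imp_single nonmon by blast
  qed
  moreover have descend: "loc_dvd S (mon u * p) a"
    if d: "dvd_in U p (mon x * a)" and x: "x \<in> N" for a x
  proof -
    obtain d where d: "d \<in> U" "mon x * a = p * d" using d by (auto simp: dvd_in_def)
    obtain v where v: "v \<in> S" "mon v * d \<in> monoid_algebra S" using poly_into_S[OF U_into_E[OF d(1)]] .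
    obtain w where w: "w \<in> S" "w + x \<in> S" using into_S x N_subset by blast
    have "mon (u + (v + (w + x))) * a = mon u * (mon v * (mon w * (mon x * a)))"
      by (simp add: mon_add mult.assoc)
    also have "\<dots> = (mon u * p) * (mon w * (mon v * d))" unfolding d(2) by (simp add: ac_simps)
    finally show ?thesis
      unfolding loc_dvd_def using u(1) v w S.monoid_algebra_mult_closed[of "mon w" "mon v * d"]
      by (intro bexI[of _ "u + (v + (w + x))"] bexI[of _ "mon w * (mon v * d)"]) auto
  qed
  moreover have "loc_dvd S (mon u * p) a \<or> loc_dvd S (mon u * p) b"
    if ab: "a \<in> monoid_algebra S" "b \<in> monoid_algebra S" and d: "loc_dvd S (mon u * p) (a * b)" for a b
  proof -
    obtain m c where mc: "m \<in> S" "c \<in> monoid_algebra S" "mon m * (a * b) = mon u * p * c"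
      using d by (auto simp: loc_dvd_def)
    \<comment> \<open>\<open>x1\<close> and \<open>x2\<close> bring \<open>a\<close> and
      \<open>b\<close> into \<open>U\<close>, \<open>x3\<close> brings the exponent \<open>m\<close>
      into \<open>N\<close>, and \<open>x4\<close> brings the cofactor into \<open>U\<close>;
      together they turn the given relation into one inside \<open>U\<close>.\<close>
    obtain x1 where x1: "x1 \<in> N" "mon x1 * a \<in> U" using poly_into_N[OF S_into_E[OF ab(1)]] .
    obtain x2 where x2: "x2 \<in> N" "mon x2 * b \<in> U" using poly_into_N[OF S_into_E[OF ab(2)]] .
    obtain x3 where x3: "x3 \<in> N" "x3 + m \<in> N" using into_N mc(1) S_subset by blast
    have "mon u * c \<in> monoid_algebra S" using S.monoid_algebra_mult_closed[of "mon u" c] u mc by simp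
    then obtain x4 where x4: "x4 \<in> N" "mon x4 * (mon u * c) \<in> U" using poly_into_N[OF S_into_E] by blast
    let ?k = "x4 + (x3 + m)"
    have k: "?k \<in> N" using x3 x4 by blast
    have "mon ?k * ((mon x1 * a) * (mon x2 * b)) = mon x1 * (mon x2 * (mon x3 * (mon x4 * (mon m * (a * b)))))"
      by (simp add: mon_add ac_simps)
    also have "\<dots> = p * (mon (x1 + (x2 + x3)) * (mon x4 * (mon u * c)))"
      unfolding mc(3) by (simp add: mon_add ac_simps)
    finally have "dvd_in U p (mon ?k * ((mon x1 * a) * (mon x2 * b)))"
      unfolding dvd_in_def using mult_mem[OF mon_mem_U x4(2), of "x1 + (x2 + x3)" 1] x1(1) x2(1) x3(1)
      by (intro bexI) auto
    then have "dvd_in U p (mon ?k) \<or> dvd_in U p (mon x1 * a) \<or> dvd_in U p (mon x2 * b)"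
      using p mon_mem_U[OF k, of 1] mult_mem[OF x1(2) x2(2)] x1(2) x2(2) unfolding prime_in_def by blast
    moreover have "\<not> dvd_in U p (mon ?k)"
    proof
      assume "dvd_in U p (mon ?k)"
      then obtain d where "p * d = mon ?k" unfolding dvd_in_def by metis
      then show False using dvd_mon_imp_single nonmon by blast
    qed
    ultimately show ?thesis using descend x1(1) x2(1) by blast
  qed
  ultimately show ?thesis using u(2) pU(2) by (simp add: loc_prime_def)
qed

text \<open>A prime of \<open>U\<close> that is a single term becomes a unit once monomials are
  inverted and is absorbed into the leading term. The exponent \<open>k\<close> is controlled only
  in \<open>E\<close>, since an exponent from \<open>N\<close> need not lie in
  \<open>S\<close>.\<close>

lemma loc_prime_factors:
  assumes "\<forall>p\<in>set ps. prime_in U p"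
  shows "\<exists>u\<in>S. \<exists>k\<in>E. \<exists>c qs. c \<noteq> 0 \<and> (\<forall>q\<in>set qs. loc_prime S q) \<and>
    mon u * prod_list ps = Poly_Mapping.single k c * prod_list qs"
  using assms
proof (induction ps)
  case Nil
  show ?case by (rule bexI[of _ 0], rule bexI[of _ 0], rule exI[of _ 1], rule exI[of _ "[]"]) auto
next
  case (Cons p ps)
  obtain u k c qs where IH: "u \<in> S" "k \<in> E" "c \<noteq> 0" "\<forall>q\<in>set qs. loc_prime S q"
    "mon u * prod_list ps = Poly_Mapping.single k c * prod_list qs" using Cons.IH Cons.prems by auto
  have p: "prime_in U p" and pU: "p \<in> U" using Cons.prems by (auto simp: prime_in_def)
  show ?case
  proof (cases "\<exists>a d. d \<noteq> 0 \<and> p = Poly_Mapping.single a d")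
    case True
    then obtain a d where ad: "d \<noteq> 0" "p = Poly_Mapping.single a d" by blast
    then have "a \<in> E" using pU N_subset by (auto simp: U_eq monoid_algebra_def)
    have "mon u * prod_list (p # ps) = p * (mon u * prod_list ps)" by (simp add: ac_simps)
    also have "\<dots> = Poly_Mapping.single (a + k) (d * c) * prod_list qs"
      unfolding IH(5) ad(2) by (simp add: mult.assoc[symmetric] mult_single)
    finally show ?thesis using IH(1-4) ad(1) \<open>a \<in> E\<close>
      by (intro bexI[of _ u] bexI[of _ "a + k"] exI[of _ "d * c"] exI[of _ qs]) auto
  next
    case False
    obtain v where v: "v \<in> S" "mon v * p \<in> monoid_algebra S" using poly_into_S[OF U_into_E[OF pU]] .
    have lp: "loc_prime S (mon v * p)" using loc_prime_shift[OF p _ v] False by blast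
    have "mon (v + u) * prod_list (p # ps) = (mon v * p) * (mon u * prod_list ps)"
      by (simp add: mon_add ac_simps)
    also have "\<dots> = Poly_Mapping.single k c * prod_list ((mon v * p) # qs)"
      unfolding IH(5) by (simp add: ac_simps)
    finally show ?thesis using IH(1-4) v(1) lp
      by (intro bexI[of _ "v + u"] bexI[of _ k] exI[of _ c] exI[of _ "(mon v * p) # qs"]) auto
  qed
qed

theorem loc_factorial_monoid_algebra: "loc_factorial S (monoid_algebra S :: ('m \<Rightarrow>\<^sub>0 'k) set)"
  unfolding loc_factorial_def
proof (intro ballI impI)
  fix a :: "'m \<Rightarrow>\<^sub>0 'k" assume a: "a \<in> monoid_algebra S" "a \<noteq> 0"
  obtain x where x: "x \<in> N" "mon x * a \<in> U" using poly_into_N[OF S_into_E[OF a(1)]] .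
  then obtain w ps where w: "w \<in> U" "dvd_in U w 1" "\<forall>p\<in>set ps. prime_in U p" "mon x * a = w * prod_list ps"
    using factorial_U a(2) unfolding factorial_in_def by (metis mult_eq_0_iff single_neq_0 zero_neq_one)
  \<comment> \<open>The unit \<open>w\<close> of \<open>U\<close> divides the monomial
    \<open>1\<close>, so it is a single term.\<close>
  obtain d where "w * d = mon 0" using w(2) by (auto simp: dvd_in_def)
  then obtain l e where le: "e \<noteq> 0" "w = Poly_Mapping.single l e" using dvd_mon_imp_single by blast
  then have l: "l \<in> E" using w(1) N_subset by (auto simp: U_eq monoid_algebra_def)
  obtain u k c qs where q: "u \<in> S" "k \<in> E" "c \<noteq> 0" "\<forall>q\<in>set qs. loc_prime S q"
    "mon u * prod_list ps = Poly_Mapping.single k c * prod_list qs" using loc_prime_factors[OF w(3)] by blast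
  have "u + x \<in> E" "l + k \<in> E" using q x l S_subset N_subset by auto
  \<comment> \<open>\<open>v1\<close> and \<open>v2\<close> bring the accumulated exponents of the
    two sides into \<open>S\<close>; afterwards each side is multiplied by both.\<close>
  then obtain v1 v2 where v: "v1 \<in> S" "v1 + (u + x) \<in> S" "v2 \<in> S" "v2 + (l + k) \<in> S"
    using into_S by metis
  have "mon (v2 + (v1 + (u + x))) * a = mon v2 * (mon v1 * (mon u * (mon x * a)))"
    by (simp add: mon_add mult.assoc)
  also have "\<dots> = mon v2 * (mon v1 * (w * (mon u * prod_list ps)))" unfolding w(4) by (simp add: ac_simps)
  also have "\<dots> = (mon v2 * (mon v1 * (Poly_Mapping.single l e * Poly_Mapping.single k c))) * prod_list qs"
    unfolding q(5) le(2) by (simp only: mult.assoc)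
  also have "mon v2 * (mon v1 * (Poly_Mapping.single l e * Poly_Mapping.single k c)) =
      Poly_Mapping.single (v1 + (v2 + (l + k))) (e * c)"
    by (simp add: mult_single add.left_commute)
  finally show "\<exists>m\<in>S. \<exists>n\<in>S. \<exists>c ps. c \<noteq> 0 \<and> (\<forall>p\<in>set ps. loc_prime S p) \<and>
      mon m * a = Poly_Mapping.single n c * prod_list ps"
    using q(3,4) le(1) v
    by (intro bexI[of _ "v2 + (v1 + (u + x))"] bexI[of _ "v1 + (v2 + (l + k))"] exI[of _ "e * c"] exI[of _ qs]) auto
qed

end

section \<open>Free monoids of even vectors\<close>

lemma keys_subset_iff: "Poly_Mapping.keys m \<subseteq> K \<longleftrightarrow> (\<forall>v. v \<notin> K \<longrightarrow> Poly_Mapping.lookup m v = 0)"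
  by (auto simp: in_keys_iff)

text \<open>The vectors \<open>x\<^sub>w + x\<^sub>z\<close> (\<open>w \<in> W\<close>) and \<open>2 x\<^sub>z\<close> form a basis of the lattice of even vectors
  supported in \<open>insert z W\<close>; the first ones generate \<open>star_monoid z W\<close>, all of them
  \<open>even_star_monoid z W\<close>.\<close>

definition star_monoid :: "'v \<Rightarrow> 'v set \<Rightarrow> ('v \<Rightarrow>\<^sub>0 nat) set" where
  "star_monoid z W = {m. Poly_Mapping.keys m \<subseteq> insert z W \<and>
     Poly_Mapping.lookup m z = (\<Sum>w\<in>W. Poly_Mapping.lookup m w)}"

definition even_star_monoid :: "'v \<Rightarrow> 'v set \<Rightarrow> ('v \<Rightarrow>\<^sub>0 nat) set" where
  "even_star_monoid z W = {m. Poly_Mapping.keys m \<subseteq> insert z W \<and>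
     (\<exists>k. Poly_Mapping.lookup m z = (\<Sum>w\<in>W. Poly_Mapping.lookup m w) + 2 * k)}"

lemma add_submonoid_star: "add_submonoid (star_monoid z W)"
proof
  fix m n :: "'a \<Rightarrow>\<^sub>0 nat" assume "m \<in> star_monoid z W" "n \<in> star_monoid z W"
  then show "m + n \<in> star_monoid z W"
    using keys_add[of m n] by (auto simp: star_monoid_def lookup_add sum.distrib)
qed (simp add: star_monoid_def)

lemma add_submonoid_even_star: "add_submonoid (even_star_monoid z W)"
proof
  fix m n :: "'a \<Rightarrow>\<^sub>0 nat" assume "m \<in> even_star_monoid z W" "n \<in> even_star_monoid z W"
  then obtain k l where "Poly_Mapping.lookup m z = (\<Sum>w\<in>W. Poly_Mapping.lookup m w) + 2 * k"
    "Poly_Mapping.lookup n z = (\<Sum>w\<in>W. Poly_Mapping.lookup n w) + 2 * l"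
    "Poly_Mapping.keys m \<subseteq> insert z W" "Poly_Mapping.keys n \<subseteq> insert z W"
    by (auto simp: even_star_monoid_def)
  then show "m + n \<in> even_star_monoid z W"
    using keys_add[of m n]
    by (auto simp: even_star_monoid_def lookup_add sum.distrib intro!: exI[of _ "k + l"])
qed (simp add: even_star_monoid_def)

lemma lookup_sum_const: "Poly_Mapping.lookup (\<Sum>l<i::nat. e) v = i * Poly_Mapping.lookup e v"
  for e :: "'v \<Rightarrow>\<^sub>0 nat"
  by (simp add: lookup_sum del: sum_constant) simp

text \<open>The new vertex \<open>w\<close> occurs in the new basis vector only, so the multiplicity
  of that vector is the coordinate at \<open>w\<close>.\<close>

lemma star_monoid_insert:
  assumes "finite W" "w \<notin> W" "z \<notin> insert w W"
  shows "star_monoid z (insert w W) =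
    {m + (\<Sum>l<i::nat. Poly_Mapping.single w 1 + Poly_Mapping.single z 1) | m i. m \<in> star_monoid z W}" (is "_ = ?R")
proof
  define e where "e = Poly_Mapping.single w 1 + Poly_Mapping.single z (1::nat)"
  have e: "Poly_Mapping.lookup e v = (if v = w \<or> v = z then 1 else 0)" for v
    using assms by (auto simp: e_def lookup_add lookup_single when_def)
  show "?R \<subseteq> star_monoid z (insert w W)"
  proof (unfold e_def[symmetric], clarify)
    fix m i assume m: "m \<in> star_monoid z W"
    have lk: "Poly_Mapping.lookup (m + (\<Sum>l<i::nat. e)) v = Poly_Mapping.lookup m v + (if v = w \<or> v = z then i else 0)" for v
      using assms by (auto simp: lookup_add lookup_sum_const e simp del: sum_constant)
    have mw: "Poly_Mapping.lookup m w = 0" using m assms by (auto simp: star_monoid_def keys_subset_iff)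
    have "Poly_Mapping.keys (m + (\<Sum>l<i::nat. e)) \<subseteq> insert z (insert w W)"
      using m by (auto simp: star_monoid_def keys_subset_iff lk split: if_splits)
    moreover have "(\<Sum>v\<in>W. Poly_Mapping.lookup (m + (\<Sum>l<i::nat. e)) v) = (\<Sum>v\<in>W. Poly_Mapping.lookup m v)"
      by (intro sum.cong refl) (use assms in \<open>auto simp: lk simp del: sum_constant\<close>)
    ultimately show "m + (\<Sum>l<i::nat. e) \<in> star_monoid z (insert w W)"
      using m assms mw by (auto simp: star_monoid_def lk simp del: sum_constant)
  qed
  show "star_monoid z (insert w W) \<subseteq> ?R"
  proof (unfold e_def[symmetric], rule subsetI)
    fix m assume m: "m \<in> star_monoid z (insert w W)"
    define i where "i = Poly_Mapping.lookup m w"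
    define m' where "m' = m - (\<Sum>l<i::nat. e)"
    have lk: "Poly_Mapping.lookup m' v = Poly_Mapping.lookup m v - (if v = w \<or> v = z then i else 0)" for v
      using assms by (auto simp: m'_def lookup_minus lookup_add lookup_sum_const e simp del: sum_constant)
    \<comment> \<open>The coordinate at \<open>z\<close> is at least \<open>i\<close>, so the
      natural subtraction in \<open>m'\<close> is exact.\<close>
    have mz: "Poly_Mapping.lookup m z = i + (\<Sum>v\<in>W. Poly_Mapping.lookup m v)"
      using m assms by (simp add: star_monoid_def i_def)
    have "m = m' + (\<Sum>l<i::nat. e)"
    proof (rule poly_mapping_eqI)
      fix v
      show "Poly_Mapping.lookup m v = Poly_Mapping.lookup (m' + (\<Sum>l<i::nat. e)) v"
        using assms mz by (auto simp: lk i_def[symmetric] lookup_add lookup_sum_const e simp del: sum_constant)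
    qed
    moreover have "(\<Sum>v\<in>W. Poly_Mapping.lookup m' v) = (\<Sum>v\<in>W. Poly_Mapping.lookup m v)"
      by (intro sum.cong refl) (use assms in \<open>auto simp: lk simp del: sum_constant\<close>)
    then have "m' \<in> star_monoid z W"
      using m mz by (auto simp: star_monoid_def keys_subset_iff lk i_def split: if_splits)
    ultimately show "m \<in> {m + (\<Sum>l<i::nat. e) | m i. m \<in> star_monoid z W}" by blast
  qed
qed

text \<open>The multiplicity of \<open>2 x\<^sub>z\<close> is half the excess of the coordinate at
  \<open>z\<close> over the sum of the others.\<close>

lemma even_star_monoid_eq:
  assumes "finite W" "z \<notin> W"
  shows "even_star_monoid z W = {m + (\<Sum>l<i::nat. Poly_Mapping.single z 2) | m i. m \<in> star_monoid z W}" (is "_ = ?R")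
proof
  define e where "e = Poly_Mapping.single z (2::nat)"
  have e: "Poly_Mapping.lookup e v = (if v = z then 2 else 0)" for v
    by (auto simp: e_def lookup_single when_def)
  have lk: "Poly_Mapping.lookup (m + (\<Sum>l<i::nat. e)) v = Poly_Mapping.lookup m v + (if v = z then 2 * i else 0)" for v m i
    by (auto simp: lookup_add lookup_sum_const e simp del: sum_constant)
  show "?R \<subseteq> even_star_monoid z W"
  proof (unfold e_def[symmetric], clarify)
    fix m i assume m: "m \<in> star_monoid z W"
    have "(\<Sum>v\<in>W. Poly_Mapping.lookup (m + (\<Sum>l<i::nat. e)) v) = (\<Sum>v\<in>W. Poly_Mapping.lookup m v)"
      by (intro sum.cong refl) (use assms in \<open>auto simp: lk simp del: sum_constant\<close>)
    then show "m + (\<Sum>l<i::nat. e) \<in> even_star_monoid z W"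
      using m by (auto simp: even_star_monoid_def star_monoid_def lk keys_subset_iff simp del: sum_constant split: if_splits)
  qed
  show "even_star_monoid z W \<subseteq> ?R"
  proof (unfold e_def[symmetric], rule subsetI)
    fix m assume "m \<in> even_star_monoid z W"
    then obtain i where m: "Poly_Mapping.keys m \<subseteq> insert z W"
      "Poly_Mapping.lookup m z = (\<Sum>w\<in>W. Poly_Mapping.lookup m w) + 2 * i" by (auto simp: even_star_monoid_def)
    define m' where "m' = Poly_Mapping.update z (\<Sum>w\<in>W. Poly_Mapping.lookup m w) m"
    have lk': "Poly_Mapping.lookup m' v = (if v = z then \<Sum>w\<in>W. Poly_Mapping.lookup m w else Poly_Mapping.lookup m v)" for v
      by (auto simp: m'_def lookup_update)
    have "m = m' + (\<Sum>l<i::nat. e)"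
      by (rule poly_mapping_eqI) (auto simp: lk lk' m(2) simp del: sum_constant)
    moreover have "(\<Sum>v\<in>W. Poly_Mapping.lookup m' v) = (\<Sum>v\<in>W. Poly_Mapping.lookup m v)"
      by (intro sum.cong refl) (use assms in \<open>auto simp: lk'\<close>)
    then have "m' \<in> star_monoid z W"
      using m by (auto simp: star_monoid_def keys_subset_iff lk' split: if_splits)
    ultimately show "m \<in> {m + (\<Sum>l<i::nat. e) | m i. m \<in> star_monoid z W}" by blast
  qed
qed

lemma factorial_star_monoid:
  fixes W :: "'v::linorder set"
  assumes "finite W" "z \<notin> W"
  shows "factorial_in (monoid_algebra (star_monoid z W) :: (('v \<Rightarrow>\<^sub>0 nat) \<Rightarrow>\<^sub>0 'k::field) set)"
  using assms
proof (induction W)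
  case empty
  have "star_monoid z {} = {0}"
  proof
    show "star_monoid z {} \<subseteq> {0}"
    proof
      fix m assume "m \<in> star_monoid z {}"
      then have "Poly_Mapping.lookup m v = 0" for v
        by (cases "v = z") (auto simp: star_monoid_def in_keys_iff)
      then show "m \<in> {0}" by (simp add: poly_mapping_eqI)
    qed
  qed (simp add: star_monoid_def)
  then show ?case using factorial_in_field by simp
next
  case (insert w W)
  let ?e = "Poly_Mapping.single w 1 + Poly_Mapping.single z (1::nat)"
  have "factorial_in (monoid_algebra {m + (\<Sum>l<i::nat. ?e) | m i. m \<in> star_monoid z W} :: (('v \<Rightarrow>\<^sub>0 nat) \<Rightarrow>\<^sub>0 'k) set)"
  proof (rule factorial_monoid_algebra_adjoin[OF add_submonoid_star])
    show "factorial_in (monoid_algebra (star_monoid z W) :: (('v \<Rightarrow>\<^sub>0 nat) \<Rightarrow>\<^sub>0 'k::field) set)"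
      using insert by simp
    fix m m' i i'
    assume m: "m \<in> star_monoid z W" "m' \<in> star_monoid z W" and eq: "m + (\<Sum>l<i::nat. ?e) = m' + (\<Sum>l<i'::nat. ?e)"
    have "Poly_Mapping.lookup m w = 0" "Poly_Mapping.lookup m' w = 0"
      using m insert by (auto simp: star_monoid_def in_keys_iff)
    moreover have "Poly_Mapping.lookup (m + (\<Sum>l<i::nat. ?e)) w = Poly_Mapping.lookup (m' + (\<Sum>l<i'::nat. ?e)) w"
      using eq by simp
    ultimately have "i = i'"
      using insert.prems by (auto simp: lookup_add lookup_sum_const lookup_single when_def simp del: sum_constant)
    then show "m = m' \<and> i = i'" using eq by simp
  qed
  then show ?case using star_monoid_insert[OF insert.hyps insert.prems] by simp
qed

lemma factorial_even_star_monoid: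
  fixes W :: "'v::linorder set"
  assumes "finite W" "z \<notin> W"
  shows "factorial_in (monoid_algebra (even_star_monoid z W) :: (('v \<Rightarrow>\<^sub>0 nat) \<Rightarrow>\<^sub>0 'k::field) set)"
proof -
  let ?e = "Poly_Mapping.single z (2::nat)"
  have "factorial_in (monoid_algebra {m + (\<Sum>l<i::nat. ?e) | m i. m \<in> star_monoid z W} :: (('v \<Rightarrow>\<^sub>0 nat) \<Rightarrow>\<^sub>0 'k) set)"
  proof (rule factorial_monoid_algebra_adjoin[OF add_submonoid_star factorial_star_monoid[OF assms]])
    fix m m' i i'
    assume m: "m \<in> star_monoid z W" "m' \<in> star_monoid z W" and eq: "m + (\<Sum>l<i::nat. ?e) = m' + (\<Sum>l<i'::nat. ?e)"
    have lk: "Poly_Mapping.lookup m v + (if v = z then 2 * i else 0) = Poly_Mapping.lookup m' v + (if v = z then 2 * i' else 0)" for v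
      using arg_cong[OF eq, of "\<lambda>p. Poly_Mapping.lookup p v"]
      by (auto simp: lookup_add lookup_sum_const lookup_single when_def simp del: sum_constant split: if_splits)
    have off: "Poly_Mapping.lookup m v = Poly_Mapping.lookup m' v" if "v \<noteq> z" for v using lk[of v] that by simp
    have "(\<Sum>v\<in>W. Poly_Mapping.lookup m v) = (\<Sum>v\<in>W. Poly_Mapping.lookup m' v)"
      by (intro sum.cong refl off) (use assms(2) in auto)
    then have "Poly_Mapping.lookup m z = Poly_Mapping.lookup m' z" using m by (simp add: star_monoid_def)
    then show "m = m' \<and> i = i'" using lk[of z] off poly_mapping_eqI[of m m'] by (metis add_left_cancel mult_cancel1 zero_neq_numeral)
  qed
  then show ?thesis using even_star_monoid_eq[OF assms] by simp
qed

section \<open>The edge monoid of a complete multipartite graph\<close>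

text \<open>Take \<open>f i\<close> copies of an element of weight one at \<open>i\<close>, for
  every facet \<open>i\<close>. The sum serves as a common denominator when weights are written as
  differences in \<open>principal_lattice_iff\<close>.\<close>

lemma (in facet_monoid) large_element: "\<exists>n\<in>S. \<forall>j\<in>J. f j \<le> \<sigma> j n"
proof -
  obtain g where g: "\<And>j. j \<in> J \<Longrightarrow> g j \<in> S \<and> \<sigma> j (g j) = 1" using \<sigma>_primitive by metis
  define n where "n = (\<Sum>i\<in>J. \<Sum>l<f i. g i)"
  have S: "(\<Sum>l<f i. g i) \<in> S" if "i \<in> J" for i using g[OF that] by (intro sum_S) auto
  have "f j \<le> \<sigma> j n" if j: "j \<in> J" for j
  proof -
    have "f j = \<sigma> j (\<Sum>l<f j. g j)" using g[OF j] by (subst \<sigma>_sum) auto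
    also have "\<dots> \<le> (\<Sum>i\<in>J. \<sigma> j (\<Sum>l<f i. g i))" using j finite_J by (intro member_le_sum) auto
    also have "\<dots> = \<sigma> j n" unfolding n_def using S by (subst \<sigma>_sum) auto
    finally show ?thesis .
  qed
  moreover have "n \<in> S" unfolding n_def by (rule sum_S) (rule S)
  ultimately show ?thesis by blast
qed

text \<open>The parts are the colour classes, and an edge joins two vertices of different colour.
  Thus \<open>avoid\<close> asks for an edge that misses a given vertex and a given part; all
  witnesses for the facets are edges of this kind.\<close>

locale multipartite =
  fixes V :: "'v::linorder set" and col :: "'v \<Rightarrow> 'c"
  assumes finite_V: "finite V" and V_nonempty: "V \<noteq> {}"
    and avoid: "v \<in> V \<Longrightarrow> c \<in> col ` V \<Longrightarrow>
      \<exists>u\<in>V - {v}. \<exists>w\<in>V - {v}. col u \<noteq> col w \<and> col u \<noteq> c \<and> col w \<noteq> c"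
begin

definition deg :: "('v \<Rightarrow>\<^sub>0 nat) \<Rightarrow> nat" where
  "deg m = (\<Sum>v\<in>V. Poly_Mapping.lookup m v)"

definition part :: "'c \<Rightarrow> ('v \<Rightarrow>\<^sub>0 nat) \<Rightarrow> nat" where
  "part c m = (\<Sum>v\<in>{v \<in> V. col v = c}. Poly_Mapping.lookup m v)"

definition even_monoid :: "('v \<Rightarrow>\<^sub>0 nat) set" where
  "even_monoid = {m. Poly_Mapping.keys m \<subseteq> V \<and> even (deg m)}"

definition edge_monoid :: "('v \<Rightarrow>\<^sub>0 nat) set" where
  "edge_monoid = {m \<in> even_monoid. \<forall>c\<in>col ` V. 2 * part c m \<le> deg m}"

definition facets :: "('v + 'c) set" where
  "facets = Inl ` V \<union> Inr ` col ` V"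

text \<open>The natural subtraction is exact on \<open>edge_monoid\<close>, where
  \<open>2 * part c m \<le> deg m\<close>; additivity is accordingly claimed there only.\<close>

definition facet_fun :: "'v + 'c \<Rightarrow> ('v \<Rightarrow>\<^sub>0 nat) \<Rightarrow> nat" where
  "facet_fun j m = (case j of Inl v \<Rightarrow> Poly_Mapping.lookup m v | Inr c \<Rightarrow> deg m div 2 - part c m)"

lemma facet_fun_simps [simp]:
  "facet_fun (Inl v) m = Poly_Mapping.lookup m v" "facet_fun (Inr c) m = deg m div 2 - part c m"
  by (simp_all add: facet_fun_def)

lemma deg_add: "deg (m + n) = deg m + deg n"
  by (simp add: deg_def lookup_add sum.distrib)

lemma part_add: "part c (m + n) = part c m + part c n"
  by (simp add: part_def lookup_add sum.distrib)

lemma deg_zero [simp]: "deg 0 = 0" and part_zero [simp]: "part c 0 = 0"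
  by (simp_all add: deg_def part_def)

lemma deg_single: "v \<in> V \<Longrightarrow> deg (Poly_Mapping.single v k) = k"
  using finite_V by (simp add: deg_def lookup_single when_def)

lemma part_single: "v \<in> V \<Longrightarrow> part c (Poly_Mapping.single v k) = (if col v = c then k else 0)"
  using finite_V by (simp add: part_def lookup_single when_def)

lemma part_le_deg: "part c m \<le> deg m"
  unfolding part_def deg_def using finite_V by (intro sum_mono2) auto

lemma deg_eq_sum_part: "deg m = (\<Sum>c\<in>col ` V. part c m)"
  unfolding deg_def part_def using finite_V by (rule sum.image_gen)

lemma part_outside: "c \<notin> col ` V \<Longrightarrow> part c m = 0"
  unfolding part_def by (rule sum.neutral) auto

lemma edge_monoid_part_le: "m \<in> edge_monoid \<Longrightarrow> 2 * part c m \<le> deg m"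
  using part_outside[of c m] by (cases "c \<in> col ` V") (auto simp: edge_monoid_def)

lemma add_submonoid_even: "add_submonoid even_monoid"
proof
  fix m n assume "m \<in> even_monoid" "n \<in> even_monoid"
  then show "m + n \<in> even_monoid" using keys_add[of m n] by (auto simp: even_monoid_def deg_add)
qed (simp add: even_monoid_def)

lemma add_submonoid_edge: "add_submonoid edge_monoid"
proof
  fix m n assume mn: "m \<in> edge_monoid" "n \<in> edge_monoid"
  then have "m + n \<in> even_monoid"
    using add_submonoid.add_S[OF add_submonoid_even] by (simp add: edge_monoid_def)
  moreover have "2 * part c (m + n) \<le> deg (m + n)" for c
    using edge_monoid_part_le[OF mn(1), of c] edge_monoid_part_le[OF mn(2), of c] by (simp add: part_add deg_add)
  ultimately show "m + n \<in> edge_monoid" by (simp add: edge_monoid_def)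
next
  show "0 \<in> edge_monoid"
    using add_submonoid.zero_S[OF add_submonoid_even] by (simp add: edge_monoid_def)
qed

definition edge_vec :: "'v \<Rightarrow> 'v \<Rightarrow> ('v \<Rightarrow>\<^sub>0 nat)" where
  "edge_vec a b = Poly_Mapping.single a 1 + Poly_Mapping.single b 1"

lemma lookup_edge_vec:
  "a \<noteq> b \<Longrightarrow> Poly_Mapping.lookup (edge_vec a b) v = (if v = a \<or> v = b then 1 else 0)"
  by (auto simp: edge_vec_def lookup_add lookup_single when_def)

lemma deg_edge_vec: "a \<in> V \<Longrightarrow> b \<in> V \<Longrightarrow> deg (edge_vec a b) = 2"
  by (simp add: edge_vec_def deg_add deg_single)

lemma part_edge_vec:
  "a \<in> V \<Longrightarrow> b \<in> V \<Longrightarrow> col a \<noteq> col b \<Longrightarrow> part c (edge_vec a b) = (if c = col a \<or> c = col b then 1 else 0)"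
  by (auto simp: edge_vec_def part_add part_single)

lemma edge_vec_mem:
  assumes "a \<in> V" "b \<in> V" "col a \<noteq> col b"
  shows "edge_vec a b \<in> edge_monoid"
proof -
  have "a \<noteq> b" using assms by auto
  then have "Poly_Mapping.keys (edge_vec a b) \<subseteq> V"
    using assms by (auto simp: in_keys_iff lookup_edge_vec split: if_splits)
  then show ?thesis
    using assms by (auto simp: edge_monoid_def even_monoid_def deg_edge_vec part_edge_vec)
qed

lemma facet_fun_edge_vec:
  assumes "a \<in> V" "b \<in> V" "col a \<noteq> col b"
  shows "facet_fun (Inl v) (edge_vec a b) = (if v = a \<or> v = b then 1 else 0)"
    "facet_fun (Inr c) (edge_vec a b) = (if c = col a \<or> c = col b then 0 else 1)"
proof -
  have "a \<noteq> b" using assms by auto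
  then show "facet_fun (Inl v) (edge_vec a b) = (if v = a \<or> v = b then 1 else 0)"
    by (simp add: lookup_edge_vec)
  show "facet_fun (Inr c) (edge_vec a b) = (if c = col a \<or> c = col b then 0 else 1)"
    using assms by (simp add: deg_edge_vec part_edge_vec)
qed

text \<open>An edge has weight one at its two ends and at the parts that it misses, and weight zero
  at all other facets (\<open>facet_fun_edge_vec\<close>). So an edge is sought that meets the
  vertex or misses the part of \<open>i\<close>, and does the opposite for \<open>j\<close>.\<close>

lemma facet_fun_separates:
  assumes "i \<in> facets" "j \<in> facets" "i \<noteq> j"
  shows "\<exists>s\<in>edge_monoid. facet_fun j s = 0 \<and> facet_fun i s > 0"
proof -
  have *: ?thesis if "a \<in> V" "b \<in> V" "col a \<noteq> col b"
    "facet_fun j (edge_vec a b) = 0" "facet_fun i (edge_vec a b) > 0" for a b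
    using edge_vec_mem[OF that(1-3)] that(4,5) by blast
  consider v where "j = Inl v" "v \<in> V" | c where "j = Inr c" "c \<in> col ` V"
    using assms(2) by (auto simp: facets_def)
  then show ?thesis
  proof cases
    case j: 1
    consider w where "i = Inl w" "w \<in> V" "w \<noteq> v" | c where "i = Inr c" "c \<in> col ` V"
      using assms(1,3) j by (auto simp: facets_def)
    then show ?thesis
    proof cases
      case i: 1
      obtain u where "u \<in> V" "u \<noteq> v" "col u \<noteq> col w" using avoid[OF j(2), of "col w"] i(2) by auto
      then show ?thesis using *[of w u] i j by (simp add: facet_fun_edge_vec del: facet_fun_simps)
    next
      case i: 2
      obtain u w where "u \<in> V" "w \<in> V" "u \<noteq> v" "w \<noteq> v" "col u \<noteq> col w" "col u \<noteq> c" "col w \<noteq> c"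
        using avoid[OF j(2) i(2)] by auto
      then show ?thesis using *[of u w] i j by (simp add: facet_fun_edge_vec del: facet_fun_simps)
    qed
  next
    case j: 2
    consider w where "i = Inl w" "w \<in> V" | c' where "i = Inr c'" "c' \<in> col ` V" "c' \<noteq> c"
      using assms(1,3) j by (auto simp: facets_def)
    then show ?thesis
    proof cases
      case i: 1
      obtain u where "u \<in> V" "col u \<noteq> col w" "col u = c \<or> col w = c"
      proof (cases "col w = c")
        case True
        then show thesis using avoid[OF i(2) j(2)] that by auto
      next
        case False
        then show thesis using j(2) that by auto
      qed
      then show ?thesis using *[of w u] i j by (auto simp: facet_fun_edge_vec simp del: facet_fun_simps)
    next
      case i: 2
      obtain a where a: "a \<in> V" "col a = c" using j(2) by auto
      obtain u w where "u \<in> V" "w \<in> V" "col u \<noteq> col w" "col u \<noteq> c'" "col w \<noteq> c'"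
        using avoid[OF a(1) i(2)] by auto
      then obtain x where "x \<in> V" "col x \<noteq> c" "col x \<noteq> c'" by metis
      then show ?thesis using *[of a x] a i j by (simp add: facet_fun_edge_vec del: facet_fun_simps)
    qed
  qed
qed

lemma facet_fun_primitive:
  assumes "j \<in> facets"
  shows "\<exists>m\<in>edge_monoid. facet_fun j m = 1"
proof -
  obtain v c where j: "j = Inl v \<and> v \<in> V \<or> j = Inr c \<and> c \<in> col ` V \<and> v \<in> V"
    using assms V_nonempty by (auto simp: facets_def)
  show ?thesis
  proof (cases "j = Inl v")
    case True
    then have v: "v \<in> V" using j by auto
    then obtain u where u: "u \<in> V" "col u \<noteq> col v" using avoid[OF v, of "col v"] by auto
    then show ?thesis using True v edge_vec_mem[of u v]
      by (intro bexI[of _ "edge_vec u v"]) (simp_all add: facet_fun_edge_vec del: facet_fun_simps)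
  next
    case False
    then have c: "j = Inr c" "c \<in> col ` V" "v \<in> V" using j by auto
    then obtain u w where "u \<in> V" "w \<in> V" "col u \<noteq> col w" "col u \<noteq> c" "col w \<noteq> c"
      using avoid[of v c] by auto
    then show ?thesis using c edge_vec_mem[of u w]
      by (intro bexI[of _ "edge_vec u w"]) (simp_all add: facet_fun_edge_vec del: facet_fun_simps)
  qed
qed

text \<open>The facet inequalities between \<open>m\<close> and \<open>u\<close> are the defining
  inequalities of \<open>edge_monoid\<close> for \<open>u - m\<close>; parity makes halving the
  degrees exact.\<close>

lemma facet_fun_divides:
  assumes m: "m \<in> edge_monoid" and u: "u \<in> edge_monoid"
    and le: "\<And>j. j \<in> facets \<Longrightarrow> facet_fun j m \<le> facet_fun j u"
  shows "\<exists>w\<in>edge_monoid. u = m + w"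
proof -
  define w where "w = u - m"
  have lk: "Poly_Mapping.lookup m v \<le> Poly_Mapping.lookup u v" for v
  proof (cases "v \<in> V")
    case True
    then show ?thesis using le[of "Inl v"] by (simp add: facets_def)
  next
    case False
    then have "Poly_Mapping.lookup m v = 0" using m by (auto simp: edge_monoid_def even_monoid_def keys_subset_iff)
    then show ?thesis by simp
  qed
  have uw: "u = m + w" by (rule poly_mapping_eqI) (simp add: w_def lookup_add lookup_minus lk)
  have "w \<in> edge_monoid"
  proof -
    have keys: "Poly_Mapping.keys w \<subseteq> V"
      using u by (auto simp: w_def edge_monoid_def even_monoid_def keys_subset_iff lookup_minus)
    have ev: "even (deg m)" "even (deg u)" using m u by (simp_all add: edge_monoid_def even_monoid_def)
    then have "even (deg w)" unfolding uw by (simp add: deg_add)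
    moreover have "2 * part c w \<le> deg w" if c: "c \<in> col ` V" for c
    proof -
      have "deg m div 2 - part c m \<le> deg u div 2 - part c u" using le[of "Inr c"] c by (simp add: facets_def)
      moreover note edge_monoid_part_le[OF m, of c] edge_monoid_part_le[OF u, of c]
      moreover have "deg u = deg m + deg w" "part c u = part c m + part c w"
        unfolding uw by (simp_all add: deg_add part_add)
      ultimately show ?thesis using ev by (auto elim!: evenE)
    qed
    ultimately show ?thesis using keys by (simp add: edge_monoid_def even_monoid_def)
  qed
  then show ?thesis using uw by blast
qed

lemma facet_fun_add:
  assumes "m \<in> edge_monoid" "n \<in> edge_monoid"
  shows "facet_fun j (m + n) = facet_fun j m + facet_fun j n"
proof (cases j)
  case (Inr c)
  have "even (deg m)" "even (deg n)" using assms by (auto simp: edge_monoid_def even_monoid_def)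
  then show ?thesis
    using edge_monoid_part_le[OF assms(1), of c] edge_monoid_part_le[OF assms(2), of c]
    unfolding Inr by (auto simp: deg_add part_add elim!: evenE)
qed (simp add: lookup_add)

lemma facet_monoid_edge:
  "facet_monoid edge_monoid (monoid_algebra edge_monoid :: (('v \<Rightarrow>\<^sub>0 nat) \<Rightarrow>\<^sub>0 'k::field) set) facets facet_fun"
proof (intro facet_monoid.intro facet_monoid_axioms.intro add_submonoid_edge refl)
  show "finite facets" using finite_V by (simp add: facets_def)
qed (use facet_fun_add facet_fun_divides facet_fun_separates facet_fun_primitive in auto)

lemma edge_into_even: "edge_monoid \<subseteq> even_monoid"
  by (auto simp: edge_monoid_def)

lemma even_monoid_into_edge_monoid:
  assumes m: "m \<in> even_monoid"
  shows "\<exists>u\<in>edge_monoid. u + m \<in> edge_monoid"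
proof -
  obtain a where a: "a \<in> V" using V_nonempty by blast
  obtain b c where bc: "b \<in> V" "c \<in> V" "col b \<noteq> col c" "col b \<noteq> col a" "col c \<noteq> col a"
    using avoid[OF a, of "col a"] a by auto
  \<comment> \<open>With weight \<open>k\<close> on vertices of three different parts, no part has
    more than \<open>k\<close> of the total \<open>3 * k\<close>. The slack \<open>k\<close> absorbs
    twice any part of \<open>m\<close>, and \<open>k\<close> even keeps the degree even.\<close>
  define k where "k = 2 * deg m"
  define u where "u = Poly_Mapping.single a k + Poly_Mapping.single b k + Poly_Mapping.single c k"
  have deg_u: "deg u = 3 * k" using a bc by (simp add: u_def deg_add deg_single)
  have part_u: "part e u \<le> k" for e using a bc by (auto simp: u_def part_add part_single)
  have "Poly_Mapping.keys u \<subseteq> V"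
    using a bc by (auto simp: u_def keys_subset_iff lookup_add lookup_single when_def)
  then have "u \<in> even_monoid" by (simp add: even_monoid_def deg_u k_def)
  moreover from this have "u + m \<in> even_monoid" using m add_submonoid.add_S[OF add_submonoid_even] by blast
  moreover have "2 * part e u \<le> deg u" for e using part_u[of e] by (simp add: deg_u)
  moreover have "2 * part e (u + m) \<le> deg (u + m)" for e
    using part_u[of e] part_le_deg[of e m] by (simp add: deg_u deg_add part_add k_def)
  ultimately show ?thesis by (auto simp: edge_monoid_def)
qed

lemma loc_factorial_edge:
  "loc_factorial edge_monoid (monoid_algebra edge_monoid :: (('v \<Rightarrow>\<^sub>0 nat) \<Rightarrow>\<^sub>0 'k::field) set)"
proof -
  obtain z where z: "z \<in> V" using V_nonempty by blast
  define W where "W = V - {z}"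
  have W: "finite W" "z \<notin> W" "insert z W = V" using z finite_V by (auto simp: W_def)
  have deg: "deg m = Poly_Mapping.lookup m z + (\<Sum>w\<in>W. Poly_Mapping.lookup m w)" for m
    unfolding deg_def using W by (metis sum.insert)
  let ?N = "even_star_monoid z W"
  have "commensurable_monoids edge_monoid ?N even_monoid (monoid_algebra ?N :: (('v \<Rightarrow>\<^sub>0 nat) \<Rightarrow>\<^sub>0 'k) set)"
  proof (intro commensurable_monoids.intro commensurable_monoids_axioms.intro add_submonoid_edge
      add_submonoid_even add_submonoid_even_star refl edge_into_even even_monoid_into_edge_monoid
      factorial_even_star_monoid W(1,2))
    show "?N \<subseteq> even_monoid" by (auto simp: even_star_monoid_def even_monoid_def deg W(3))
    fix m assume m: "m \<in> even_monoid"
    obtain t where t: "deg m = 2 * t" using m by (auto simp: even_monoid_def elim: evenE)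
    \<comment> \<open>After adding \<open>x\<close> the coordinate at \<open>z\<close> exceeds the
      sum of the others by \<open>deg m\<close> plus twice the coordinate of \<open>m\<close> at
      \<open>z\<close>, which is nonnegative and even.\<close>
    define x where "x = Poly_Mapping.single z (2 * deg m)"
    have lk: "Poly_Mapping.lookup x v = (if v = z then 2 * deg m else 0)" for v
      by (auto simp: x_def lookup_single when_def)
    have sumx: "(\<Sum>w\<in>W. Poly_Mapping.lookup x w) = 0" using W(2) by (intro sum.neutral) (auto simp: lk)
    have "x \<in> ?N" using z W(3) sumx by (auto simp: even_star_monoid_def keys_subset_iff lk)
    moreover have "x + m \<in> ?N"
    proof -
      have "Poly_Mapping.keys (x + m) \<subseteq> insert z W"
        using m z by (auto simp: even_monoid_def keys_subset_iff lookup_add lk W(3))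
      moreover have "Poly_Mapping.lookup (x + m) z =
          (\<Sum>w\<in>W. Poly_Mapping.lookup (x + m) w) + 2 * (Poly_Mapping.lookup m z + t)"
        using deg[of m] t sumx by (simp add: lookup_add sum.distrib lk)
      ultimately show ?thesis unfolding even_star_monoid_def by blast
    qed
    ultimately show "\<exists>x\<in>?N. x + m \<in> ?N" by blast
  qed
  then show ?thesis by (rule commensurable_monoids.loc_factorial_monoid_algebra)
qed

lemma factorial_facet_monoid_edge:
  "factorial_facet_monoid edge_monoid (monoid_algebra edge_monoid :: (('v \<Rightarrow>\<^sub>0 nat) \<Rightarrow>\<^sub>0 'k::field) set)
     facets facet_fun"
  by (intro factorial_facet_monoid.intro factorial_facet_monoid_axioms.intro facet_monoid_edge loc_factorial_edge)

end

section \<open>The edge ring as a monoid algebra\<close>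

context multipartite
begin

text \<open>Greedy choice: remove an edge between the two heaviest parts. For these parts both sides
  of the inequality drop by two. For a third part equality is impossible before the removal, since
  two other parts are at least as heavy, and parity then leaves a slack of two.\<close>

lemma edge_monoid_decompose:
  assumes m: "m \<in> edge_monoid" and pos: "deg m > 0"
  shows "\<exists>a\<in>V. \<exists>b\<in>V. col a \<noteq> col b \<and> (\<exists>m'\<in>edge_monoid. m = edge_vec a b + m')"
proof -
  let ?C = "col ` V"
  have finC: "finite ?C" using finite_V by simp
  have ev: "even (deg m)" and keys: "Poly_Mapping.keys m \<subseteq> V"
    using m by (auto simp: edge_monoid_def even_monoid_def)
  have ex_max: "\<exists>c\<in>D. \<forall>d\<in>D. part d m \<le> part c m" if D: "D \<subseteq> ?C" "D \<noteq> {}" for D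
  proof -
    have f: "finite ((\<lambda>d. part d m) ` D)" using D finC finite_subset by blast
    then have "Max ((\<lambda>d. part d m) ` D) \<in> (\<lambda>d. part d m) ` D" using D(2) by (intro Max_in) auto
    then obtain c where "c \<in> D" "part c m = Max ((\<lambda>d. part d m) ` D)" by auto
    then show ?thesis using f by (intro bexI[of _ c]) auto
  qed
  obtain c1 where c1: "c1 \<in> ?C" "\<And>d. d \<in> ?C \<Longrightarrow> part d m \<le> part c1 m"
    using ex_max[of ?C] V_nonempty by auto
  obtain v where v: "v \<in> V" "col v = c1" using c1(1) by auto
  have "?C - {c1} \<noteq> {}" using avoid[OF v(1) c1(1)] by auto
  then obtain c2 where c2: "c2 \<in> ?C" "c2 \<noteq> c1" "\<And>d. d \<in> ?C \<Longrightarrow> d \<noteq> c1 \<Longrightarrow> part d m \<le> part c2 m"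
    using ex_max[of "?C - {c1}"] by auto
  have split: "deg m = part c1 m + (\<Sum>c\<in>?C - {c1}. part c m)"
    unfolding deg_eq_sum_part by (rule sum.remove[OF finC c1(1)])
  \<comment> \<open>Otherwise all the weight sits in the part \<open>c1\<close>, against
    \<open>2 * part c1 m \<le> deg m\<close>.\<close>
  have c2pos: "part c2 m > 0"
  proof (rule ccontr)
    assume "\<not> ?thesis"
    then have "(\<Sum>c\<in>?C - {c1}. part c m) = 0" using c2(3) by (intro sum.neutral) auto
    then show False using split edge_monoid_part_le[OF m, of c1] pos by simp
  qed
  then have c1pos: "part c1 m > 0" using c1(2)[OF c2(1)] by simp
  have vertex: "\<exists>a\<in>V. col a = c \<and> Poly_Mapping.lookup m a > 0" if "part c m > 0" for c
  proof (rule ccontr)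
    assume "\<not> ?thesis"
    then have "part c m = 0" unfolding part_def by (intro sum.neutral) auto
    then show False using that by simp
  qed
  obtain a where a: "a \<in> V" "col a = c1" "Poly_Mapping.lookup m a > 0" using vertex[OF c1pos] by blast
  obtain b where b: "b \<in> V" "col b = c2" "Poly_Mapping.lookup m b > 0" using vertex[OF c2pos] by blast
  have ab: "col a \<noteq> col b" "a \<noteq> b" using a b c2 by auto
  define m' where "m' = m - edge_vec a b"
  have mm: "m = edge_vec a b + m'"
    by (rule poly_mapping_eqI)
      (use a b in \<open>auto simp: m'_def lookup_add lookup_minus lookup_edge_vec[OF ab(2)]\<close>)
  have degm: "deg m = 2 + deg m'" using a b by (subst mm) (simp add: deg_add deg_edge_vec)
  have partm: "part c m = (if c = c1 \<or> c = c2 then 1 else 0) + part c m'" for c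
    using a b ab by (subst mm) (simp add: part_add part_edge_vec)
  have "2 * part c m' \<le> deg m'" if c: "c \<in> ?C" for c
  proof (cases "c = c1 \<or> c = c2")
    case True
    then show ?thesis using edge_monoid_part_le[OF m, of c] partm[of c] degm by simp
  next
    case False
    then have "part c m \<le> part c1 m" "part c m \<le> part c2 m" using c1(2) c2(3) c by auto
    moreover have "part c m + part c1 m + part c2 m \<le> deg m"
    proof -
      have "(\<Sum>d\<in>{c, c1, c2}. part d m) \<le> deg m"
        unfolding deg_eq_sum_part using c c1(1) c2(1) finC by (intro sum_mono2) auto
      then show ?thesis using False c2(2) by simp
    qed
    ultimately have "2 * part c m \<noteq> deg m" using pos by linarith
    \<comment> \<open>Two unequal even numbers differ by at least two, which pays for the loss of
      degree.\<close>
    then have "2 * part c m + 2 \<le> deg m" using ev edge_monoid_part_le[OF m, of c] by presburger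
    then show ?thesis using partm[of c] False degm by simp
  qed
  moreover have "Poly_Mapping.keys m' \<subseteq> V" using keys by (auto simp: m'_def keys_subset_iff lookup_minus)
  moreover have "even (deg m')" using ev degm by simp
  ultimately have "m' \<in> edge_monoid" by (simp add: edge_monoid_def even_monoid_def)
  then show ?thesis using a(1) b(1) ab(1) mm by blast
qed

text \<open>The generators lie in the monoid algebra, and by repeated use of
  \<open>edge_monoid_decompose\<close> every monomial of \<open>edge_monoid\<close> is a product of
  edge monomials.\<close>

lemma edge_ring_eq:
  assumes E: "\<And>a b. {a, b} \<in> E \<longleftrightarrow> a \<in> V \<and> b \<in> V \<and> col a \<noteq> col b"
  shows "(edge_ring V E :: (('v \<Rightarrow>\<^sub>0 nat) \<Rightarrow>\<^sub>0 'k::field) ring) = idom_subring.ring_on (monoid_algebra edge_monoid)"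
proof -
  let ?P = "monoid_algebra {m. Poly_Mapping.keys m \<subseteq> V} :: (('v \<Rightarrow>\<^sub>0 nat) \<Rightarrow>\<^sub>0 'k) set"
  let ?A = "monoid_algebra edge_monoid :: (('v \<Rightarrow>\<^sub>0 nat) \<Rightarrow>\<^sub>0 'k) set"
  let ?R = "polynomial_ring V :: (('v \<Rightarrow>\<^sub>0 nat) \<Rightarrow>\<^sub>0 'k) ring"
  let ?gen = "range pconst \<union> {pvar a \<otimes>\<^bsub>?R\<^esub> pvar b | a b. {a, b} \<in> E}"
  interpret P: idom_subring ?P
    by (rule idom_subring_monoid_algebra, unfold_locales)
      (auto simp: keys_subset_iff lookup_add)
  interpret A: idom_subring ?A
    by (rule idom_subring_monoid_algebra[OF add_submonoid_edge])
  have R: "?R = P.ring_on"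
    unfolding polynomial_ring_def P.ring_on_def
    by (rule arg_cong[where f = "\<lambda>C. ring_of_type_algebra\<lparr>carrier := C\<rparr>"]) (auto simp: monoid_algebra_def)
  have AP: "?A \<subseteq> ?P" by (auto simp: monoid_algebra_def edge_monoid_def even_monoid_def)
  have gen: "?gen = range (Poly_Mapping.single 0) \<union> {mon (edge_vec a b) | a b. a \<in> V \<and> b \<in> V \<and> col a \<noteq> col b}"
    unfolding R E by (simp add: pconst_def[abs_def] pvar_def mult_single edge_vec_def)
  have "generate_ring ?R ?gen = ?A"
  proof
    show "generate_ring ?R ?gen \<subseteq> ?A"
    proof
      fix p assume "p \<in> generate_ring ?R ?gen"
      then show "p \<in> ?A"
      proof induction
        case one
        then show ?case by (simp add: R)
      next
        case (incl p)
        then show ?case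
          unfolding gen using edge_vec_mem add_submonoid.zero_S[OF add_submonoid_edge]
          by auto
      next
        case (a_inv p)
        then show ?case using AP by (auto simp: R)
      next
        case (eng_add p q)
        then show ?case by (simp add: R)
      next
        case (eng_mult p q)
        then show ?case by (simp add: R)
      qed
    qed
    show "?A \<subseteq> generate_ring ?R ?gen"
    proof
      have mult: "p * q \<in> generate_ring ?R ?gen" if "p \<in> generate_ring ?R ?gen" "q \<in> generate_ring ?R ?gen" for p q
        using generate_ring.eng_mult[OF that] by (simp add: R)
      have add: "p + q \<in> generate_ring ?R ?gen" if "p \<in> generate_ring ?R ?gen" "q \<in> generate_ring ?R ?gen" for p q
        using generate_ring.eng_add[OF that] by (simp add: R)
      have const: "Poly_Mapping.single 0 c \<in> generate_ring ?R ?gen" for c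
        by (rule generate_ring.incl) (simp add: gen)
      have mon: "mon m \<in> generate_ring ?R ?gen" if "m \<in> edge_monoid" for m
        using that
      proof (induction "deg m" arbitrary: m rule: less_induct)
        case less
        show ?case
        proof (cases "deg m = 0")
          case True
          have "Poly_Mapping.lookup m v = 0" for v
            using True less.prems finite_V
            by (cases "v \<in> V") (auto simp: deg_def edge_monoid_def even_monoid_def keys_subset_iff)
          then have "m = 0" by (simp add: poly_mapping_eqI)
          then show ?thesis using const[of 1] by simp
        next
          case False
          then obtain a b m' where ab: "a \<in> V" "b \<in> V" "col a \<noteq> col b" "m' \<in> edge_monoid" "m = edge_vec a b + m'"
            using edge_monoid_decompose[OF less.prems] by auto
          have "deg m' < deg m" using ab by (simp add: deg_add deg_edge_vec)
          then have "mon m' \<in> generate_ring ?R ?gen" using less.hyps ab(4) by blast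
          moreover have "mon (edge_vec a b) \<in> generate_ring ?R ?gen"
            using ab by (intro generate_ring.incl) (auto simp: gen)
          ultimately show ?thesis unfolding ab(5) mon_add by (rule mult[rotated])
        qed
      qed
      have sum: "sum f K \<in> generate_ring ?R ?gen" if "\<And>k. k \<in> K \<Longrightarrow> f k \<in> generate_ring ?R ?gen"
        for f and K :: "('v \<Rightarrow>\<^sub>0 nat) set"
        using that const[of 0] by (induction K rule: infinite_finite_induct) (auto intro: add)
      fix p assume p: "p \<in> ?A"
      have "Poly_Mapping.single m (Poly_Mapping.lookup p m) \<in> generate_ring ?R ?gen" if "m \<in> Poly_Mapping.keys p" for m
      proof -
        have "m \<in> edge_monoid" using p that by (auto simp: monoid_algebra_def)
        then have "Poly_Mapping.single 0 (Poly_Mapping.lookup p m) * mon m \<in> generate_ring ?R ?gen"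
          by (intro mult const mon)
        then show ?thesis by (simp add: mult_single)
      qed
      then have "(\<Sum>m\<in>Poly_Mapping.keys p. Poly_Mapping.single m (Poly_Mapping.lookup p m)) \<in> generate_ring ?R ?gen"
        by (rule sum)
      then show "p \<in> generate_ring ?R ?gen"
        using poly_mapping_eq_sum_single[of "Poly_Mapping.keys p" p] by simp
    qed
  qed
  then show ?thesis
    unfolding edge_ring_def by (simp add: A.ring_on_def polynomial_ring_def)
qed

section \<open>The lattice of principal weights\<close>

definition colour_sum :: "('v + 'c \<Rightarrow> int) \<Rightarrow> 'c \<Rightarrow> int" where
  "colour_sum x c = x (Inr c) + (\<Sum>v\<in>{v \<in> V. col v = c}. x (Inl v))"

definition total :: "('v + 'c \<Rightarrow> int) \<Rightarrow> int" where
  "total x = (\<Sum>v\<in>V. x (Inl v))"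

text \<open>For the weights of one exponent \<open>m\<close> the \<open>colour_sum\<close> of every
  part is \<open>deg m div 2\<close>, since \<open>part c m\<close> cancels, and
  \<open>total\<close> is \<open>deg m\<close>; differences inherit these relations. Conversely,
  adding the weights of a large \<open>n\<close> makes all weights nonnegative, and the relations
  then make them the weights of an even vector.\<close>

lemma principal_lattice_iff:
  "(\<exists>m\<in>edge_monoid. \<exists>n\<in>edge_monoid. \<forall>j\<in>facets. x j = int (facet_fun j m) - int (facet_fun j n)) \<longleftrightarrow>
   (\<exists>t. total x = 2 * t \<and> (\<forall>c\<in>col ` V. colour_sum x c = t))" (is "?L \<longleftrightarrow> ?R")
proof
  assume ?L
  then obtain m n where mn: "m \<in> edge_monoid" "n \<in> edge_monoid"
    and x: "\<And>j. j \<in> facets \<Longrightarrow> x j = int (facet_fun j m) - int (facet_fun j n)" by blast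
  have xv: "x (Inl v) = int (Poly_Mapping.lookup m v) - int (Poly_Mapping.lookup n v)" if "v \<in> V" for v
    using x[of "Inl v"] that by (simp add: facets_def)
  have "total x = int (deg m) - int (deg n)"
    using xv by (simp add: total_def deg_def sum_subtractf)
  moreover have "even (deg m)" "even (deg n)" using mn by (simp_all add: edge_monoid_def even_monoid_def)
  then obtain k l where kl: "deg m = 2 * k" "deg n = 2 * l" by (auto elim!: evenE)
  moreover have "colour_sum x c = int k - int l" if c: "c \<in> col ` V" for c
  proof -
    have "(\<Sum>v\<in>{v \<in> V. col v = c}. x (Inl v)) = int (part c m) - int (part c n)"
      using xv by (simp add: part_def sum_subtractf)
    moreover have "x (Inr c) = int (k - part c m) - int (l - part c n)"
      using x[of "Inr c"] c kl by (simp add: facets_def)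
    moreover have "part c m \<le> k" "part c n \<le> l"
      using edge_monoid_part_le[OF mn(1), of c] edge_monoid_part_le[OF mn(2), of c] kl by simp_all
    ultimately show ?thesis by (simp add: colour_sum_def of_nat_diff)
  qed
  ultimately show ?R by (intro exI[of _ "int k - int l"]) (simp add: right_diff_distrib)
next
  assume ?R
  then obtain t where t: "total x = 2 * t" "\<And>c. c \<in> col ` V \<Longrightarrow> colour_sum x c = t" by blast
  obtain n where n: "n \<in> edge_monoid" "\<And>j. j \<in> facets \<Longrightarrow> nat \<bar>x j\<bar> \<le> facet_fun j n"
    using facet_monoid.large_element[OF facet_monoid_edge, of "\<lambda>j. nat \<bar>x j\<bar>"] by blast
  obtain l where l: "deg n = 2 * l" using n(1) by (auto simp: edge_monoid_def even_monoid_def elim: evenE)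
  \<comment> \<open>The vertex weights determine \<open>m\<close>. The value of \<open>total\<close>
    makes its degree even, and the values of \<open>colour_sum\<close> give it the prescribed part
    weights.\<close>
  define m where "m = (\<Sum>v\<in>V. Poly_Mapping.single v (nat (x (Inl v) + int (Poly_Mapping.lookup n v))))"
  have lk: "Poly_Mapping.lookup m v = (if v \<in> V then nat (x (Inl v) + int (Poly_Mapping.lookup n v)) else 0)" for v
    using finite_V by (simp add: m_def lookup_sum lookup_single when_def)
  have nonneg: "0 \<le> x (Inl v) + int (Poly_Mapping.lookup n v)" if "v \<in> V" for v
    using n(2)[of "Inl v"] that by (simp add: facets_def)
  have degm: "int (deg m) = 2 * (t + int l)"
  proof -
    have "int (deg m) = (\<Sum>v\<in>V. x (Inl v) + int (Poly_Mapping.lookup n v))"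
      using nonneg by (simp add: deg_def lk)
    also have "\<dots> = total x + int (deg n)" by (simp add: total_def deg_def sum.distrib)
    finally show ?thesis using t l by simp
  qed
  have partm: "int (part c m) = (colour_sum x c - x (Inr c)) + int (part c n)" for c
  proof -
    have "int (part c m) = (\<Sum>v\<in>{v \<in> V. col v = c}. x (Inl v) + int (Poly_Mapping.lookup n v))"
      using nonneg by (simp add: part_def lk)
    then show ?thesis by (simp add: colour_sum_def part_def sum.distrib)
  qed
  have half: "int (deg m div 2) = t + int l" using degm by (simp add: zdiv_int)
  have inr: "int (deg m div 2) - int (part c m) = x (Inr c) + int (facet_fun (Inr c) n)"
    "x (Inr c) + int (facet_fun (Inr c) n) \<ge> 0" if c: "c \<in> col ` V" for c
  proof -
    have "int (facet_fun (Inr c) n) = int l - int (part c n)"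
      using edge_monoid_part_le[OF n(1), of c] l by (simp add: of_nat_diff)
    then show "int (deg m div 2) - int (part c m) = x (Inr c) + int (facet_fun (Inr c) n)"
      using half partm[of c] t(2)[OF c] by simp
    show "x (Inr c) + int (facet_fun (Inr c) n) \<ge> 0"
      using n(2)[of "Inr c"] c by (simp add: facets_def del: facet_fun_simps)
  qed
  have ev: "even (deg m)" using degm by (metis dvd_triv_left even_of_nat_iff)
  have m: "m \<in> edge_monoid"
  proof -
    have "2 * part c m \<le> deg m" if c: "c \<in> col ` V" for c
      using inr[OF c] ev by (auto elim!: evenE)
    then show ?thesis using ev by (auto simp: edge_monoid_def even_monoid_def keys_subset_iff lk)
  qed
  have "x j = int (facet_fun j m) - int (facet_fun j n)" if j: "j \<in> facets" for j
  proof -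
    consider v where "j = Inl v" "v \<in> V" | c where "j = Inr c" "c \<in> col ` V" using j by (auto simp: facets_def)
    then show ?thesis
    proof cases
      case 1
      then show ?thesis using nonneg[OF 1(2)] by (simp add: lk)
    next
      case 2
      have "int (facet_fun (Inr c) m) = int (deg m div 2) - int (part c m)"
        using inr[OF 2(2)] by (simp add: of_nat_diff)
      then show ?thesis using inr(1)[OF 2(2)] 2(1) by (simp del: facet_fun_simps)
    qed
  qed
  then show ?L using m n(1) by blast
qed

lemma colour_sum_add: "colour_sum (\<lambda>j. x j + y j) c = colour_sum x c + colour_sum y c"
  by (simp add: colour_sum_def sum.distrib)

lemma total_add: "total (\<lambda>j. x j + y j) = total x + total y"
  by (simp add: total_def sum.distrib)

end

text \<open>With at least four parts, two parts differ from both \<open>c\<close> and the part of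
  \<open>v\<close>. With three parts only the two parts other than \<open>c\<close> are available,
  and a second vertex in each is needed to avoid \<open>v\<close>.\<close>

lemma multipartite_multipartite_verts:
  assumes r1: "1 \<le> r 1" and mono: "mono_on {1..n} r" and n: "(n = 3 \<and> 2 \<le> r 1) \<or> 4 \<le> n"
  shows "multipartite (multipartite_verts n r) fst" and "fst ` multipartite_verts n r = {1..n}"
proof -
  have r: "r 1 \<le> r i" if "i \<in> {1..n}" for i
    using mono_onD[OF mono, of 1 i] that by simp
  then have mem: "(i, 1) \<in> multipartite_verts n r" if "i \<in> {1..n}" for i
    using that r1 by (fastforce simp: multipartite_verts_def)
  then show fst: "fst ` multipartite_verts n r = {1..n}"
    by (force simp: multipartite_verts_def)
  show "multipartite (multipartite_verts n r) fst"
  proof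
    show "finite (multipartite_verts n r)" by (simp add: multipartite_verts_def)
    show "multipartite_verts n r \<noteq> {}" using mem[of 1] n by auto
    fix v c assume v: "v \<in> multipartite_verts n r" and c: "c \<in> fst ` multipartite_verts n r"
    have two: "\<exists>i j. i \<in> B \<and> j \<in> B \<and> i \<noteq> j" if "2 \<le> card B" for B :: "nat set"
      using that card_le_Suc0_iff_eq[of B] by (metis Suc_n_not_le_n card.infinite numeral_2_eq_2 not_less_eq_eq zero_le)
    show "\<exists>u\<in>multipartite_verts n r - {v}. \<exists>w\<in>multipartite_verts n r - {v}. fst u \<noteq> fst w \<and> fst u \<noteq> c \<and> fst w \<noteq> c"
    proof (cases "4 \<le> n")
      case True
      have "card {1..n} - card {c, fst v} \<le> card ({1..n} - {c, fst v})" by (rule diff_card_le_card_Diff) simp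
      moreover have "card {c, fst v} \<le> 2" by (simp add: card_insert_if)
      ultimately have "2 \<le> card ({1..n} - {c, fst v})" using True by simp
      then obtain i j where "i \<in> {1..n} - {c, fst v}" "j \<in> {1..n} - {c, fst v}" "i \<noteq> j" using two by blast
      then show ?thesis using mem[of i] mem[of j]
        by (intro bexI[of _ "(i, 1)"] bexI[of _ "(j, 1)"]) auto
    next
      case False
      then have n3: "n = 3" "2 \<le> r 1" using n by auto
      have "card {1..n} - card {c} \<le> card ({1..n} - {c})" by (rule diff_card_le_card_Diff) simp
      then have "2 \<le> card ({1..n} - {c})" using n3 by simp
      then obtain i j where ij: "i \<in> {1..n} - {c}" "j \<in> {1..n} - {c}" "i \<noteq> j" using two by blast
      \<comment> \<open>A vertex of the part \<open>i\<close> other than \<open>v\<close>; its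
        existence rests on \<open>2 \<le> r 1\<close> and the monotonicity of
        \<open>r\<close>.\<close>
      define f where "f i = (i, if v = (i, 1) then 2 else 1 :: nat)" for i :: nat
      have f: "f i \<in> multipartite_verts n r - {v}" if "i \<in> {1..n}" for i
        using r[OF that] n3 that by (auto simp: f_def multipartite_verts_def)
      show ?thesis
        by (rule bexI[of _ "f i"], rule bexI[of _ "f j"]) (use ij f in \<open>auto simp: f_def\<close>)
    qed
  qed
qed

theorem theorem1p3:
  fixes n :: nat and r :: "nat \<Rightarrow> nat"
  assumes "1 \<le> r 1" and "mono_on {1..n} r"
    and "(n = 3 \<and> 2 \<le> r 1) \<or> 4 \<le> n"
  shows "divisor_class_group
           (edge_ring (multipartite_verts n r) (multipartite_edges n r)
              :: ((nat \<times> nat \<Rightarrow>\<^sub>0 nat) \<Rightarrow>\<^sub>0 'k::{alg_closed_field, field_char_0}) ring)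
         \<cong> product_group {1..n} (\<lambda>_. integer_group)"
proof -
  let ?V = "multipartite_verts n r"
  let ?H = "product_group {1..n} (\<lambda>_. integer_group) :: (nat \<Rightarrow> int) monoid"
  interpret multipartite ?V fst by (rule multipartite_multipartite_verts(1)[OF assms])
  have colours: "fst ` ?V = {1..n}" by (rule multipartite_multipartite_verts(2)[OF assms])
  have n: "3 \<le> n" using assms(3) by auto
  interpret R: factorial_facet_monoid edge_monoid
      "monoid_algebra edge_monoid :: ((nat \<times> nat \<Rightarrow>\<^sub>0 nat) \<Rightarrow>\<^sub>0 'k) set" facets facet_fun
    by (rule factorial_facet_monoid_edge)
  \<comment> \<open>The relations of \<open>principal_lattice_iff\<close> with \<open>t\<close>
    eliminated through \<open>colour_sum x 1\<close>. The first coordinate records the relation for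
    \<open>total\<close>, the others the differences of the colour sums.\<close>
  define h :: "(nat \<times> nat + nat \<Rightarrow> int) \<Rightarrow> nat \<Rightarrow> int" where
    "h x = (\<lambda>i\<in>{1..n}. if i = 1 then 2 * colour_sum x 1 - total x else colour_sum x i - colour_sum x 1)" for x
  have "divisor_class_group R.ring_on \<cong> ?H"
  proof (rule R.divisor_class_group_iso)
    show "group ?H" by simp
    show "h x \<in> carrier ?H" for x by (simp add: h_def)
    show "h (\<lambda>j. x j + y j) = h x \<otimes>\<^bsub>?H\<^esub> h y" for x y
      by (rule ext) (simp add: h_def colour_sum_add total_add)
    show "\<exists>x. z = h x" if z: "z \<in> carrier ?H" for z
    proof -
      have w: "(2, 1) \<in> ?V"
        using mono_onD[OF assms(2), of 1 2] assms(1) n by (auto simp: multipartite_verts_def)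
      \<comment> \<open>Only the first coordinate of \<open>h\<close> sees \<open>total\<close>, so
        one vertex gets weight \<open>- z 1\<close>. It lies in part \<open>2\<close>, whose own
        weight compensates for it, and \<open>colour_sum x 1\<close> stays zero.\<close>
      define x :: "nat \<times> nat + nat \<Rightarrow> int" where "x j = (case j of Inl v \<Rightarrow> if v = (2, 1) then - z 1 else 0
          | Inr i \<Rightarrow> if i = 1 then 0 else if i = 2 then z 2 + z 1 else z i)" for j
      have "total x = - z 1" using w finite_V by (simp add: total_def x_def)
      moreover have "colour_sum x i = (if i = 1 then 0 else z i)" for i
        using w finite_V by (auto simp: colour_sum_def x_def if_distrib[of "(\<lambda>t. _ + t)"] sum.If_cases)
      ultimately have on: "h x i = z i" if "i \<in> {1..n}" for i
        using that unfolding h_def restrict_apply by simp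
      have "h x i = z i" for i
      proof (cases "i \<in> {1..n}")
        case False
        \<comment> \<open>The elements of the product group are extensional functions, so
          \<open>z\<close> takes the same default value off \<open>{1..n}\<close>.\<close>
        then have "h x i = undefined" unfolding h_def restrict_apply by (rule if_not_P)
        moreover have "z \<in> {1..n} \<rightarrow>\<^sub>E UNIV" using z by simp
        then have "z i = undefined" using False by (rule PiE_arb)
        ultimately show ?thesis by simp
      qed (rule on)
      then show ?thesis by (intro exI[of _ x]) auto
    qed
    show "h x = \<one>\<^bsub>?H\<^esub> \<longleftrightarrow> (\<exists>m\<in>edge_monoid. \<exists>m'\<in>edge_monoid.
        \<forall>j\<in>facets. x j = int (facet_fun j m) - int (facet_fun j m'))" for x
    proof -
      have "h x = \<one>\<^bsub>?H\<^esub> \<longleftrightarrow> (\<forall>i\<in>{1..n}. h x i = 0)"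
        by (auto simp: h_def fun_eq_iff)
      also have "\<dots> \<longleftrightarrow> (\<exists>t. total x = 2 * t \<and> (\<forall>c\<in>{1..n}. colour_sum x c = t))"
      proof
        assume h: "\<forall>i\<in>{1..n}. h x i = 0"
        have "total x = 2 * colour_sum x 1" using h[rule_format, of 1] n by (simp add: h_def)
        moreover have "colour_sum x i = colour_sum x 1" if "i \<in> {1..n}" for i
          using h[rule_format, OF that] that by (auto simp: h_def split: if_splits)
        ultimately show "\<exists>t. total x = 2 * t \<and> (\<forall>c\<in>{1..n}. colour_sum x c = t)" by blast
      next
        assume "\<exists>t. total x = 2 * t \<and> (\<forall>c\<in>{1..n}. colour_sum x c = t)"
        then obtain t where "total x = 2 * t" "\<forall>c\<in>{1..n}. colour_sum x c = t" by blast
        then show "\<forall>i\<in>{1..n}. h x i = 0" using n by (auto simp: h_def)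
      qed
      finally show ?thesis unfolding principal_lattice_iff colours .
    qed
  qed
  moreover have "{a, b} \<in> multipartite_edges n r \<longleftrightarrow> a \<in> ?V \<and> b \<in> ?V \<and> fst a \<noteq> fst b" for a b
    unfolding multipartite_edges_def mem_Collect_eq doubleton_eq_iff by metis
  then have "(edge_ring ?V (multipartite_edges n r) :: ((nat \<times> nat \<Rightarrow>\<^sub>0 nat) \<Rightarrow>\<^sub>0 'k) ring) = R.ring_on"
    by (rule edge_ring_eq)
  ultimately show ?thesis by simp
qed

end
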